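(* Let $X$ be $\mathbb{R}^d$, $\mathbb{C}$, $\mathbb{H}$, or $\mathbb{O}$, with a lattice $\mathcal{Z}$ that is integral, unit-generated, norm-Euclidean, nicely invertible with respect to an inversion $\iota$, and either 3-remote or 7-remote; let $K$ be its Dirichlet region and $T$ the associated continued fraction map. Let $\mu$ be the unique $T$-invariant probability measure equivalent to Lebesgue measure $\lambda$. Then $\mu$ has a density $d\mu/d\lambda$ that is (real-)analytic on each connected component of $K\setminus\bigcup_{n\ge0}T^n\partial K$.
   Context: $\mathbb{C},\mathbb{H},\mathbb{O}$ are identified with $\mathbb{R}^2,\mathbb{R}^4,\mathbb{R}^8$; norms, distances, dot products are Euclidean. An inversion is a map $\iota:X\setminus\{0\}\to X\setminus\{0\}$ with $|\iota x|=1/|x|$ and $d(\iota x,\iota y)=d(x,y)/(|x||y|)$ (equivalently $\iota(x)=\mathcal{O}(x)/|x|^2$, $\mathcal{O}$ orthogonal), assumed to satisfy $\iota\circ\iota=\mathrm{id}$; $\iota(0)=0$. A lattice is a discrete additive subgroup with compact quotient. Dirichlet region $K=\{x:d(x,0)\le d(x,z)\ \forall z\in\mathcal{Z}\}$ with a boundary choice so each $x$ has a unique $[x]\in\mathcal{Z}$ with $x-[x]\in K$; $\operatorname{rad}(K)=\sup_{x\in K}|x|$. $Tx=\iota x-[\iota x]$ for $x\ne0$, $T0=0$. Integral: $z\cdot z\in\mathbb{Z}$ for all $z\in\mathcal{Z}$. Unit-generated: every element is a sum of lattice points of norm $1$. Nicely invertible: $|z|^2\iota(z)\in\mathcal{Z}$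 for all nonzero $z\in\mathcal{Z}$. Norm-Euclidean: $\operatorname{rad}(K)<1$. 3-remote: $\inf_{x\in K}d(z,x)\ge1$ for all $z\in\mathcal{Z}$ with $|z|=\sqrt3$. 7-remote: $\inf_{x\in K}d(z/2,x)\ge1/2$ for all $z\in\mathcal{Z}$ with $|z|=\sqrt7$. *)

theory Defs
  imports "HOL-Analysis.Analysis" "HOL-Probability.Probability_Measure"
begin

(* X is modelled as an arbitrary Euclidean space 'a (covers R^d, C = R^2, H = R^4, O = R^8). *)

definition is_inversion :: "('a::euclidean_space \<Rightarrow> 'a) \<Rightarrow> bool" where
  "is_inversion \<iota> \<longleftrightarrow>
     (\<exists>Q. orthogonal_transformation Q \<and> (\<forall>x. x \<noteq> 0 \<longrightarrow> \<iota> x = (1 / (norm x)\<^sup>2) *\<^sub>R Q x))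
     \<and> \<iota> 0 = 0 \<and> (\<forall>x. \<iota> (\<iota> x) = x)"

definition is_lattice :: "'a::euclidean_space set \<Rightarrow> bool" where
  "is_lattice Z \<longleftrightarrow>
     0 \<in> Z \<and> (\<forall>x\<in>Z. \<forall>y\<in>Z. x + y \<in> Z) \<and> (\<forall>x\<in>Z. - x \<in> Z)
     \<and> (\<exists>e>0. \<forall>z\<in>Z. z \<noteq> 0 \<longrightarrow> e \<le> norm z)
     \<and> (\<exists>C. compact C \<and> (\<forall>x. \<exists>z\<in>Z. x - z \<in> C))"

definition dirichlet :: "'a::euclidean_space set \<Rightarrow> 'a set" where
  "dirichlet Z = {x. \<forall>z\<in>Z. dist x 0 \<le> dist x z}"

definition dirichlet_with_boundary_choice :: "'a::euclidean_space set \<Rightarrow> 'a set \<Rightarrow> bool" where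
  "dirichlet_with_boundary_choice Z K \<longleftrightarrow>
     K \<subseteq> dirichlet Z \<and> (\<forall>x. \<exists>!z. z \<in> Z \<and> x - z \<in> K)"

definition lattice_rep :: "'a::euclidean_space set \<Rightarrow> 'a set \<Rightarrow> 'a \<Rightarrow> 'a" where
  "lattice_rep Z K x = (THE z. z \<in> Z \<and> x - z \<in> K)"

definition cf_map :: "('a::euclidean_space \<Rightarrow> 'a) \<Rightarrow> 'a set \<Rightarrow> 'a set \<Rightarrow> 'a \<Rightarrow> 'a" where
  "cf_map \<iota> Z K x = (if x = 0 then 0 else \<iota> x - lattice_rep Z K (\<iota> x))"

definition integral_lattice :: "'a::euclidean_space set \<Rightarrow> bool" where
  "integral_lattice Z \<longleftrightarrow> (\<forall>z\<in>Z. z \<bullet> z \<in> \<int>)"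

definition unit_generated :: "'a::euclidean_space set \<Rightarrow> bool" where
  "unit_generated Z \<longleftrightarrow>
     (\<forall>z\<in>Z. \<exists>us. set us \<subseteq> {u\<in>Z. norm u = 1} \<and> sum_list us = z)"

definition nicely_invertible :: "'a::euclidean_space set \<Rightarrow> ('a \<Rightarrow> 'a) \<Rightarrow> bool" where
  "nicely_invertible Z \<iota> \<longleftrightarrow> (\<forall>z\<in>Z. z \<noteq> 0 \<longrightarrow> (norm z)\<^sup>2 *\<^sub>R \<iota> z \<in> Z)"

definition norm_euclidean :: "'a::euclidean_space set \<Rightarrow> bool" where
  "norm_euclidean K \<longleftrightarrow> (SUP x\<in>K. norm x) < 1"

definition remote3 :: "'a::euclidean_space set \<Rightarrow> 'a set \<Rightarrow> bool" where
  "remote3 Z K \<longleftrightarrow> (\<forall>z\<in>Z. norm z = sqrt 3 \<longrightarrow> (INF x\<in>K. dist z x) \<ge> 1)"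

definition remote7 :: "'a::euclidean_space set \<Rightarrow> 'a set \<Rightarrow> bool" where
  "remote7 Z K \<longleftrightarrow>
     (\<forall>z\<in>Z. norm z = sqrt 7 \<longrightarrow> (INF x\<in>K. dist ((1/2) *\<^sub>R z) x) \<ge> 1/2)"

definition multi_indices :: "('a::euclidean_space \<Rightarrow> nat) set" where
  "multi_indices = {\<alpha>. \<forall>i. i \<notin> Basis \<longrightarrow> \<alpha> i = 0}"

definition real_analytic_on :: "('a::euclidean_space \<Rightarrow> real) \<Rightarrow> 'a set \<Rightarrow> bool" where
  "real_analytic_on f S \<longleftrightarrow>
     (\<forall>x\<in>S. \<exists>r>0. \<exists>c :: ('a \<Rightarrow> nat) \<Rightarrow> real. \<forall>h. norm h < r \<longrightarrow>
        ((\<lambda>\<alpha>. c \<alpha> * (\<Prod>i\<in>Basis. (h \<bullet> i) ^ \<alpha> i)) has_sum f (x + h)) multi_indices)"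

end

theory Submission
  imports Defs "HOL-Complex_Analysis.Great_Picard"
begin

text \<open>
  The inverse branches of \<open>T\<close> are the maps \<open>x \<mapsto> \<iota>(x + z)\<close>, \<open>z \<in> Z\<close>.  Up to positive factors, composing
  with them preserves a family of hyperplanes \<open>x \<bullet> u = 0\<close>, unit spheres centred at lattice points and
  spheres of radius \<open>1/2\<close> centred at half lattice points, and the remoteness hypothesis leaves only
  finitely many members that meet the interior \<open>E\<close> of the Dirichlet region.  Hence a point \<open>x0\<close> outside
  all images \<open>T^n \<partial>K\<close> has a ball on which every composed branch \<open>s\<close> is either defined throughout, with
  values in \<open>E\<close>, or nowhere.  On this ball invariance reads \<open>\<mu> A = \<Sum>s. \<mu> (s A)\<close>, the sum being over all
  branches of length \<open>n\<close>.

  The Jacobian of \<open>s\<close> is \<open>1 / den s ^ d\<close>, and \<open>den s\<close> is constant or a multiple of \<open>|x - p|^2\<close> with a pole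
  \<open>p\<close> outside the ball.  Since branches contract, \<open>\<mu> (s A)\<close> is close to
  \<open>\<mu> (s B) leb (s A) / leb (s B)\<close>, so \<open>\<mu>\<close> is close to the measure whose density \<open>H_n\<close> is a positive
  combination, of bounded total weight, of the functions \<open>mobius_kernel q\<close> with \<open>|q| \<le> 1/\<epsilon>\<close>.  Their power
  series are bounded uniformly, hence a subsequence of \<open>H_n\<close> converges to an analytic function, which
  is a density of \<open>\<mu>\<close> near \<open>x0\<close>.
\<close>

section \<open>Power series of the kernels\<close>

text \<open>The wall family is closed under pull-back for an arithmetic reason. Along
  \<open>x \<mapsto> \<iota> (x + z)\<close> the equation of the unit sphere about w acquires the
  leading coefficient |w|^2 - 1, so |w|^2 = 0, 1, 2, 3 give a unit sphere, a hyperplane, a unit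
  sphere and a sphere of radius 1/2, and larger |w| miss \<open>E\<close>. Spheres of radius 1/2
  about w/2 occur only with |w|^2 odd; 1, 3, 5 lead back into the family and 7 would leave it. The
  3-remote condition stops the chain before radius 1/2 can arise from a unit sphere, the 7-remote
  condition one step later. The density of the measure is merely integrable, so the averages use
  ratios of mass to volume as weights and not values of a density. The comparison yields only an
  upper bound for the measure of \<open>A\<close>, with an error independent of \<open>A\<close>; it
  becomes an equality since the averaged densities have the right mass on the whole ball. The limit
  is taken in the coefficients of the power series, so analyticity survives without passing to
  complex variables.\<close>

lemma has_sum_group_by:
  fixes f :: "'b \<Rightarrow> real"
  assumes f: "f summable_on L" and E: "\<And>l. l \<in> L \<Longrightarrow> E l \<in> M"
  shows "((\<lambda>\<alpha>. infsum f {l \<in> L. E l = \<alpha>}) has_sum infsum f L) M"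
proof -
  have bij: "bij_betw snd (Sigma M (\<lambda>\<alpha>. {l \<in> L. E l = \<alpha>})) L"
    by (rule bij_betwI[where g = "\<lambda>l. (E l, l)"]) (use E in auto)
  have "((\<lambda>p. f (snd p)) has_sum infsum f L) (Sigma M (\<lambda>\<alpha>. {l \<in> L. E l = \<alpha>}))"
    using has_sum_reindex_bij_betw[OF bij, of f] f by simp
  moreover have "((\<lambda>l. f (snd (\<alpha>, l))) has_sum infsum f {l \<in> L. E l = \<alpha>}) {l \<in> L. E l = \<alpha>}" for \<alpha>
    using summable_on_subset_banach[OF f, of "{l \<in> L. E l = \<alpha>}"] by auto
  ultimately show ?thesis
    by (rule has_sum_SigmaD)
qed

text \<open>Words over \<open>J\<close> replace the multinomial theorem: expanding letter by letter
  needs no coefficients. Words that carry the same monomial are merged only at the end, by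
  \<open>power_series_regroup\<close>.\<close>

lemma sum_power_lists:
  fixes m :: "'b \<Rightarrow> real"
  assumes "finite J"
  shows "(\<Sum>j\<in>J. m j) ^ k = (\<Sum>l | set l \<subseteq> J \<and> length l = k. prod_list (map m l))"
proof (induction k)
  case 0
  have "{l. set l \<subseteq> J \<and> length l = 0} = {[]}" by auto
  then show ?case by simp
next
  case (Suc k)
  let ?L = "\<lambda>k. {l. set l \<subseteq> J \<and> length l = k}"
  have bij: "bij_betw (\<lambda>(j, l). j # l) (J \<times> ?L k) (?L (Suc k))"
    by (rule bij_betwI[where g = "\<lambda>l. (hd l, tl l)"]) (auto simp: length_Suc_conv)
  have "(\<Sum>l\<in>?L (Suc k). prod_list (map m l)) = (\<Sum>(j, l)\<in>J \<times> ?L k. m j * prod_list (map m l))"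
    by (subst sum.reindex_bij_betw[OF bij, symmetric]) (auto intro!: sum.cong)
  also have "\<dots> = (\<Sum>j\<in>J. m j) * (\<Sum>l\<in>?L k. prod_list (map m l))"
    by (simp add: sum_product sum.cartesian_product)
  finally show ?case using Suc by simp
qed

lemma summable_on_lists:
  fixes m :: "'b \<Rightarrow> real"
  assumes J: "finite J" and a: "summable (\<lambda>k. \<bar>a k\<bar> * (\<Sum>j\<in>J. \<bar>m j\<bar>) ^ k)"
  shows "(\<lambda>l. \<bar>a (length l)\<bar> * prod_list (map (\<lambda>j. \<bar>m j\<bar>) l)) summable_on lists J"
proof -
  let ?L = "\<lambda>k. {l. set l \<subseteq> J \<and> length l = k}"
  have fin: "finite (?L k)" for k using finite_lists_length_eq[OF J] .
  have pos: "0 \<le> prod_list (map (\<lambda>j. \<bar>m j\<bar>) l)" for l by (induction l) auto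
  have "(\<lambda>l. \<bar>a (length l)\<bar> * prod_list (map (\<lambda>j. \<bar>m j\<bar>) l)) summable_on (\<Union>k\<in>UNIV. ?L k)"
  proof (rule summable_on_UnionI)
    show "((\<lambda>l. \<bar>a (length l)\<bar> * prod_list (map (\<lambda>j. \<bar>m j\<bar>) l)) has_sum
             (\<bar>a k\<bar> * (\<Sum>j\<in>J. \<bar>m j\<bar>) ^ k)) (?L k)" for k
      by (rule has_sum_finiteI[OF fin]) (simp add: sum_power_lists[OF J] sum_distrib_left)
    show "(\<lambda>k. \<bar>a k\<bar> * (\<Sum>j\<in>J. \<bar>m j\<bar>) ^ k) summable_on UNIV"
      by (rule summable_nonneg_imp_summable_on[OF a]) (simp add: sum_nonneg)
  qed (auto simp: pos disjoint_family_on_def)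
  also have "(\<Union>k\<in>UNIV. ?L k) = lists J" by auto
  finally show ?thesis .
qed

lemma has_sum_lists_power_series:
  fixes m :: "'b \<Rightarrow> real"
  assumes J: "finite J" and a: "summable (\<lambda>k. \<bar>a k\<bar> * (\<Sum>j\<in>J. \<bar>m j\<bar>) ^ k)"
    and s: "(\<lambda>k. a k * (\<Sum>j\<in>J. m j) ^ k) sums s"
  shows "((\<lambda>l. a (length l) * prod_list (map m l)) has_sum s) (lists J)"
proof -
  let ?f = "\<lambda>l. a (length l) * prod_list (map m l)"
  have abs: "\<bar>prod_list (map m l)\<bar> = prod_list (map (\<lambda>j. \<bar>m j\<bar>) l)" for l
    by (induction l) (auto simp: abs_mult)
  have sf: "?f summable_on lists J"
  proof (rule abs_summable_summable)
    have "norm (?f l) = \<bar>a (length l)\<bar> * prod_list (map (\<lambda>j. \<bar>m j\<bar>) l)" for l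
      by (simp only: real_norm_def abs_mult abs)
    then show "(\<lambda>l. norm (?f l)) summable_on lists J"
      using summable_on_lists[OF J a] by presburger
  qed
  have "((\<lambda>k. infsum ?f {l \<in> lists J. length l = k}) has_sum infsum ?f (lists J)) UNIV"
    by (rule has_sum_group_by[OF sf]) auto
  moreover have "infsum ?f {l \<in> lists J. length l = k} = a k * (\<Sum>j\<in>J. m j) ^ k" for k
  proof -
    have "{l \<in> lists J. length l = k} = {l. set l \<subseteq> J \<and> length l = k}" by auto
    then show ?thesis
      using finite_lists_length_eq[OF J, of k]
      by (simp add: sum_power_lists[OF J] sum_distrib_left)
  qed
  ultimately have "infsum ?f (lists J) = s"
    using sums_unique2[OF has_sum_imp_sums s, of "infsum ?f (lists J)"] by simp
  then show ?thesis using sf by (simp add: has_sum_iff)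
qed

lemma inverse_power_power_series:
  obtains a :: "nat \<Rightarrow> real" where "\<And>t. \<bar>t\<bar> < 1 \<Longrightarrow> (\<lambda>k. a k * t ^ k) sums (1 / (1 - t) ^ d)"
proof
  fix t :: real assume t: "\<bar>t\<bar> < 1"
  have "(\<lambda>k. ((- real d) gchoose k) * (- t) ^ k) sums (1 + (- t)) powr (- real d)"
    by (rule gen_binomial_real) (use t in auto)
  also have "(1 + (- t)) powr (- real d) = 1 / (1 - t) ^ d"
    using t by (simp add: powr_minus powr_realpow divide_inverse)
  also have "(\<lambda>k. ((- real d) gchoose k) * (- t) ^ k) = (\<lambda>k. (((- real d) gchoose k) * (- 1) ^ k) * t ^ k)"
    by (simp add: power_minus[of t] mult.assoc)
  finally show "(\<lambda>k. (((- real d) gchoose k) * (- 1) ^ k) * t ^ k) sums (1 / (1 - t) ^ d)" .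
qed

text \<open>Summability with every coordinate equal to \<open>\<rho>\<close> dominates all
  \<open>h\<close> with \<open>norm h \<le> \<rho>\<close> at once, so one coefficient family serves
  the whole ball.\<close>

lemma power_series_regroup:
  fixes C :: "'b \<Rightarrow> real" and E :: "'b \<Rightarrow> 'a::euclidean_space \<Rightarrow> nat"
  assumes sm: "(\<lambda>l. \<bar>C l\<bar> * \<rho> ^ (\<Sum>i\<in>Basis. E l i)) summable_on L" and \<rho>: "\<rho> > 0"
    and E: "\<And>l. l \<in> L \<Longrightarrow> E l \<in> multi_indices"
  obtains c where "\<And>h. norm h \<le> \<rho> \<Longrightarrow>
    ((\<lambda>\<alpha>. c \<alpha> * (\<Prod>i\<in>Basis. (h \<bullet> i) ^ \<alpha> i)) has_sum
      (\<Sum>\<^sub>\<infinity>l\<in>L. C l * (\<Prod>i\<in>Basis. (h \<bullet> i) ^ E l i))) multi_indices"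
proof
  let ?c = "\<lambda>\<alpha>. infsum C {l \<in> L. E l = \<alpha>}"
  fix h :: 'a assume h: "norm h \<le> \<rho>"
  let ?f = "\<lambda>l. C l * (\<Prod>i\<in>Basis. (h \<bullet> i) ^ E l i)"
  have bd: "\<bar>\<Prod>i\<in>Basis. (h \<bullet> i) ^ e i\<bar> \<le> \<rho> ^ (\<Sum>i\<in>Basis. e i)" for e :: "'a \<Rightarrow> nat"
    unfolding abs_prod power_sum power_abs
    by (intro prod_mono conjI zero_le_power abs_ge_zero power_mono)
       (use h Basis_le_norm order_trans in blast)+
  have "?f summable_on L"
  proof (rule abs_summable_summable, rule Infinite_Sum.abs_summable_on_comparison_test'[OF sm])
    show "norm (?f l) \<le> \<bar>C l\<bar> * \<rho> ^ (\<Sum>i\<in>Basis. E l i)" for l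
      using bd[of "E l"] by (simp add: abs_mult mult_left_mono)
  qed
  from has_sum_group_by[OF this, of E multi_indices] E
  have "((\<lambda>\<alpha>. infsum ?f {l \<in> L. E l = \<alpha>}) has_sum infsum ?f L) multi_indices" by blast
  moreover have "infsum ?f {l \<in> L. E l = \<alpha>} = ?c \<alpha> * (\<Prod>i\<in>Basis. (h \<bullet> i) ^ \<alpha> i)" for \<alpha>
  proof -
    have "infsum ?f {l \<in> L. E l = \<alpha>} = infsum (\<lambda>l. C l * (\<Prod>i\<in>Basis. (h \<bullet> i) ^ \<alpha> i)) {l \<in> L. E l = \<alpha>}"
      by (rule infsum_cong) auto
    then show ?thesis by (simp add: infsum_cmult_left')
  qed
  ultimately show "((\<lambda>\<alpha>. ?c \<alpha> * (\<Prod>i\<in>Basis. (h \<bullet> i) ^ \<alpha> i)) has_sum infsum ?f L) multi_indices"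
    by simp
qed

text \<open>With \<open>q = v / |v|^2\<close> this is \<open>(|v| / |h - v|)^(2 d)\<close>, the normalised Jacobian of an inversion with
  pole \<open>v\<close>; the value \<open>q = 0\<close> covers a pole at infinity.\<close>

definition mobius_kernel :: "'a::euclidean_space \<Rightarrow> 'a \<Rightarrow> real" where
  "mobius_kernel q h = 1 / (1 - 2 * (h \<bullet> q) + (norm h)\<^sup>2 * (norm q)\<^sup>2) ^ DIM('a)"

text \<open>The kernel is 1 / (1 - t)^d with t = 2 (h . q) - |h|^2 |q|^2, a polynomial in the
  coordinates of \<open>h\<close>. Expanding in words in its monomials gives bounds \<open>M\<close>
  that depend on \<open>R\<close> but not on \<open>q\<close>; the compactness argument lives on
  this uniformity.\<close>

lemma mobius_kernel_expansion:
  fixes R :: real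
  assumes R: "R > 0"
  obtains \<rho> :: real and L :: "('a::euclidean_space \<times> bool) list set"
    and E :: "('a \<times> bool) list \<Rightarrow> 'a \<Rightarrow> nat" and cf M
  where "\<rho> > 0" "countable L" "\<And>l. l \<in> L \<Longrightarrow> E l \<in> multi_indices"
    "\<And>l q. l \<in> L \<Longrightarrow> norm q \<le> R \<Longrightarrow> \<bar>cf l q\<bar> \<le> M l"
    "(\<lambda>l. M l * \<rho> ^ (\<Sum>i\<in>Basis. E l i)) summable_on L"
    "\<And>q h. norm q \<le> R \<Longrightarrow> norm h \<le> \<rho> \<Longrightarrow>
       ((\<lambda>l. cf l q * (\<Prod>i\<in>Basis. (h \<bullet> i) ^ E l i)) has_sum mobius_kernel q h) L"
proof -
  \<comment> \<open>A letter (i, b) stands for one monomial of t: 2 (q . i) (h . i) if b is false, -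
    |q|^2 (h . i)^2 if b is true. \<open>e\<close> holds its exponents, \<open>b0\<close> its
    coefficient, and \<open>bm\<close> a bound for the coefficient when |q| \<le> R.\<close>
  define J where "J = (Basis :: 'a set) \<times> (UNIV :: bool set)"
  define e :: "'a \<times> bool \<Rightarrow> 'a \<Rightarrow> nat"
    where "e = (\<lambda>(i, b) i'. if i' = i then (if b then 2 else 1) else 0)"
  define b0 :: "'a \<Rightarrow> 'a \<times> bool \<Rightarrow> real"
    where "b0 = (\<lambda>q (i, b). if b then - (norm q)\<^sup>2 else 2 * (q \<bullet> i))"
  define bm :: "'a \<times> bool \<Rightarrow> real" where "bm = (\<lambda>(i, b). if b then R\<^sup>2 else 2 * R)"
  \<comment> \<open>With this radius the linear and quadratic letters contribute 1/4 and 1 / (64 d)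
    to \<open>\<tau>\<close>, which therefore stays below 1.\<close>
  define \<rho> where "\<rho> = 1 / (8 * DIM('a) * R)"
  define \<tau> where "\<tau> = (\<Sum>j\<in>J. bm j * \<rho> ^ (\<Sum>i\<in>Basis. e j i))"
  define E where "E = (\<lambda>l (i::'a). sum_list (map (\<lambda>j. e j i) l))"
  obtain a :: "nat \<Rightarrow> real"
    where a: "\<And>t. \<bar>t\<bar> < 1 \<Longrightarrow> (\<lambda>k. a k * t ^ k) sums (1 / (1 - t) ^ DIM('a))"
    using inverse_power_power_series by blast
  define cf where "cf = (\<lambda>l q. a (length l) * prod_list (map (b0 q) l))"
  define M where "M = (\<lambda>l. \<bar>a (length l)\<bar> * prod_list (map bm l))"
  have J: "finite J" unfolding J_def by simp
  have \<rho>: "\<rho> > 0" using R by (simp add: \<rho>_def)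
  have bm0: "0 \<le> bm j" for j using R by (simp add: bm_def split_beta)
  have deg: "(\<Sum>i\<in>Basis. e (i', b) i) = (if b then 2 else 1)" if "i' \<in> Basis" for i' b
    using that by (simp add: e_def sum.delta)
  have sumJ: "(\<Sum>j\<in>J. F j) = (\<Sum>i\<in>Basis. F (i, False) + F (i, True))" for F :: "_ \<Rightarrow> real"
    unfolding J_def using sum.cartesian_product[of "\<lambda>i b. F (i, b)" UNIV Basis]
    by (simp add: UNIV_bool sum.distrib add.commute)
  have "\<tau> = DIM('a) * (2 * R * \<rho> + R\<^sup>2 * \<rho>\<^sup>2)"
    unfolding \<tau>_def sumJ by (simp add: deg bm_def cong: sum.cong)
  also have "\<dots> = 1/4 + 1 / (64 * DIM('a))"
    using R by (simp add: \<rho>_def field_simps power2_eq_square)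
  also have "\<dots> \<le> 1/4 + 1/64"
    by (simp add: field_simps)
  finally have \<tau>1: "\<tau> < 1" by simp
  have \<tau>0: "0 \<le> \<tau>" unfolding \<tau>_def using bm0 \<rho> by (intro sum_nonneg) auto
  obtain t where t: "\<tau> < t" "t < 1" using \<tau>1 dense by blast
  have sa: "summable (\<lambda>k. \<bar>a k\<bar> * s ^ k)" if "0 \<le> s" "s \<le> \<tau>" for s
  proof -
    have "summable (\<lambda>k. a k * t ^ k)" using a[of t] t \<tau>0 by (auto simp: sums_iff)
    from powser_insidea[OF this, of s] show ?thesis using that t by (simp add: abs_mult power_abs)
  qed
  have expE: "(\<Prod>i\<in>Basis. x i ^ E l i) = prod_list (map (\<lambda>j. \<Prod>i\<in>Basis. x i ^ e j i) l)"
    for x :: "'a \<Rightarrow> real" and l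
    by (induction l) (simp_all add: E_def power_add prod.distrib)
  have prodmul: "prod_list (map f l) * prod_list (map g l) = prod_list (map (\<lambda>j. f j * g j) l)"
    for f g :: "'a \<times> bool \<Rightarrow> real" and l
    by (induction l) simp_all
  have absb: "\<bar>b0 q j\<bar> \<le> bm j" if "norm q \<le> R" "j \<in> J" for q j
  proof -
    have "\<bar>q \<bullet> i\<bar> \<le> R" if "i \<in> Basis" for i
      using Basis_le_norm[OF that, of q] \<open>norm q \<le> R\<close> by linarith
    then show ?thesis using that by (auto simp: b0_def bm_def J_def power_mono abs_mult)
  qed
  show ?thesis
  proof (rule that[of \<rho> "lists J" E cf M])
    show "\<rho> > 0" by fact
    show "countable (lists J)" using J by (simp add: countable_finite)
    show "E l \<in> multi_indices" if "l \<in> lists J" for l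
      unfolding multi_indices_def E_def
    proof (intro CollectI allI impI)
      fix i :: 'a assume i: "i \<notin> Basis"
      show "sum_list (map (\<lambda>j. e j i) l) = 0"
        using that by (induction l) (use i in \<open>auto simp: e_def J_def\<close>)
    qed
    show "\<bar>cf l q\<bar> \<le> M l" if "l \<in> lists J" "norm q \<le> R" for l q
    proof -
      have "\<bar>prod_list (map (b0 q) l)\<bar> \<le> prod_list (map bm l)"
        using that(1)
      proof (induction l)
        case (Cons j l)
        then show ?case using absb[OF that(2), of j] bm0 by (auto simp: abs_mult intro!: mult_mono)
      qed simp
      then show ?thesis by (simp add: cf_def M_def abs_mult mult_left_mono)
    qed
    have M': "M l * \<rho> ^ (\<Sum>i\<in>Basis. E l i)
        = \<bar>a (length l)\<bar> * prod_list (map (\<lambda>j. \<bar>bm j * \<rho> ^ (\<Sum>i\<in>Basis. e j i)\<bar>) l)" for l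
    proof -
      have "\<rho> ^ (\<Sum>i\<in>Basis. E l i) = prod_list (map (\<lambda>j. \<rho> ^ (\<Sum>i\<in>Basis. e j i)) l)"
        using expE[of "\<lambda>_. \<rho>" l] by (simp add: power_sum)
      then show ?thesis
        using bm0 \<rho> by (simp add: M_def mult.assoc prodmul abs_mult)
    qed
    show "(\<lambda>l. M l * \<rho> ^ (\<Sum>i\<in>Basis. E l i)) summable_on lists J"
      unfolding M'
    proof (rule summable_on_lists[OF J])
      have "(\<Sum>j\<in>J. \<bar>bm j * \<rho> ^ (\<Sum>i\<in>Basis. e j i)\<bar>) = \<tau>"
        unfolding \<tau>_def using bm0 \<rho> by (intro sum.cong) (auto simp: abs_mult)
      then show "summable (\<lambda>k. \<bar>a k\<bar> * (\<Sum>j\<in>J. \<bar>bm j * \<rho> ^ (\<Sum>i\<in>Basis. e j i)\<bar>) ^ k)"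
        using sa[OF \<tau>0] by simp
    qed
    show "((\<lambda>l. cf l q * (\<Prod>i\<in>Basis. (h \<bullet> i) ^ E l i)) has_sum mobius_kernel q h) (lists J)"
      if q: "norm q \<le> R" and h: "norm h \<le> \<rho>" for q h
    proof -
      let ?m = "\<lambda>j. b0 q j * (\<Prod>i\<in>Basis. (h \<bullet> i) ^ e j i)"
      have mon: "(\<Prod>i\<in>Basis. (h \<bullet> i) ^ e (i', b) i) = (h \<bullet> i') ^ (if b then 2 else 1)"
        if "i' \<in> Basis" for i' b
      proof -
        have "(\<Prod>i\<in>Basis. (h \<bullet> i) ^ e (i', b) i)
            = (\<Prod>i\<in>Basis. if i = i' then (h \<bullet> i') ^ (if b then 2 else 1) else 1)"
          by (intro prod.cong) (auto simp: e_def)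
        then show ?thesis using that by (simp add: prod.delta)
      qed
      have hi: "\<bar>h \<bullet> i\<bar> \<le> \<rho>" if "i \<in> Basis" for i
        using Basis_le_norm[OF that, of h] h by linarith
      have le: "\<bar>?m j\<bar> \<le> bm j * \<rho> ^ (\<Sum>i\<in>Basis. e j i)" if "j \<in> J" for j
        unfolding abs_mult abs_prod power_sum power_abs
        using absb[OF q that] bm0 hi by (intro mult_mono prod_mono prod_nonneg conjI power_mono) auto
      have "(\<Sum>j\<in>J. ?m j) = 2 * (h \<bullet> q) - (norm h)\<^sup>2 * (norm q)\<^sup>2"
      proof -
        have "(\<Sum>j\<in>J. ?m j) = (\<Sum>i\<in>Basis. 2 * ((h \<bullet> i) * (q \<bullet> i)) - (norm q)\<^sup>2 * ((h \<bullet> i) * (h \<bullet> i)))"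
          unfolding sumJ by (intro sum.cong) (simp_all add: mon b0_def power2_eq_square)
        also have "\<dots> = 2 * (h \<bullet> q) - (norm q)\<^sup>2 * (h \<bullet> h)"
          by (simp add: sum_subtractf sum_distrib_left[symmetric] euclidean_inner[of h q] euclidean_inner[of h h])
        finally show ?thesis by (simp add: power2_norm_eq_inner mult.commute)
      qed
      note sm = this
      have s\<tau>: "(\<Sum>j\<in>J. \<bar>?m j\<bar>) \<le> \<tau>" unfolding \<tau>_def by (intro sum_mono le)
      have "\<bar>\<Sum>j\<in>J. ?m j\<bar> < 1" using sum_abs[of ?m J] s\<tau> \<tau>1 by linarith
      then have "(\<lambda>k. a k * (\<Sum>j\<in>J. ?m j) ^ k) sums mobius_kernel q h"
        using a[of "\<Sum>j\<in>J. ?m j"] by (simp add: sm mobius_kernel_def algebra_simps)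
      from has_sum_lists_power_series[OF J sa this]
      have "((\<lambda>l. a (length l) * prod_list (map ?m l)) has_sum mobius_kernel q h) (lists J)"
        using s\<tau> by (simp add: sum_nonneg)
      then show ?thesis
        by (simp add: cf_def mult.assoc expE prodmul)
    qed
  qed
qed

text \<open>A Montel theorem for positive averages of kernels. Averaging only changes the
  coefficients, which stay below \<open>W * M l\<close>; a diagonal subsequence makes every
  coefficient converge, and the summable majorant turns this into convergence of the sums. The index
  set varies with \<open>n\<close> because branches of different lengths are averaged.\<close>

lemma mobius_kernel_averages_compact:
  fixes R :: real
  assumes R: "R > 0"
  obtains \<rho> B :: real where "\<rho> > 0" "B \<ge> 0"
    "\<And>(V :: nat \<Rightarrow> 's set) w (q :: nat \<Rightarrow> 's \<Rightarrow> 'a::euclidean_space) W.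
       (\<And>n s. s \<in> V n \<Longrightarrow> 0 \<le> w n s \<and> norm (q n s) \<le> R) \<Longrightarrow>
       (\<And>n. w n summable_on V n) \<Longrightarrow> (\<And>n. infsum (w n) (V n) \<le> W) \<Longrightarrow>
       (\<forall>n h. norm h \<le> \<rho> \<longrightarrow> (\<lambda>s. w n s * mobius_kernel (q n s) h) summable_on V n \<and>
          \<bar>\<Sum>\<^sub>\<infinity>s\<in>V n. w n s * mobius_kernel (q n s) h\<bar> \<le> W * B) \<and>
       (\<exists>k H c. strict_mono k \<and> continuous_on (cball 0 \<rho>) H \<and>
         (\<forall>h. norm h \<le> \<rho> \<longrightarrow>
            (\<lambda>n. \<Sum>\<^sub>\<infinity>s\<in>V (k n). w (k n) s * mobius_kernel (q (k n) s) h) \<longlonglongrightarrow> H h \<and>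
            ((\<lambda>\<alpha>. c \<alpha> * (\<Prod>i\<in>Basis. (h \<bullet> i) ^ \<alpha> i)) has_sum H h) multi_indices))"
proof (rule mobius_kernel_expansion[OF R])
  fix \<rho> and L :: "('a \<times> bool) list set" and E :: "('a \<times> bool) list \<Rightarrow> 'a \<Rightarrow> nat" and cf M
  assume \<rho>: "\<rho> > 0" and L: "countable L" and E: "\<And>l. l \<in> L \<Longrightarrow> E l \<in> multi_indices"
      and cfM: "\<And>l q. l \<in> L \<Longrightarrow> norm q \<le> R \<Longrightarrow> \<bar>cf l q\<bar> \<le> M l"
      and sM: "(\<lambda>l. M l * \<rho> ^ (\<Sum>i\<in>Basis. E l i)) summable_on L"
      and ker: "\<And>q h. norm q \<le> R \<Longrightarrow> norm h \<le> \<rho> \<Longrightarrow>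
       ((\<lambda>l. cf l q * (\<Prod>i\<in>Basis. (h \<bullet> i) ^ E l i)) has_sum mobius_kernel q h) L"
  define N where "N = (\<lambda>l. M l * \<rho> ^ (\<Sum>i\<in>Basis. E l i))"
  have sN: "N summable_on L" unfolding N_def by (rule sM)
  have M0: "0 \<le> M l" if "l \<in> L" for l using cfM[OF that, of 0] R by auto
  have N0: "0 \<le> N l" if "l \<in> L" for l using M0[OF that] \<rho> by (simp add: N_def)
  have hE: "\<bar>\<Prod>i\<in>Basis. (h \<bullet> i) ^ e i\<bar> \<le> \<rho> ^ (\<Sum>i\<in>Basis. e i)"
    if h: "norm h \<le> \<rho>" for e :: "'a \<Rightarrow> nat" and h
    unfolding abs_prod power_sum power_abs
    by (intro prod_mono conjI zero_le_power abs_ge_zero power_mono)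
       (use h Basis_le_norm order_trans in blast)+
  have dom: "\<bar>x * (\<Prod>i\<in>Basis. (h \<bullet> i) ^ E l i)\<bar> \<le> X * N l"
    if "norm h \<le> \<rho>" "\<bar>x\<bar> \<le> X * M l" "l \<in> L" for x X h l
  proof -
    have "0 \<le> X * M l" using that(2) by linarith
    then have "\<bar>x\<bar> * \<bar>\<Prod>i\<in>Basis. (h \<bullet> i) ^ E l i\<bar> \<le> (X * M l) * \<rho> ^ (\<Sum>i\<in>Basis. E l i)"
      using hE[OF that(1), of "E l"] that(2) by (intro mult_mono) auto
    then show ?thesis by (simp add: abs_mult N_def mult.assoc)
  qed
  show ?thesis
  proof (rule that[of \<rho> "infsum N L"], goal_cases)
    case 1 show ?case by (rule \<rho>)
  next
    case 2 show ?case by (rule infsum_nonneg) (rule N0)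
  next
    case prems: (3 V w q W)
    have w0: "0 \<le> w n s" and qR: "norm (q n s) \<le> R" if "s \<in> V n" for n s
      using prems(1) that by auto
    have W0: "0 \<le> W" using infsum_nonneg[of "V 0" "w 0"] w0 prems(3)[of 0] by fastforce
    define C where "C = (\<lambda>n l. \<Sum>\<^sub>\<infinity>s\<in>V n. w n s * cf l (q n s))"
    have Cs: "((\<lambda>s. w n s * cf l (q n s)) has_sum C n l) (V n) \<and> \<bar>C n l\<bar> \<le> W * M l"
      if l: "l \<in> L" for n l
    proof -
      have 1: "(\<lambda>s. w n s * M l) summable_on V n"
        using prems(2) by (rule summable_on_cmult_left)
      have 2: "norm (w n s * cf l (q n s)) \<le> w n s * M l" if "s \<in> V n" for s
        using cfM[OF l qR[OF that]] w0[OF that] by (simp add: abs_mult mult_left_mono)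
      have "(\<lambda>s. norm (w n s * cf l (q n s))) summable_on V n"
        using Infinite_Sum.abs_summable_on_comparison_test'[OF 1 2] .
      then have 3: "((\<lambda>s. w n s * cf l (q n s)) has_sum C n l) (V n)"
        unfolding C_def by (rule has_sum_infsum[OF abs_summable_summable])
      have "\<bar>C n l\<bar> \<le> infsum (w n) (V n) * M l"
        using norm_infsum_le[OF 3 _ 2, of "infsum (w n) (V n) * M l"]
          has_sum_cmult_left[OF has_sum_infsum[OF prems(2)], of n "M l"] by simp
      also have "\<dots> \<le> W * M l" using prems(3) M0[OF l] by (rule mult_right_mono)
      finally show ?thesis using 3 by blast
    qed
    have Hn: "((\<lambda>l. C n l * (\<Prod>i\<in>Basis. (h \<bullet> i) ^ E l i)) has_sum
                (\<Sum>\<^sub>\<infinity>s\<in>V n. w n s * mobius_kernel (q n s) h)) L \<and>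
              (\<lambda>s. w n s * mobius_kernel (q n s) h) summable_on V n" if h: "norm h \<le> \<rho>" for n h
    proof -
      let ?P = "\<lambda>l. \<Prod>i\<in>Basis. (h \<bullet> i) ^ E l i"
      \<comment> \<open>Summing this double series over \<open>l\<close> first gives the average of
        the kernels; summing over \<open>s\<close> first gives the series with the averaged
        coefficients \<open>C n l\<close>.\<close>
      let ?F = "\<lambda>(s, l). w n s * (cf l (q n s) * ?P l)"
      have 1: "(\<lambda>(s, l). w n s * N l) summable_on (V n \<times> L)"
        by (rule summable_on_SigmaI[where g = "\<lambda>s. w n s * infsum N L"])
           (use sN w0 N0 prems(2) in \<open>auto intro!: has_sum_cmult_right summable_on_cmult_left\<close>)
      have "(\<lambda>p. norm (?F p)) summable_on (V n \<times> L)"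
      proof (rule Infinite_Sum.abs_summable_on_comparison_test'[OF 1], clarify)
        fix s l assume "s \<in> V n" "l \<in> L"
        then have "\<bar>cf l (q n s) * ?P l\<bar> \<le> 1 * N l"
          using cfM qR by (intro dom h) auto
        then show "norm (w n s * (cf l (q n s) * ?P l)) \<le> w n s * N l"
          using w0[OF \<open>s \<in> V n\<close>] by (simp add: abs_mult mult_left_mono)
      qed
      then have F: "?F summable_on (V n \<times> L)" by (rule abs_summable_summable)
      then obtain T where T: "(?F has_sum T) (V n \<times> L)" by (auto simp: summable_on_def)
      have A: "((\<lambda>s. w n s * mobius_kernel (q n s) h) has_sum T) (V n)"
        by (rule has_sum_SigmaD[OF T]) (use ker[OF qR h] in \<open>auto intro!: has_sum_cmult_right\<close>)
      have T': "((\<lambda>(l, s). w n s * (cf l (q n s) * ?P l)) has_sum T) (L \<times> V n)"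
        using T by (subst has_sum_swap) simp
      have "((\<lambda>l. C n l * ?P l) has_sum T) L"
      proof (rule has_sum_SigmaD[OF T'])
        fix l assume "l \<in> L"
        from has_sum_cmult_left[OF conjunct1[OF Cs[OF this, of n]], of "?P l"]
        show "((\<lambda>s. case (l, s) of (l, s) \<Rightarrow> w n s * (cf l (q n s) * ?P l)) has_sum C n l * ?P l) (V n)"
          by (simp add: mult.assoc)
      qed
      then show ?thesis using A by (simp add: infsumI has_sum_imp_summable)
    qed
    have Cbd: "\<bar>C n l * (\<Prod>i\<in>Basis. (h \<bullet> i) ^ E l i)\<bar> \<le> W * N l"
      if "norm h \<le> \<rho>" "l \<in> L" for n h l
      using that Cs by (intro dom) auto
    have part1: "\<bar>\<Sum>\<^sub>\<infinity>s\<in>V n. w n s * mobius_kernel (q n s) h\<bar> \<le> W * infsum N L" if h: "norm h \<le> \<rho>" for n h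
      using norm_infsum_le[OF conjunct1[OF Hn[OF h, of n]]
          has_sum_cmult_right[OF has_sum_infsum[OF sN], of W]] Cbd[OF h] by simp
    \<comment> \<open>Dividing by \<open>M l\<close> produces one bound for all words, as the
      diagonal extraction requires. Where \<open>M l = 0\<close> the quotient is 0 by convention and
      \<open>C n l\<close> vanishes itself, so multiplying back recovers it.\<close>
    have "\<bar>C n l / M l\<bar> \<le> W" if "l \<in> L" for n l
      using Cs[OF that, of n] M0[OF that] W0 by (cases "M l = 0") (auto simp: field_simps)
    then obtain k where k: "strict_mono (k :: nat \<Rightarrow> nat)"
      and "\<And>l. l \<in> L \<Longrightarrow> \<exists>x. (\<lambda>n. C (k n) l / M l) \<longlonglongrightarrow> x"
      using function_convergent_subsequence[OF L, of "\<lambda>n l. C n l / M l" W] by (metis real_norm_def)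
    then obtain x where x: "\<And>l. l \<in> L \<Longrightarrow> (\<lambda>n. C (k n) l / M l) \<longlonglongrightarrow> x l" by metis
    define D where "D = (\<lambda>l. x l * M l)"
    have D: "(\<lambda>n. C (k n) l) \<longlonglongrightarrow> D l" if "l \<in> L" for l
    proof -
      have "(\<lambda>n. C (k n) l / M l * M l) \<longlonglongrightarrow> D l"
        unfolding D_def by (intro tendsto_intros x that)
      moreover have "C (k n) l / M l * M l = C (k n) l" for n
        using Cs[OF that, of "k n"] by (cases "M l = 0") auto
      ultimately show ?thesis by simp
    qed
    have DM: "\<bar>D l\<bar> \<le> W * M l" if "l \<in> L" for l
      by (rule LIMSEQ_le_const2[OF tendsto_rabs[OF D[OF that]]]) (use Cs[OF that] in auto)
    define H where "H = (\<lambda>h. \<Sum>\<^sub>\<infinity>l\<in>L. D l * (\<Prod>i\<in>Basis. (h \<bullet> i) ^ E l i))"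
    have sWN: "(\<lambda>l. W * N l) summable_on L" using sN by (rule summable_on_cmult_right)
    have "(\<lambda>l. \<bar>D l\<bar> * \<rho> ^ (\<Sum>i\<in>Basis. E l i)) summable_on L"
    proof (rule summable_on_comparison_test[OF sWN])
      show "\<bar>D l\<bar> * \<rho> ^ (\<Sum>i\<in>Basis. E l i) \<le> W * N l" if "l \<in> L" for l
        unfolding N_def mult.assoc[symmetric] using DM[OF that] \<rho> by (intro mult_right_mono) auto
    qed (use \<rho> in auto)
    then obtain c where c: "\<And>h. norm h \<le> \<rho> \<Longrightarrow>
        ((\<lambda>\<alpha>. c \<alpha> * (\<Prod>i\<in>Basis. (h \<bullet> i) ^ \<alpha> i)) has_sum H h) multi_indices"
      unfolding H_def using power_series_regroup[OF _ \<rho>, of D E L] E by blast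
    have cont: "continuous_on (cball 0 \<rho>) H"
    proof (rule uniform_limit_theorem)
      show "uniform_limit (cball 0 \<rho>) (\<lambda>X h. \<Sum>l\<in>X. D l * (\<Prod>i\<in>Basis. (h \<bullet> i) ^ E l i)) H
              (finite_subsets_at_top L)"
        unfolding H_def using dom DM
        by (intro Weierstrass_m_test_general[OF _ sWN]) auto
      show "\<forall>\<^sub>F X in finite_subsets_at_top L.
              continuous_on (cball 0 \<rho>) (\<lambda>h. \<Sum>l\<in>X. D l * (\<Prod>i\<in>Basis. (h \<bullet> i) ^ E l i))"
        by (intro always_eventually allI continuous_intros)
    qed simp
    have lim: "(\<lambda>n. \<Sum>\<^sub>\<infinity>s\<in>V (k n). w (k n) s * mobius_kernel (q (k n) s) h) \<longlonglongrightarrow> H h"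
      if h: "norm h \<le> \<rho>" for h
    \<comment> \<open>The sums over finite sets of words converge uniformly in \<open>n\<close>,
      because the majorant \<open>W * N l\<close> does not involve \<open>n\<close>; hence the limit
      in \<open>n\<close> may be exchanged with the sum.\<close>
    proof (rule swap_uniform_limit')
      let ?P = "\<lambda>l. \<Prod>i\<in>Basis. (h \<bullet> i) ^ E l i"
      show "\<forall>\<^sub>F X in finite_subsets_at_top L.
              ((\<lambda>n. \<Sum>l\<in>X. C (k n) l * ?P l) \<longlongrightarrow> (\<Sum>l\<in>X. D l * ?P l)) sequentially"
        by (rule eventually_finite_subsets_at_top_weakI) (auto intro!: tendsto_intros D)
      show "((\<lambda>X. \<Sum>l\<in>X. D l * ?P l) \<longlongrightarrow> H h) (finite_subsets_at_top L)"
        unfolding H_def has_sum_def[symmetric]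
      proof (rule has_sum_infsum[OF abs_summable_summable],
          rule Infinite_Sum.abs_summable_on_comparison_test'[OF sWN])
        show "norm (D l * ?P l) \<le> W * N l" if "l \<in> L" for l
          using dom[OF h DM[OF that] that] by simp
      qed
      show "uniform_limit UNIV (\<lambda>X n. \<Sum>l\<in>X. C (k n) l * ?P l)
              (\<lambda>n. \<Sum>\<^sub>\<infinity>s\<in>V (k n). w (k n) s * mobius_kernel (q (k n) s) h) (finite_subsets_at_top L)"
        by (rule Weierstrass_m_test_general'[OF _ _ sWN]) (use Cbd[OF h] Hn[OF h] in auto)
    qed auto
    show ?case using part1 Hn k cont lim c by blast
  qed
qed

section \<open>The Jacobian of an inversion\<close>

text \<open>The admissible balls form a Vitali cover of \<open>U\<close>, so countably many disjoint
  ones exhaust it up to a Lebesgue null set, which \<open>ac\<close> makes null for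
  \<open>M\<close>. The radius bound depends on the centre because the comparison for an inversion
  degenerates near 0.\<close>

lemma emeasure_le_of_small_balls:
  fixes M N :: "'a::euclidean_space measure"
  assumes [measurable_cong]: "sets M = sets borel" "sets N = sets borel"
    and ac: "\<And>A. A \<in> sets borel \<Longrightarrow> emeasure lborel A = 0 \<Longrightarrow> emeasure M A = 0"
    and U: "open U" and \<delta>: "\<And>a. a \<in> U \<Longrightarrow> 0 < \<delta> a"
    and le: "\<And>a \<rho>. 0 < \<rho> \<Longrightarrow> \<rho> \<le> \<delta> a \<Longrightarrow> ball a \<rho> \<subseteq> U \<Longrightarrow>
               emeasure M (ball a \<rho>) \<le> c * emeasure N (ball a \<rho>)"
  shows "emeasure M U \<le> c * emeasure N U"
proof -
  define I where "I = {(a, \<rho>). 0 < \<rho> \<and> \<rho> \<le> \<delta> a \<and> ball a \<rho> \<subseteq> U}"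
  have "\<exists>i. i \<in> I \<and> x \<in> ball (fst i) (snd i) \<and> snd i < d" if x: "x \<in> U" and d: "0 < d" for x d
  proof -
    obtain e where e: "e > 0" "ball x e \<subseteq> U" using U x openE by blast
    define r where "r = min (min (d / 2) e) (\<delta> x)"
    have "0 < r" "r \<le> e" "r < d" "r \<le> \<delta> x" using e d \<delta>[OF x] by (auto simp: r_def)
    then show ?thesis using e by (intro exI[of _ "(x, r)"]) (auto simp: I_def)
  qed
  then obtain C where C: "countable C" "C \<subseteq> I"
    and disj: "pairwise (\<lambda>i j. disjnt (ball (fst i) (snd i)) (ball (fst j) (snd j))) C"
    and neg: "negligible (U - (\<Union>i\<in>C. ball (fst i) (snd i)))"
    using Vitali_covering_theorem_balls[of U I fst snd] by blast
  let ?B = "\<lambda>i. ball (fst i) (snd i)"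
  have disj': "disjoint_family_on ?B C"
    using disj by (auto simp: pairwise_def disjnt_def disjoint_family_on_def)
  have BU: "(\<Union>i\<in>C. ?B i) \<subseteq> U" using C by (fastforce simp: I_def)
  have meas: "U \<in> sets borel" "(\<Union>i\<in>C. ?B i) \<in> sets borel" using U by (auto intro!: borel_open)
  have "emeasure lborel (U - (\<Union>i\<in>C. ?B i)) = 0"
    using neg meas by (simp add: negligible_iff_null_sets null_sets_completion_iff null_sets_def)
  then have 0: "emeasure M (U - (\<Union>i\<in>C. ?B i)) = 0" using meas by (intro ac) auto
  have "emeasure M U = emeasure M ((\<Union>i\<in>C. ?B i) \<union> (U - (\<Union>i\<in>C. ?B i)))"
    using BU by (simp add: Un_absorb1)
  also have "\<dots> \<le> emeasure M (\<Union>i\<in>C. ?B i) + emeasure M (U - (\<Union>i\<in>C. ?B i))"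
    using meas assms(1) by (intro emeasure_subadditive) auto
  also have "\<dots> = (\<integral>\<^sup>+i. emeasure M (?B i) \<partial>count_space C)"
    unfolding 0 using C disj' assms(1) by (simp add: emeasure_UN_countable)
  also have "\<dots> \<le> (\<integral>\<^sup>+i. c * emeasure N (?B i) \<partial>count_space C)"
  proof (rule nn_integral_mono)
    fix i assume "i \<in> space (count_space C)"
    then have "i \<in> I" using C by auto
    then show "emeasure M (?B i) \<le> c * emeasure N (?B i)"
      using le[of "snd i" "fst i"] by (auto simp: I_def)
  qed
  also have "\<dots> = c * emeasure N (\<Union>i\<in>C. ?B i)"
    using C disj' assms(2) by (simp add: emeasure_UN_countable nn_integral_cmult)
  also have "\<dots> \<le> c * emeasure N U"
    using BU meas assms(2) by (intro mult_left_mono emeasure_mono) auto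
  finally show ?thesis .
qed

lemma ennreal_le_of_le_mult:
  fixes a b :: ennreal
  assumes "\<And>s::real. s > 1 \<Longrightarrow> a \<le> ennreal (s ^ m) * b"
  shows "a \<le> b"
proof (cases b)
  case (real r)
  show ?thesis
  proof (rule LIMSEQ_le_const)
    have "(\<lambda>n. ennreal ((1 + 1 / real (Suc n)) ^ m * r)) \<longlonglongrightarrow> ennreal ((1 + 0) ^ m * r)"
      by (intro tendsto_ennrealI tendsto_intros LIMSEQ_Suc[OF lim_1_over_n])
    then show "(\<lambda>n. ennreal ((1 + 1 / real (Suc n)) ^ m * r)) \<longlonglongrightarrow> b" using real by simp
    have "a \<le> ennreal ((1 + 1 / real (Suc n)) ^ m * r)" for n
      using assms[of "1 + 1 / real (Suc n)"] real
      by (subst ennreal_mult) (auto intro!: zero_le_power add_nonneg_nonneg)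
    then show "\<exists>N. \<forall>n\<ge>N. a \<le> ennreal ((1 + 1 / real (Suc n)) ^ m * r)" by blast
  qed
qed simp

lemma norm_diff_sq: "(norm (x - y))\<^sup>2 = (norm x)\<^sup>2 - 2 * (x \<bullet> y) + (norm y)\<^sup>2"
  for x y :: "'a::real_inner"
  using dot_norm_neg[of x y] by simp

text \<open>With \<open>inverse 0 = 0\<close> the formula also covers the point 0. The condition on
  \<open>Q\<close> reflects that \<iota> is an involution.\<close>

locale inversion =
  fixes \<iota> Q :: "'a::euclidean_space \<Rightarrow> 'a"
  assumes Q: "orthogonal_transformation Q" and QQ: "Q (Q x) = x"
    and iota_def: "\<iota> x = Q x /\<^sub>R (norm x)\<^sup>2"
begin

lemma linear_Q: "linear Q" using Q by (rule orthogonal_transformation_linear)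
lemma norm_Q [simp]: "norm (Q x) = norm x" using Q by (rule orthogonal_transformation_norm)
text \<open>An orthogonal involution is its own adjoint.\<close>

lemma Q_inner: "Q x \<bullet> y = x \<bullet> Q y"
proof -
  have "Q x \<bullet> Q (Q y) = x \<bullet> Q y" using Q unfolding orthogonal_transformation_def by blast
  then show ?thesis by (simp only: QQ)
qed
lemma norm_iota: "norm (\<iota> x) = 1 / norm x"
proof -
  have "norm (\<iota> x) = norm x / (norm x)\<^sup>2" unfolding iota_def by (simp add: divide_inverse)
  then show ?thesis by (cases "x = 0") (simp_all add: power2_eq_square)
qed
lemma iota_0 [simp]: "\<iota> 0 = 0" by (simp add: iota_def)
lemma iota_iota [simp]: "\<iota> (\<iota> x) = x"
proof (cases "x = 0")
  case False
  have "\<iota> (\<iota> x) = Q (Q x /\<^sub>R (norm x)\<^sup>2) /\<^sub>R (1 / norm x)\<^sup>2"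
    by (simp only: iota_def[of "\<iota> x"] norm_iota) (simp only: iota_def)
  then show ?thesis using False
    by (simp add: linear_cmul[OF linear_Q] QQ power_divide)
qed simp
lemma iota_eq_0_iff [simp]: "\<iota> x = 0 \<longleftrightarrow> x = 0" by (metis iota_0 iota_iota)

text \<open>Clearing the denominator turns a sphere about \<open>a\<close>, pulled back along
  \<iota>, into a quadratic polynomial in \<open>x\<close>. The sphere and ball computations below
  start from this identity.\<close>

lemma norm_iota_diff_sq:
  assumes "x \<noteq> 0"
  shows "(norm (\<iota> x - a))\<^sup>2 * (norm x)\<^sup>2 = 1 - 2 * (x \<bullet> Q a) + (norm a)\<^sup>2 * (norm x)\<^sup>2"
proof -
  have "(norm (\<iota> x - a))\<^sup>2 = (norm (\<iota> x))\<^sup>2 - 2 * (\<iota> x \<bullet> a) + (norm a)\<^sup>2"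
    by (rule norm_diff_sq)
  also have "\<iota> x \<bullet> a = (x \<bullet> Q a) / (norm x)\<^sup>2"
    by (simp add: iota_def Q_inner divide_inverse)
  finally show ?thesis using assms by (simp add: norm_iota field_simps)
qed

lemma norm_iota_diff:
  assumes "x \<noteq> 0" "y \<noteq> 0"
  shows "norm (\<iota> x - \<iota> y) = norm (x - y) / (norm x * norm y)"
proof -
  have Qi: "Q (\<iota> y) = y /\<^sub>R (norm y)\<^sup>2" by (simp add: iota_def linear_cmul[OF linear_Q] QQ)
  have "(norm (\<iota> x - \<iota> y))\<^sup>2 * (norm x)\<^sup>2 * (norm y)\<^sup>2 = (norm (x - y))\<^sup>2"
    using assms by (simp add: norm_iota_diff_sq Qi norm_iota power_divide)
      (simp add: norm_diff_sq[of x y] field_simps)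
  then have "(norm (\<iota> x - \<iota> y) * norm x * norm y)\<^sup>2 = (norm (x - y))\<^sup>2"
    by (simp add: power_mult_distrib)
  then have "norm (\<iota> x - \<iota> y) * norm x * norm y = norm (x - y)"
    by (rule power2_eq_imp_eq) auto
  then show ?thesis using assms by (simp add: field_simps)
qed

lemma iota_measurable [measurable]: "\<iota> \<in> borel_measurable borel"
proof -
  have "Q \<in> borel_measurable borel"
    using linear_Q by (intro borel_measurable_continuous_onI linear_continuous_on)
      (simp add: linear_conv_bounded_linear)
  then have "(\<lambda>x. Q x /\<^sub>R (norm x)\<^sup>2) \<in> borel_measurable borel" by measurable
  then show ?thesis by (simp add: iota_def[abs_def])
qed

text \<open>Completing the square in \<open>norm_iota_diff_sq\<close>. As 0 lies outside the ball,
  the leading coefficient \<open>k\<close> is positive and the preimage is again a ball; the point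
  0, where \<iota> is set by convention, belongs to neither side.\<close>

lemma vimage_iota_ball:
  assumes "0 < \<rho>" "\<rho> < norm a"
  shows "\<iota> -` ball a \<rho> = ball (Q a /\<^sub>R ((norm a)\<^sup>2 - \<rho>\<^sup>2)) (\<rho> / ((norm a)\<^sup>2 - \<rho>\<^sup>2))"
proof -
  define k where "k = (norm a)\<^sup>2 - \<rho>\<^sup>2"
  have k: "k > 0" using assms by (simp add: k_def power_strict_mono)
  have sq: "u\<^sup>2 < v\<^sup>2 \<longleftrightarrow> u < v" if "0 \<le> u" "0 \<le> v" for u v :: real
    using that by (auto intro: power2_less_imp_less power_strict_mono)
  have "x \<in> \<iota> -` ball a \<rho> \<longleftrightarrow> x \<in> ball (Q a /\<^sub>R k) (\<rho> / k)" for x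
  proof (cases "x = 0")
    case True
    then show ?thesis using assms k by (simp add: divide_simps)
  next
    case False
    have nx: "(norm x)\<^sup>2 > 0" using False by simp
    have "x \<in> \<iota> -` ball a \<rho> \<longleftrightarrow> (norm (\<iota> x - a))\<^sup>2 < \<rho>\<^sup>2"
      using assms by (simp add: dist_norm norm_minus_commute sq)
    also have "\<dots> \<longleftrightarrow> (norm (\<iota> x - a))\<^sup>2 * (norm x)\<^sup>2 < \<rho>\<^sup>2 * (norm x)\<^sup>2"
      using nx by simp
    also have "\<dots> \<longleftrightarrow> 1 - 2 * (x \<bullet> Q a) + k * (norm x)\<^sup>2 < 0"
      unfolding norm_iota_diff_sq[OF False] k_def by (simp add: algebra_simps)
    also have "1 - 2 * (x \<bullet> Q a) + k * (norm x)\<^sup>2 = k * ((norm (x - Q a /\<^sub>R k))\<^sup>2 - (\<rho> / k)\<^sup>2)"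
    proof -
      have e: "(norm (x - Q a /\<^sub>R k))\<^sup>2 = (norm x)\<^sup>2 - 2 * (x \<bullet> Q a) / k + (norm a)\<^sup>2 / k\<^sup>2"
      proof -
        have "(norm (x - Q a /\<^sub>R k))\<^sup>2 = (norm x)\<^sup>2 - 2 * (x \<bullet> (Q a /\<^sub>R k)) + (norm (Q a /\<^sub>R k))\<^sup>2"
          by (rule norm_diff_sq)
        then show ?thesis using k by (simp add: divide_inverse power_mult_distrib mult.commute power_inverse)
      qed
      moreover have "k * ((norm a)\<^sup>2 / k\<^sup>2 - \<rho>\<^sup>2 / k\<^sup>2) = 1"
        using k by (simp only: diff_divide_distrib[symmetric] k_def[symmetric]) (simp add: power2_eq_square)
      moreover have "k * ((norm (x - Q a /\<^sub>R k))\<^sup>2 - (\<rho> / k)\<^sup>2)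
          = k * (norm x)\<^sup>2 - k * (2 * (x \<bullet> Q a) / k) + k * ((norm a)\<^sup>2 / k\<^sup>2 - \<rho>\<^sup>2 / k\<^sup>2)"
        by (simp only: e power_divide) (simp add: algebra_simps)
      ultimately show ?thesis using k by simp
    qed
    also have "\<dots> < 0 \<longleftrightarrow> (norm (x - Q a /\<^sub>R k))\<^sup>2 < (\<rho> / k)\<^sup>2"
      using k by (simp add: mult_less_0_iff)
    also have "\<dots> \<longleftrightarrow> x \<in> ball (Q a /\<^sub>R k) (\<rho> / k)"
      using assms k by (simp add: dist_norm norm_minus_commute sq)
    finally show ?thesis .
  qed
  then show ?thesis unfolding k_def by blast
qed

lemma iota_vimage_null:
  assumes A: "A \<in> sets borel" and null: "emeasure lborel A = 0"
  shows "emeasure lborel (\<iota> -` A) = 0"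
proof -
  have "negligible (A - {0})"
    using A null by (intro negligible_diff) (auto simp: negligible_iff_null_sets null_sets_completion_iff null_sets_def)
  then have "negligible (\<iota> ` (A - {0}))"
  proof (rule negligible_locally_Lipschitz_image[rotated])
    fix x assume x: "x \<in> A - {0}"
    let ?T = "{y. norm y > norm x / 2}"
    have "open ?T" by (intro open_Collect_less continuous_intros)
    moreover have "norm (\<iota> y - \<iota> x) \<le> 2 / (norm x)\<^sup>2 * norm (y - x)" if "y \<in> ?T" for y
    proof -
      have "y \<noteq> 0" using that x by auto
      have "norm (\<iota> y - \<iota> x) = norm (y - x) / (norm y * norm x)"
        using \<open>y \<noteq> 0\<close> x by (simp add: norm_iota_diff)
      also have "\<dots> \<le> norm (y - x) / (norm x / 2 * norm x)"
        using that x \<open>y \<noteq> 0\<close> by (intro divide_left_mono mult_right_mono mult_pos_pos) auto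
      finally show ?thesis by (simp add: power2_eq_square mult.commute)
    qed
    ultimately show "\<exists>T B. open T \<and> x \<in> T \<and> (\<forall>y\<in>(A - {0}) \<inter> T. norm (\<iota> y - \<iota> x) \<le> B * norm (y - x))"
      using x by (intro exI[of _ ?T] exI[of _ "2 / (norm x)\<^sup>2"]) auto
  qed simp
  then have "negligible (insert 0 (\<iota> ` (A - {0})))" by simp
  moreover have "\<iota> -` A \<subseteq> insert 0 (\<iota> ` (A - {0}))"
  proof
    fix x assume "x \<in> \<iota> -` A"
    then show "x \<in> insert 0 (\<iota> ` (A - {0}))"
      by (cases "x = 0") (auto intro!: image_eqI[of x \<iota> "\<iota> x"])
  qed
  ultimately have "negligible (\<iota> -` A)" by (rule negligible_subset)
  moreover have "\<iota> -` A \<in> sets borel" using measurable_sets[OF iota_measurable A] by simp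
  ultimately show ?thesis
    by (simp add: negligible_iff_null_sets null_sets_completion_iff null_sets_def)
qed

text \<open>Preimages of small balls are balls of known radius, so both measures nearly agree on them, and
  the Vitali covering theorem extends this to open sets.\<close>

lemma distr_iota:
  "distr lborel borel \<iota> = density lborel (\<lambda>x. ennreal (1 / norm x ^ (2 * DIM('a))))"
  (is "?M = ?N")
proof -
  let ?d = "DIM('a)"
  have M: "emeasure ?M A = emeasure lborel (\<iota> -` A)" if "A \<in> sets borel" for A
    using that by (simp add: emeasure_distr)
  have Mac: "emeasure ?M A = 0" if "A \<in> sets borel" "emeasure lborel A = 0" for A
    using that by (simp add: M iota_vimage_null)
  have Nac: "emeasure ?N A = 0" if "A \<in> sets borel" "emeasure lborel A = 0" for A
  proof -
    have "A \<in> null_sets lborel" using that by (simp add: null_sets_def)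
    then have "A \<in> null_sets ?N"
      by (subst null_sets_density_iff) (auto intro!: AE_I'[of A])
    then show ?thesis by auto
  qed
  have balls: "emeasure ?M (ball a \<rho>) \<le> ennreal (s ^ (2 * ?d)) * emeasure ?N (ball a \<rho>) \<and>
        emeasure ?N (ball a \<rho>) \<le> ennreal (s ^ (2 * ?d)) * emeasure ?M (ball a \<rho>)"
    if s: "s > 1" and \<rho>: "0 < \<rho>" "\<rho> \<le> (s - 1) / (s + 1) * norm a" for s \<rho> :: real and a :: 'a
  proof -
    \<comment> \<open>Chosen so that (1 + t) / (1 - t) = s: on a ball of radius at most t |a| about
      \<open>a\<close> the norm varies by a factor of at most s, hence the density by at most
      \<open>s ^ (2 * ?d)\<close>.\<close>
    define t where "t = (s - 1) / (s + 1)"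
    have t: "0 < t" "t < 1" using s by (auto simp: t_def)
    have st: "s * (1 - t) = 1 + t" using s by (simp add: t_def field_simps)
    have \<rho>t: "\<rho> \<le> t * norm a" using \<rho> by (simp add: t_def)
    have a0: "0 < norm a"
      using \<rho>t \<rho> t by (metis less_le_trans zero_less_mult_pos)
    have "t * norm a < norm a" using t a0 by simp
    then have \<rho>a: "\<rho> < norm a" using \<rho>t by linarith
    define k where "k = (norm a)\<^sup>2 - \<rho>\<^sup>2"
    have k: "k > 0" using \<rho> \<rho>a by (simp add: k_def power_strict_mono)
    have ka: "k \<le> (norm a)\<^sup>2" by (simp add: k_def)
    have "\<rho>\<^sup>2 \<le> (t * norm a)\<^sup>2" using \<rho>t \<rho> by (intro power_mono) auto
    then have kb: "(1 - t\<^sup>2) * (norm a)\<^sup>2 \<le> k" by (simp add: k_def algebra_simps power_mult_distrib)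
    let ?L = "emeasure lborel (ball a \<rho>)"
    have MB: "emeasure ?M (ball a \<rho>) = ennreal ((1 / k) ^ ?d) * ?L"
      using \<rho> \<rho>a k by (simp add: M vimage_iota_ball emeasure_ball k_def[symmetric] power_divide
        ennreal_mult[symmetric] mult_ac)
    have N: "emeasure ?N (ball a \<rho>) = (\<integral>\<^sup>+x. ennreal (1 / norm x ^ (2 * ?d)) * indicator (ball a \<rho>) x \<partial>lborel)"
      by (simp add: emeasure_density)
    have nx: "(1 - t) * norm a \<le> norm x \<and> norm x \<le> (1 + t) * norm a" if "x \<in> ball a \<rho>" for x
    proof -
      have "norm (a - x) < \<rho>" using that by (simp add: dist_norm)
      then show ?thesis using norm_triangle_ineq2[of a x] norm_triangle_ineq2[of x a] \<rho>t
        by (simp add: algebra_simps norm_minus_commute)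
    qed
    have cB: "(\<integral>\<^sup>+x. ennreal c * indicator (ball a \<rho>) x \<partial>lborel) = ennreal c * ?L" for c
      by (simp add: nn_integral_cmult_indicator)
    have N1: "ennreal (1 / ((1 + t) * norm a) ^ (2 * ?d)) * ?L \<le> emeasure ?N (ball a \<rho>)"
      unfolding N cB[symmetric]
    proof (rule nn_integral_mono)
      fix x
      show "ennreal (1 / ((1 + t) * norm a) ^ (2 * ?d)) * indicator (ball a \<rho>) x
              \<le> ennreal (1 / norm x ^ (2 * ?d)) * indicator (ball a \<rho>) x"
      proof (cases "x \<in> ball a \<rho>")
        case True
        have "0 < (1 - t) * norm a" using t a0 by simp
        then have "0 < norm x" using nx[OF True] by linarith
        then show ?thesis using nx[OF True] True t a0
          by (auto intro!: ennreal_leI divide_left_mono power_mono mult_pos_pos)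
      qed simp
    qed
    have N2: "emeasure ?N (ball a \<rho>) \<le> ennreal (1 / ((1 - t) * norm a) ^ (2 * ?d)) * ?L"
      unfolding N cB[symmetric]
    proof (rule nn_integral_mono)
      fix x
      show "ennreal (1 / norm x ^ (2 * ?d)) * indicator (ball a \<rho>) x \<le>
            ennreal (1 / ((1 - t) * norm a) ^ (2 * ?d)) * indicator (ball a \<rho>) x"
      proof (cases "x \<in> ball a \<rho>")
        case True
        have "0 < (1 - t) * norm a" using t a0 by simp
        moreover from this have "0 < norm x" using nx[OF True] by linarith
        ultimately show ?thesis using nx[OF True] True t a0
          by (auto intro!: ennreal_leI divide_left_mono power_mono mult_pos_pos)
      qed simp
    qed
    have sq: "0 < (1 - t)\<^sup>2 * (norm a)\<^sup>2" using t a0 by simp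
    have "1 / k \<le> 1 / ((1 - t)\<^sup>2 * (norm a)\<^sup>2)"
    proof -
      have "(1 - t)\<^sup>2 \<le> 1 - t\<^sup>2" using t by (simp add: power2_eq_square algebra_simps mult_left_le)
      then have "(1 - t)\<^sup>2 * (norm a)\<^sup>2 \<le> (1 - t\<^sup>2) * (norm a)\<^sup>2" by (rule mult_right_mono) simp
      then show ?thesis using kb sq k by (intro divide_left_mono) auto
    qed
    also have "\<dots> = s\<^sup>2 * (1 / ((1 + t) * norm a)\<^sup>2)"
      using t a0 s by (simp add: st[symmetric] power_mult_distrib)
    finally have "(1 / k) ^ ?d \<le> (s\<^sup>2 * (1 / ((1 + t) * norm a)\<^sup>2)) ^ ?d"
      using k by (intro power_mono) auto
    then have 1: "(1 / k) ^ ?d \<le> s ^ (2 * ?d) * (1 / ((1 + t) * norm a) ^ (2 * ?d))"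
      by (simp add: power_mult power_mult_distrib power_divide)
    have "1 / ((1 - t) * norm a)\<^sup>2 \<le> s\<^sup>2 * (1 / k)"
    proof -
      have "1 / ((1 - t) * norm a)\<^sup>2 = s\<^sup>2 * (1 / ((1 + t) * norm a)\<^sup>2)"
        using t a0 s by (simp add: st[symmetric] power_mult_distrib)
      also have "\<dots> \<le> s\<^sup>2 * (1 / k)"
      proof (intro mult_left_mono divide_left_mono)
        have "(norm a)\<^sup>2 \<le> ((1 + t) * norm a)\<^sup>2"
          using t by (intro power_mono) (auto simp: algebra_simps)
        then show "k \<le> ((1 + t) * norm a)\<^sup>2" using ka by linarith
        show "0 < ((1 + t) * norm a)\<^sup>2 * k" using t a0 k by simp
      qed auto
      finally show ?thesis .
    qed
    then have "(1 / ((1 - t) * norm a)\<^sup>2) ^ ?d \<le> (s\<^sup>2 * (1 / k)) ^ ?d"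
      by (intro power_mono) auto
    then have 2: "1 / ((1 - t) * norm a) ^ (2 * ?d) \<le> s ^ (2 * ?d) * (1 / k) ^ ?d"
      by (simp add: power_mult power_mult_distrib power_divide)
    have "emeasure ?M (ball a \<rho>) \<le> ennreal (s ^ (2 * ?d) * (1 / ((1 + t) * norm a) ^ (2 * ?d))) * ?L"
      unfolding MB by (intro mult_right_mono ennreal_leI 1) auto
    also have "\<dots> = ennreal (s ^ (2 * ?d)) * (ennreal (1 / ((1 + t) * norm a) ^ (2 * ?d)) * ?L)"
      using s t by (subst ennreal_mult) (auto simp: mult.assoc)
    also have "\<dots> \<le> ennreal (s ^ (2 * ?d)) * emeasure ?N (ball a \<rho>)"
      by (intro mult_left_mono N1) auto
    finally have "emeasure ?M (ball a \<rho>) \<le> ennreal (s ^ (2 * ?d)) * emeasure ?N (ball a \<rho>)" .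
    moreover have "emeasure ?N (ball a \<rho>) \<le> ennreal (s ^ (2 * ?d) * (1 / k) ^ ?d) * ?L"
      by (rule order_trans[OF N2]) (intro mult_right_mono ennreal_leI 2, auto)
    then have "emeasure ?N (ball a \<rho>) \<le> ennreal (s ^ (2 * ?d)) * emeasure ?M (ball a \<rho>)"
      unfolding MB using s k by (subst (asm) ennreal_mult) (auto simp: mult.assoc)
    ultimately show ?thesis by blast
  qed
  have open_le: "emeasure ?M U = emeasure ?N U" if U: "open U" "0 \<notin> U" for U
  proof (rule antisym)
    have pos: "0 < (s - 1) / (s + 1) * norm a" if "s > 1" "a \<in> U" for s a
      using that U by (intro mult_pos_pos divide_pos_pos) auto
    show "emeasure ?M U \<le> emeasure ?N U"
    proof (rule ennreal_le_of_le_mult)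
      fix s :: real assume s: "s > 1"
      show "emeasure ?M U \<le> ennreal (s ^ (2 * ?d)) * emeasure ?N U"
        by (rule emeasure_le_of_small_balls[where \<delta> = "\<lambda>a. (s - 1) / (s + 1) * norm a"])
           (use Mac U pos[OF s] balls[OF s] in auto)
    qed
    show "emeasure ?N U \<le> emeasure ?M U"
    proof (rule ennreal_le_of_le_mult)
      fix s :: real assume s: "s > 1"
      show "emeasure ?N U \<le> ennreal (s ^ (2 * ?d)) * emeasure ?M U"
        by (rule emeasure_le_of_small_balls[where \<delta> = "\<lambda>a. (s - 1) / (s + 1) * norm a"])
           (use Nac U pos[OF s] balls[OF s] in auto)
    qed
  qed
  have z: "emeasure ?M {0} = 0" "emeasure ?N {0} = 0" by (auto intro!: Mac Nac)
  \<comment> \<open>Both measures are infinite on every neighbourhood of 0, so an exhaustion by sets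
    of finite measure has to treat that point separately: {0} joins the open sets as a generator,
    and the sets |x| > 1/n cover the rest.\<close>
  let ?E = "insert {0} {U :: 'a set. open U}"
  let ?A = "\<lambda>n. if n = 0 then {0} else {x :: 'a. norm x > 1 / real n}"
  show ?thesis
  proof (rule measure_eqI_generator_eq[where E = ?E and \<Omega> = UNIV and A = ?A])
    show "Int_stable ?E" by (auto simp: Int_stable_def Int_insert_left Int_insert_right)
    show "?E \<subseteq> Pow UNIV" by auto
    have "sigma_sets UNIV ?E = sets borel"
    proof
      show "sigma_sets UNIV ?E \<subseteq> sets borel"
        by (rule sets.sigma_sets_subset[of _ borel, simplified]) auto
      show "sets borel \<subseteq> sigma_sets UNIV ?E"
        unfolding borel_def by (auto intro!: sigma_sets_mono)
    qed
    then show "sets ?M = sigma_sets UNIV ?E" "sets ?N = sigma_sets UNIV ?E" by auto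
    show "emeasure ?M X = emeasure ?N X" if "X \<in> ?E" for X
    proof (cases "X = {0}")
      case False
      then have X: "open X" using that by auto
      have oX: "open (X - {0})" using X by (simp add: open_Diff)
      have "emeasure m X = emeasure m (X - {0})" if "sets m = sets borel" "emeasure m {0} = 0" for m :: "'a measure"
        using that X by (intro emeasure_Diff_null_set[symmetric]) (auto simp: null_sets_def)
      then show ?thesis using open_le[OF oX] z by simp
    qed (simp add: z)
    show "range ?A \<subseteq> ?E" by (auto intro!: open_Collect_less continuous_intros)
    show "(\<Union>i. ?A i) = UNIV"
    proof safe
      fix x :: 'a
      show "x \<in> (\<Union>i. ?A i)"
      proof (cases "x = 0")
        case True then show ?thesis by (intro UN_I[of 0]) auto
      next
        case False
        then obtain n :: nat where "n > 0" "1 / real n < norm x"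
          using ex_inverse_of_nat_less[of "norm x"] by (auto simp: divide_inverse)
        then show ?thesis by (intro UN_I[of n]) auto
      qed
    qed auto
    show "emeasure ?M (?A i) \<noteq> \<infinity>" for i
    proof (cases "i = 0")
      case False
      have "\<iota> -` ?A i \<subseteq> ball 0 (real i)"
        using False by (auto simp: norm_iota divide_simps split: if_splits)
      then have "emeasure lborel (\<iota> -` ?A i) \<le> emeasure lborel (ball 0 (real i) :: 'a set)"
        by (intro emeasure_mono) auto
      also have "\<dots> < \<infinity>" by (simp add: emeasure_ball)
      finally show ?thesis using False by (subst M) auto
    qed (simp add: z)
  qed
qed

end

section \<open>The lattice and its Dirichlet region\<close>

text \<open>The condition on \<open>Q\<close> and \<open>Z\<close> is nice invertibility in
  disguise, since |z|^2 \<iota> z = Q z for nonzero z.\<close>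

locale cf_system = inversion \<iota> Q for \<iota> Q :: "'a::euclidean_space \<Rightarrow> 'a" +
  fixes Z K :: "'a set"
  assumes lat: "is_lattice Z" and bdK: "dirichlet_with_boundary_choice Z K"
    and integral: "integral_lattice Z" and unit: "unit_generated Z"
    and ne: "norm_euclidean K" and QZ: "z \<in> Z \<Longrightarrow> Q z \<in> Z"
    and remote: "remote3 Z K \<or> remote7 Z K"
begin

definition U where "U = {u \<in> Z. norm u = 1}"
definition E where "E = {x. \<forall>u\<in>U. u \<bullet> x < 1/2}"
abbreviation D where "D \<equiv> dirichlet Z"
abbreviation T where "T \<equiv> cf_map \<iota> Z K"

lemma Z_add: "\<And>x y. x \<in> Z \<Longrightarrow> y \<in> Z \<Longrightarrow> x + y \<in> Z"
  and Z_minus: "\<And>x. x \<in> Z \<Longrightarrow> - x \<in> Z"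
  using lat by (auto simp: is_lattice_def)

lemma Z_diff: "x \<in> Z \<Longrightarrow> y \<in> Z \<Longrightarrow> x - y \<in> Z"
  using Z_add[of x "- y"] Z_minus[of y] by simp

lemma Z_norm_sq_nat:
  assumes "z \<in> Z" obtains m :: nat where "(norm z)\<^sup>2 = real m"
proof -
  obtain k :: int where k: "(norm z)\<^sup>2 = of_int k"
    using integral assms by (auto simp: integral_lattice_def power2_norm_eq_inner Ints_def)
  then have "0 \<le> k" using zero_le_power2[of "norm z"] by (simp add: k)
  then show ?thesis using that[of "nat k"] k by simp
qed

text \<open>Polarisation: integrality concerns square norms only, so inner products are known just
  up to halves.\<close>

lemma Z_inner_half_int:
  assumes "z \<in> Z" "w \<in> Z" obtains k :: int where "2 * (z \<bullet> w) = of_int k"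
proof -
  obtain a b c :: nat where "(norm z)\<^sup>2 = real a" "(norm w)\<^sup>2 = real b" "(norm (z - w))\<^sup>2 = real c"
    using Z_norm_sq_nat assms Z_diff by metis
  then have "2 * (z \<bullet> w) = of_int (int a + int b - int c)" using norm_diff_sq[of z w] by simp
  then show ?thesis by (rule that)
qed

lemma finite_Z_bounded: "finite {z \<in> Z. norm z \<le> R}"
proof -
  obtain e where e: "e > 0" "\<And>z. z \<in> Z \<Longrightarrow> z \<noteq> 0 \<Longrightarrow> e \<le> norm z"
    using lat by (auto simp: is_lattice_def)
  have "uniform_discrete {z \<in> Z. norm z \<le> R}"
    unfolding uniform_discrete_def
  proof (intro exI[of _ e] conjI ballI impI)
    fix x y assume "x \<in> {z \<in> Z. norm z \<le> R}" "y \<in> {z \<in> Z. norm z \<le> R}" "dist x y < e"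
    then show "x = y" using e(2)[of "x - y"] Z_diff[of x y] by (force simp: dist_norm)
  qed (rule e)
  moreover have "bounded {z \<in> Z. norm z \<le> R}" by (auto simp: bounded_iff)
  ultimately show ?thesis using uniform_discrete_finite_iff by blast
qed

lemma countable_Z: "countable Z"
proof -
  have "Z = (\<Union>n. {z \<in> Z. norm z \<le> real n})" using real_arch_simple by blast
  moreover have "countable (\<Union>n. {z \<in> Z. norm z \<le> real n})"
    using finite_Z_bounded by (intro countable_UN) (auto intro: countable_finite)
  ultimately show ?thesis by simp
qed

lemma finite_U: "finite U"
  by (rule finite_subset[OF _ finite_Z_bounded[of 1]]) (auto simp: U_def)

lemma U_minus: "u \<in> U \<Longrightarrow> - u \<in> U" using Z_minus by (simp add: U_def)
lemma U_Q: "u \<in> U \<Longrightarrow> Q u \<in> U" using QZ by (simp add: U_def)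

lemma mem_D_iff: "x \<in> D \<longleftrightarrow> (\<forall>z\<in>Z. 2 * (x \<bullet> z) \<le> (norm z)\<^sup>2)"
proof -
  have "dist x 0 \<le> dist x z \<longleftrightarrow> 2 * (x \<bullet> z) \<le> (norm z)\<^sup>2" for z
  proof -
    have "dist x 0 \<le> dist x z \<longleftrightarrow> (norm x)\<^sup>2 \<le> (norm (x - z))\<^sup>2"
      by (simp add: dist_norm abs_le_square_iff[symmetric])
    then show ?thesis by (simp add: norm_diff_sq[of x z])
  qed
  then show ?thesis by (simp add: dirichlet_def)
qed

text \<open>A shortest way of writing a lattice point as a sum of units has no two terms with negative
  inner product, so a sum of \<open>k\<close> units has square norm at least \<open>k\<close>: the Dirichlet region is cut
  out by the units alone.\<close>

lemma Z_as_short_sum: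
  assumes "z \<in> Z"
  obtains us where "set us \<subseteq> U" "sum_list us = z" "real (length us) \<le> (norm z)\<^sup>2"
proof -
  define P where "P us \<longleftrightarrow> set us \<subseteq> U \<and> sum_list us = z" for us
  have "\<exists>us. P us" using unit assms by (auto simp: unit_generated_def U_def P_def)
  then obtain us where us: "P us" and min: "\<And>vs. P vs \<Longrightarrow> length us \<le> length vs"
    using arg_min_nat_lemma[of P _ length] by blast
  have nonneg: "0 \<le> u \<bullet> v" if "us = as @ u # bs @ v # cs" for as bs cs u v
  proof (rule ccontr)
    assume neg: "\<not> 0 \<le> u \<bullet> v"
    have uv: "u \<in> U" "v \<in> U" using us that by (auto simp: P_def)
    then have uvZ: "u \<in> Z" "v \<in> Z" "norm u = 1" "norm v = 1" by (auto simp: U_def)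
    have "(norm (u - - v))\<^sup>2 = 2 + 2 * (u \<bullet> v)"
      by (simp only: norm_diff_sq) (simp add: uvZ)
    then have n2: "(norm (u + v))\<^sup>2 = 2 + 2 * (u \<bullet> v)" by simp
    obtain m :: nat where m: "(norm (u + v))\<^sup>2 = real m"
      using Z_norm_sq_nat Z_add uvZ by metis
    \<comment> \<open>An integral square norm below 2 is 0 or 1, so the two units cancel or merge
      into a single unit; either way a shorter sum results.\<close>
    have "real m < 2" using n2 m neg by linarith
    then consider "m = 0" | "m = 1" by linarith
    then show False
    proof cases
      case 1
      then have "u + v = 0" using m by simp
      then have "P (as @ bs @ cs)"
        using us that by (auto simp: P_def algebra_simps eq_neg_iff_add_eq_0)
      from min[OF this] that show False by simp
    next
      case 2
      then have "norm (u + v) = 1" using m power2_eq_imp_eq[of "norm (u + v)" 1] by simp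
      then have "u + v \<in> U" using uvZ Z_add by (simp add: U_def)
      then have "P (as @ (u + v) # bs @ cs)"
        using us that by (auto simp: P_def algebra_simps)
      from min[OF this] that show False by simp
    qed
  qed
  have "real (length vs) \<le> (norm (sum_list vs))\<^sup>2" if "us = as @ vs" for as vs
    using that
  proof (induction vs arbitrary: as)
    case (Cons v vs)
    have IH: "real (length vs) \<le> (norm (sum_list vs))\<^sup>2" using Cons(1)[of "as @ [v]"] Cons(2) by simp
    have v: "norm v = 1" using us Cons(2) by (auto simp: P_def U_def)
    have "0 \<le> v \<bullet> w" if w: "w \<in> set vs" for w
    proof -
      obtain bs cs where "vs = bs @ w # cs" using w by (meson split_list)
      then show ?thesis using nonneg[of as v bs w cs] Cons(2) by simp
    qed
    then have "0 \<le> v \<bullet> sum_list vs"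
      by (induction vs) (auto simp: inner_add_right)
    moreover have "(norm (v - - sum_list vs))\<^sup>2 = 1 + 2 * (v \<bullet> sum_list vs) + (norm (sum_list vs))\<^sup>2"
      by (simp only: norm_diff_sq) (simp add: v)
    ultimately show ?case using IH by simp
  qed simp
  from this[of "[]" us] show ?thesis using us that by (auto simp: P_def)
qed

lemma inner_le_of_units:
  assumes x: "\<And>u. u \<in> U \<Longrightarrow> u \<bullet> x \<le> 1/2" and us: "set us \<subseteq> U"
  shows "2 * (x \<bullet> sum_list us) \<le> length us"
  using us
proof (induction us)
  case (Cons u us)
  then show ?case using x[of u] by (simp add: inner_add_right inner_commute)
qed simp

lemma D_eq: "D = {x. \<forall>u\<in>U. u \<bullet> x \<le> 1/2}"
proof safe
  fix x u assume "x \<in> D" "u \<in> U"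
  then have "2 * (x \<bullet> u) \<le> 1" unfolding mem_D_iff by (auto simp: U_def)
  then show "u \<bullet> x \<le> 1/2" by (simp add: inner_commute)
next
  fix x assume x: "\<forall>u\<in>U. u \<bullet> x \<le> 1/2"
  show "x \<in> D" unfolding mem_D_iff
  proof
    fix z assume "z \<in> Z"
    then obtain us where us: "set us \<subseteq> U" "sum_list us = z" "real (length us) \<le> (norm z)\<^sup>2"
      by (rule Z_as_short_sum)
    then show "2 * (x \<bullet> z) \<le> (norm z)\<^sup>2" using inner_le_of_units[of x us] x by force
  qed
qed

lemma D_unit: "x \<in> D \<Longrightarrow> u \<in> U \<Longrightarrow> u \<bullet> x \<le> 1/2"
  by (simp add: D_eq)

lemma E_subset_D: "E \<subseteq> D" by (auto simp: E_def D_eq less_imp_le)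
lemma K_subset_D: "K \<subseteq> D" using bdK by (simp add: dirichlet_with_boundary_choice_def)
lemma ex1_rep: "\<exists>!z. z \<in> Z \<and> x - z \<in> K" using bdK by (simp add: dirichlet_with_boundary_choice_def)

lemma scale_D_in_E:
  assumes "x \<in> D" "0 \<le> t" "t < 1" shows "t *\<^sub>R x \<in> E"
  unfolding E_def
proof (intro CollectI ballI)
  fix u assume "u \<in> U"
  then have "u \<bullet> x \<le> 1/2" using assms(1) by (auto simp: D_eq)
  moreover have "t * (u \<bullet> x) < 1 * (u \<bullet> x) \<or> t * (u \<bullet> x) \<le> 0"
    using assms by (cases "0 < u \<bullet> x") (auto intro: mult_strict_right_mono mult_nonneg_nonpos)
  ultimately show "u \<bullet> t *\<^sub>R x < 1/2" unfolding inner_scaleR_right by linarith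
qed

text \<open>On \<open>E\<close> the inequality 2 (x . z) < |z|^2 is strict for every nonzero lattice
  point, again by short sums of units, whereas \<open>x - z \<in> D\<close> forces the reverse one.
  So the boundary choice has no effect on \<open>E\<close>.\<close>

lemma E_subset_K: "E \<subseteq> K"
proof
  fix x assume x: "x \<in> E"
  obtain z where z: "z \<in> Z" "x - z \<in> K" using ex1_rep by blast
  have "z = 0"
  proof (rule ccontr)
    assume z0: "z \<noteq> 0"
    obtain us where us: "set us \<subseteq> U" "sum_list us = z" "real (length us) \<le> (norm z)\<^sup>2"
      using Z_as_short_sum[OF z(1)] .
    have "us \<noteq> []" using us z0 by auto
    then have "2 * (x \<bullet> sum_list us) < length us" using us(1)
    proof (induction us rule: list_nonempty_induct)
      case (single u)
      then show ?case using x by (auto simp: E_def inner_commute)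
    next
      case (cons u us)
      then show ?case using x by (fastforce simp: E_def inner_add_right inner_commute)
    qed
    then have 1: "2 * (x \<bullet> z) < (norm z)\<^sup>2" using us(3) unfolding us(2) by linarith
    have "2 * ((x - z) \<bullet> (- z)) \<le> (norm (- z))\<^sup>2"
      using z K_subset_D Z_minus unfolding mem_D_iff by (meson in_mono mem_D_iff)
    then have "(norm z)\<^sup>2 \<le> 2 * (x \<bullet> z)" by (simp add: inner_diff_left dot_square_norm)
    with 1 show False by simp
  qed
  with z show "x \<in> K" by simp
qed

lemma open_E: "open E"
proof -
  have "E = (\<Inter>u\<in>U. {x. u \<bullet> x < 1/2})" by (auto simp: E_def)
  then show ?thesis using finite_U by (auto intro!: open_INT open_Collect_less continuous_intros)
qed

lemma closed_D: "closed D"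
proof -
  have "D = (\<Inter>u\<in>U. {x. u \<bullet> x \<le> 1/2})" by (auto simp: D_eq)
  then show ?thesis by (auto intro!: closed_INT closed_Collect_le continuous_intros)
qed

lemma bounded_D: "bounded D"
proof -
  obtain C where C: "compact C" "\<And>x. \<exists>z\<in>Z. x - z \<in> C" using lat by (auto simp: is_lattice_def)
  obtain R where R: "\<And>x. x \<in> C \<Longrightarrow> norm x \<le> R" using compact_imp_bounded[OF C(1)] by (auto simp: bounded_iff)
  have "norm x \<le> R" if x: "x \<in> D" for x
  proof -
    obtain z where z: "z \<in> Z" "x - z \<in> C" using C by blast
    then have "dist x 0 \<le> dist x z" using x by (simp add: dirichlet_def)
    then show ?thesis using R[OF z(2)] by (simp add: dist_norm)
  qed
  then show ?thesis by (auto simp: bounded_iff)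
qed

lemma compact_D: "compact D" using closed_D bounded_D by (simp add: compact_eq_bounded_closed)

text \<open>The supremum is over \<open>K\<close>, which may omit parts of the boundary of
  \<open>D\<close>; but t x lies in \<open>E\<close>, hence in \<open>K\<close>, for x in
  \<open>D\<close> and t < 1, and t may tend to 1. The maximum with 1/2 secures a positive
  radius.\<close>

lemma D_radius: obtains r where "0 < r" "r < 1" "\<And>x. x \<in> D \<Longrightarrow> norm x \<le> r"
proof -
  define s where "s = (SUP x\<in>K. norm x)"
  have s1: "s < 1" using ne by (simp add: norm_euclidean_def s_def)
  have "bdd_above (norm ` K)"
    using bounded_subset[OF bounded_D K_subset_D] by (force simp: bounded_iff bdd_above_def)
  then have sK: "norm x \<le> s" if "x \<in> K" for x unfolding s_def using that by (rule cSUP_upper2[of _ _ x]) auto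
  have sD: "norm x \<le> s" if x: "x \<in> D" for x
  proof (rule field_le_mult_one_interval)
    fix t :: real assume t: "0 < t" "t < 1"
    then show "t * norm x \<le> s" using sK[of "t *\<^sub>R x"] scale_D_in_E[OF x, of t] E_subset_K by auto
  qed
  show ?thesis by (rule that[of "max s (1/2)"]) (use s1 sD in \<open>auto simp: le_max_iff_disj\<close>)
qed

lemma norm_D_less_1: "x \<in> D \<Longrightarrow> norm x < 1" using D_radius by (metis le_less_trans)

text \<open>A point on a face \<open>u \<bullet> x = 1/2\<close> is approached along its own ray:
  shrinking it enters \<open>E\<close>, stretching it crosses the face and leaves
  \<open>D\<close>.\<close>

lemma D_diff_E_frontier: "D - E \<subseteq> frontier K"
proof
  fix x assume x: "x \<in> D - E"
  then obtain u where u: "u \<in> U" "u \<bullet> x = 1/2" by (force simp: E_def D_eq)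
  have xn: "x \<noteq> 0" using u by auto
  show "x \<in> frontier K"
    unfolding frontier_straddle
  proof (intro CollectI allI impI conjI)
    fix e :: real assume e: "e > 0"
    define s where "s = min (1/2) (e / (2 * norm x))"
    have s: "0 < s" "s < 1" "s * norm x < e" using e xn by (auto simp: s_def field_simps min_def)
    have "(1 - s) *\<^sub>R x \<in> K" using scale_D_in_E[of x "1 - s"] x s E_subset_K by auto
    moreover have "dist x ((1 - s) *\<^sub>R x) < e" using s by (simp add: dist_norm algebra_simps)
    ultimately show "\<exists>y\<in>K. dist x y < e" by blast
    have "u \<bullet> ((1 + s) *\<^sub>R x) > 1/2" using u(2) s by (simp add: algebra_simps)
    then have "(1 + s) *\<^sub>R x \<notin> K" 
      using D_unit[of "(1 + s) *\<^sub>R x" u] u(1) K_subset_D by (auto simp del: inner_scaleR_right)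
    moreover have "dist x ((1 + s) *\<^sub>R x) < e" using s by (simp add: dist_norm algebra_simps)
    ultimately show "\<exists>y. y \<notin> K \<and> dist x y < e" by blast
  qed
qed

lemma negligible_D_diff_E: "negligible (D - E)"
proof (rule negligible_subset)
  show "negligible (\<Union>u\<in>U. {x. u \<bullet> x = 1/2})"
    using finite_U negligible_hyperplane[of _ "1/2 :: real"] by (intro negligible_Union) fastforce+
  show "D - E \<subseteq> (\<Union>u\<in>U. {x. u \<bullet> x = 1/2})" by (force simp: E_def D_eq)
qed

lemma T_branch:
  assumes "y \<in> K" "z \<in> Z" "y + z \<noteq> 0"
  shows "T (\<iota> (y + z)) = y"
proof -
  have "lattice_rep Z K (y + z) = z"
    unfolding lattice_rep_def
  proof (rule the1_equality[OF ex1_rep])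
    show "z \<in> Z \<and> y + z - z \<in> K" using assms by simp
  qed
  then show ?thesis using assms by (simp add: cf_map_def)
qed

lemma T_eq:
  assumes "x \<noteq> 0"
  obtains z where "z \<in> Z" "\<iota> x = T x + z" "T x \<in> K"
proof -
  have "lattice_rep Z K (\<iota> x) \<in> Z \<and> \<iota> x - lattice_rep Z K (\<iota> x) \<in> K"
    unfolding lattice_rep_def by (rule theI'[OF ex1_rep])
  then show ?thesis using that[of "lattice_rep Z K (\<iota> x)"] assms by (simp add: cf_map_def)
qed

text \<open>The remoteness conditions are not strict, but \<open>E\<close> is open: a point of
  \<open>E\<close> at the extremal distance could be moved towards \<open>v\<close> within
  \<open>E\<close>.\<close>

lemma open_far_strict:
  assumes "\<And>x. x \<in> E \<Longrightarrow> c \<le> dist v x" and x: "x \<in> E" and c: "0 < c"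
  shows "c < dist v x"
proof (rule ccontr)
  assume "\<not> c < dist v x"
  then have eq: "dist v x = c" using assms by force
  obtain e where e: "e > 0" "ball x e \<subseteq> E" using open_E x openE by blast
  define s where "s = min (1/2) (e / (2 * c))"
  have s: "0 < s" "s < 1" "s * c < e" using e c by (auto simp: s_def field_simps min_def)
  define y where "y = x + s *\<^sub>R (v - x)"
  have "dist x y = s * c" using eq s by (simp add: y_def dist_norm)
  then have "y \<in> E" using e s by auto
  have "v - y = (1 - s) *\<^sub>R (v - x)" by (simp add: y_def algebra_simps)
  then have "dist v y = (1 - s) * c" using eq s by (simp add: dist_norm)
  moreover have "(1 - s) * c < c" using s c by simp
  ultimately show False using assms(1)[OF \<open>y \<in> E\<close>] by simp
qed

lemma remote3_E:
  assumes r: "remote3 Z K" and z: "z \<in> Z" "(norm z)\<^sup>2 = 3" and x: "x \<in> E"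
  shows "1 < norm (x - z)"
proof -
  have "norm z = sqrt 3" using z by (metis norm_ge_zero real_sqrt_unique)
  then have "1 \<le> (INF x\<in>K. dist z x)" using r z by (auto simp: remote3_def)
  also have "(INF x\<in>K. dist z x) \<le> dist z y" if "y \<in> K" for y
    using that by (intro cINF_lower) (auto intro!: bdd_belowI[of _ 0])
  finally have "1 < dist z x" using open_far_strict[of 1 z x] x E_subset_K by force
  then show ?thesis by (simp add: dist_norm norm_minus_commute)
qed

lemma remote7_E:
  assumes r: "remote7 Z K" and z: "z \<in> Z" "(norm z)\<^sup>2 = 7" and x: "x \<in> E"
  shows "1/2 < norm (x - z /\<^sub>R 2)"
proof -
  have "norm z = sqrt 7" using z by (metis norm_ge_zero real_sqrt_unique)
  then have *: "1/2 \<le> (INF x\<in>K. dist ((1/2) *\<^sub>R z) x)" using r z by (auto simp: remote7_def)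
  have "(INF x\<in>K. dist ((1/2) *\<^sub>R z) x) \<le> dist ((1/2) *\<^sub>R z) y" if "y \<in> K" for y
    using that by (intro cINF_lower) (auto intro!: bdd_belowI[of _ 0])
  then have "1/2 < dist ((1/2) *\<^sub>R z) x"
    using open_far_strict[of "1/2" "(1/2) *\<^sub>R z" x] x E_subset_K * by force
  then show ?thesis by (simp add: dist_norm norm_minus_commute)
qed

section \<open>Walls and branches\<close>

text \<open>Up to positive factors, the equations of the images of the walls of \<open>D\<close> under the branches of
  \<open>T\<close> belong to this family, of which only finitely many members change sign on \<open>E\<close>.\<close>

definition walls :: "('a \<Rightarrow> real) set" where
  "walls = {\<lambda>x. 1} \<union> (\<lambda>u x. x \<bullet> u) ` U \<union> (\<lambda>w x. (norm (x - w))\<^sup>2 - 1) ` Z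
     \<union> (\<lambda>w x. (norm (x - w /\<^sub>R 2))\<^sup>2 - 1/4) ` {w \<in> Z. remote7 Z K \<and> (\<exists>n::nat. (norm w)\<^sup>2 = 2 * real n + 1)}"

text \<open>Negatives are included because a pull-back can exchange the two sides of a wall: \<iota>
  swaps the inside and the outside of the unit sphere about 0.\<close>

definition signed_walls :: "('a \<Rightarrow> real) set" where
  "signed_walls = walls \<union> (\<lambda>g x. - g x) ` walls"

lemma signed_walls_uminus: "g \<in> signed_walls \<Longrightarrow> (\<lambda>x. - g x) \<in> signed_walls"
  by (auto simp: signed_walls_def image_iff)

lemma wall_sphere: "w \<in> Z \<Longrightarrow> (\<lambda>x. (norm (x - w))\<^sup>2 - 1) \<in> signed_walls"
  unfolding signed_walls_def walls_def by blast

lemma wall_half_sphere: "w \<in> Z \<Longrightarrow> remote7 Z K \<Longrightarrow> (norm w)\<^sup>2 = 2 * real n + 1 \<Longrightarrow>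
    (\<lambda>x. (norm (x - w /\<^sub>R 2))\<^sup>2 - 1/4) \<in> signed_walls"
  unfolding signed_walls_def walls_def by blast

lemma E_unit: "x \<in> E \<Longrightarrow> u \<in> U \<Longrightarrow> \<bar>x \<bullet> u\<bar> < 1/2"
proof -
  assume "x \<in> E" "u \<in> U"
  then have "u \<bullet> x < 1/2" "(- u) \<bullet> x < 1/2" using U_minus[of u] unfolding E_def by blast+
  then show ?thesis by (simp add: inner_commute abs_less_iff)
qed

text \<open>On \<open>E\<close> the value |x . u| stays below 1/2, while c is half an integer: c = 0
  leaves a wall, and every other c fixes the sign on all of \<open>E\<close>.\<close>

lemma halfspace_sign:
  assumes u: "u \<in> U" and c: "2 * c = of_int k"
  shows "\<exists>g\<in>signed_walls. \<forall>x\<in>E. sgn (x \<bullet> u + c) = sgn (g x)"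
proof -
  have 1: "(\<lambda>x. 1) \<in> signed_walls" "(\<lambda>x. - 1) \<in> signed_walls" "(\<lambda>x. x \<bullet> u) \<in> signed_walls"
    using u by (auto simp: signed_walls_def walls_def)
  consider "k = 0" | "k \<ge> 1" | "k \<le> - 1" by linarith
  then show ?thesis
  proof cases
    case 1
    then show ?thesis using c 1 \<open>(\<lambda>x. x \<bullet> u) \<in> signed_walls\<close> by (intro bexI[of _ "\<lambda>x. x \<bullet> u"]) auto
  next
    case 2
    then have "1 \<le> 2 * c" using c by simp
    then have "x \<bullet> u + c > 0" if "x \<in> E" for x using E_unit[OF that u] by linarith
    then show ?thesis using 1(1) by (intro bexI[of _ "\<lambda>x. 1"]) auto
  next
    case 3
    then have "2 * c \<le> - 1" using c by simp
    then have "x \<bullet> u + c < 0" if "x \<in> E" for x using E_unit[OF that u] by linarith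
    then show ?thesis using 1(2) by (intro bexI[of _ "\<lambda>x. - 1"]) auto
  qed
qed

lemma sgn_eq_of_mult: "0 < c \<Longrightarrow> y * c = c' * w \<Longrightarrow> 0 < c' \<Longrightarrow> sgn y = sgn w" for c y w c' :: real
  by (metis sgn_mult sgn_pos mult_1 mult.right_neutral)

lemma norm_E_less_1: "x \<in> E \<Longrightarrow> norm x < 1" using norm_D_less_1 E_subset_D by blast

lemma sphere_positive:
  assumes "x \<in> E" "1 + c \<le> norm w" "0 \<le> c"
  shows "0 < (norm (x - w))\<^sup>2 - c\<^sup>2"
proof -
  have "c < norm (x - w)" using norm_E_less_1[OF assms(1)] norm_triangle_ineq2[of w x] assms(2)
    by (simp add: norm_minus_commute)
  then show ?thesis using assms(3) by (simp add: power_strict_mono)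
qed

text \<open>With y = x + z and m = |w|^2, multiplying by |y|^2 gives 1 - 2 (y . Q w) + (m - 1)
  |y|^2, and completing the square identifies the wall for small m. For m \<ge> 4, and for m = 3
  under 3-remoteness, the sign is constant because \<open>\<iota> (x + z)\<close> itself lies in
  \<open>E\<close>, away from the sphere.\<close>

lemma sphere_pullback:
  assumes z: "z \<in> Z" and w: "w \<in> Z"
  shows "\<exists>g'\<in>signed_walls. \<forall>x\<in>E. x + z \<noteq> 0 \<longrightarrow> \<iota> (x + z) \<in> E \<longrightarrow>
           sgn ((norm (\<iota> (x + z) - w))\<^sup>2 - 1) = sgn (g' x)"
proof -
  obtain m :: nat where m: "(norm w)\<^sup>2 = real m" using Z_norm_sq_nat[OF w] .
  have key: "((norm (\<iota> (x + z) - w))\<^sup>2 - 1) * (norm (x + z))\<^sup>2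
      = 1 - 2 * ((x + z) \<bullet> Q w) + (real m - 1) * (norm (x + z))\<^sup>2" if "x + z \<noteq> 0" for x
    using norm_iota_diff_sq[OF that, of w] m by (simp add: algebra_simps)
  have pos: "0 < (norm (x + z))\<^sup>2" if "x + z \<noteq> 0" for x using that by simp
  have one: "(\<lambda>x. 1) \<in> signed_walls" by (auto simp: signed_walls_def walls_def)
  have shift: "(norm (x - (v - z)))\<^sup>2 = (norm (x + z))\<^sup>2 - 2 * ((x + z) \<bullet> v) + (norm v)\<^sup>2" for x v
    using norm_diff_sq[of "x + z" v] by (simp add: algebra_simps)
  consider "m = 0" | "m = 1" | "m = 2" | "m = 3" | "m \<ge> 4" by linarith
  then show ?thesis
  proof cases
    case 1
    then have w0: "w = 0" using m by simp
    have mem: "(\<lambda>x. - ((norm (x - (- z)))\<^sup>2 - 1)) \<in> signed_walls"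
      by (rule signed_walls_uminus[OF wall_sphere[OF Z_minus[OF z]]])
    moreover have eq: "sgn ((norm (\<iota> (x + z) - w))\<^sup>2 - 1) = sgn (- ((norm (x - (- z)))\<^sup>2 - 1))"
      if "x + z \<noteq> 0" for x
      by (rule sgn_eq_of_mult[OF pos[OF that], of _ 1])
         (use key[OF that] 1 w0 in \<open>auto simp: linear_0[OF linear_Q]\<close>)
    ultimately show ?thesis by (intro bexI[OF _ mem] ballI impI) (rule eq)
  next
    case 2
    then have wU: "- Q w \<in> U" using U_minus U_Q w m power2_eq_imp_eq[of "norm w" 1] by (simp add: U_def)
    then have "- Q w \<in> Z" by (simp add: U_def)
    then obtain k where k: "2 * (z \<bullet> (- Q w)) = of_int k" using Z_inner_half_int[OF z] by blast
    obtain g' where g': "g' \<in> signed_walls"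
      "\<And>x. x \<in> E \<Longrightarrow> sgn (x \<bullet> (- Q w) + (z \<bullet> (- Q w) + 1/2)) = sgn (g' x)"
      using halfspace_sign[OF wU, of "z \<bullet> (- Q w) + 1/2" "k + 1"] k by auto
    moreover have eq: "sgn ((norm (\<iota> (x + z) - w))\<^sup>2 - 1) = sgn (x \<bullet> (- Q w) + (z \<bullet> (- Q w) + 1/2))"
      if "x + z \<noteq> 0" for x
      by (rule sgn_eq_of_mult[OF pos[OF that], of _ 2])
         (use key[OF that] 2 in \<open>auto simp: inner_add_left\<close>)
    ultimately show ?thesis by metis
  next
    case 3
    have mem: "(\<lambda>x. (norm (x - (Q w - z)))\<^sup>2 - 1) \<in> signed_walls"
      by (rule wall_sphere[OF Z_diff[OF QZ[OF w] z]])
    moreover have eq: "sgn ((norm (\<iota> (x + z) - w))\<^sup>2 - 1) = sgn ((norm (x - (Q w - z)))\<^sup>2 - 1)"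
      if "x + z \<noteq> 0" for x
      by (rule sgn_eq_of_mult[OF pos[OF that], of _ 1])
         (use key[OF that] 3 m shift[of x "Q w"] in auto)
    ultimately show ?thesis by (intro bexI[OF _ mem] ballI impI) (rule eq)
  next
    case 4
    show ?thesis
    proof (cases "remote3 Z K")
      case True
      have "0 < (norm (y - w))\<^sup>2 - 1" if "y \<in> E" for y
        using remote3_E[OF True w _ that] m 4 by (simp add: one_less_power)
      then show ?thesis using one by (intro bexI[of _ "\<lambda>x. 1"]) auto
    next
      case False
      then have r7: "remote7 Z K" using remote by blast
      \<comment> \<open>The quadratic is twice the equation of the sphere of radius 1/2 about Q w /
        2 - z = v / 2. The square norm of v has the parity of |w|^2 = 3, since 4 (Q w . z) is an
        even integer, so this sphere belongs to \<open>walls\<close>.\<close>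
      let ?v = "Q w - 2 *\<^sub>R z"
      have vZ: "?v \<in> Z" using Z_diff[OF Z_diff[OF QZ[OF w] z] z] by (simp add: scaleR_2 algebra_simps)
      obtain k where k: "2 * (Q w \<bullet> z) = of_int k" using Z_inner_half_int[OF QZ[OF w] z] .
      obtain l :: nat where l: "(norm z)\<^sup>2 = real l" using Z_norm_sq_nat[OF z] .
      have nv: "(norm ?v)\<^sup>2 = 3 - 2 * of_int k + 4 * real l"
        using norm_diff_sq[of "Q w" "2 *\<^sub>R z"] m 4 k l by (simp add: power_mult_distrib)
      obtain n :: nat where n: "(norm ?v)\<^sup>2 = real n" using Z_norm_sq_nat[OF vZ] .
      have "real_of_int (int n) = of_int (3 - 2 * k + 4 * int l)" using nv n by simp
      then have "int n = 3 - 2 * k + 4 * int l" by (simp only: of_int_eq_iff)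
      then have "odd n" by presburger
      then obtain n' where "n = 2 * n' + 1" by (rule oddE)
      then have mem: "(\<lambda>x. (norm (x - ?v /\<^sub>R 2))\<^sup>2 - 1/4) \<in> signed_walls"
        using r7 vZ n by (intro wall_half_sphere[of _ n']) auto
      moreover have eq: "sgn ((norm (\<iota> (x + z) - w))\<^sup>2 - 1) = sgn ((norm (x - ?v /\<^sub>R 2))\<^sup>2 - 1/4)"
        if "x + z \<noteq> 0" for x
      proof (rule sgn_eq_of_mult[OF pos[OF that], of _ 2])
        have "?v /\<^sub>R 2 = Q w /\<^sub>R 2 - z" by (simp add: scaleR_diff_right)
        then have "(norm (x - ?v /\<^sub>R 2))\<^sup>2 = (norm (x + z))\<^sup>2 - (x + z) \<bullet> Q w + 3/4"
          using shift[of x "Q w /\<^sub>R 2"] m 4 by (simp add: power_mult_distrib power_divide)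
        then show "((norm (\<iota> (x + z) - w))\<^sup>2 - 1) * (norm (x + z))\<^sup>2 = 2 * ((norm (x - ?v /\<^sub>R 2))\<^sup>2 - 1/4)"
          using key[OF that] 4 by simp
      qed auto
      ultimately show ?thesis by (intro bexI[OF _ mem] ballI impI) (rule eq)
    qed
  next
    case 5
    have "(2::real)\<^sup>2 \<le> (norm w)\<^sup>2" using m 5 by simp
    then have "2 \<le> norm w" by (rule power2_le_imp_le) simp
    then have "0 < (norm (y - w))\<^sup>2 - 1" if "y \<in> E" for y
      using sphere_positive[OF that, of 1 w] by simp
    then show ?thesis using one by (intro bexI[of _ "\<lambda>x. 1"]) auto
  qed
qed

text \<open>Here the polynomial is 1 - y . Q w + (n / 2) |y|^2 with y = x + z. For |w|^2 = 1, 3, 5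
  it describes a half-space, a unit sphere and another sphere of radius 1/2; |w|^2 = 7 is settled by
  7-remoteness, and from 9 on |w| / 2 \<ge> 1 + 1/2 keeps the sphere away from
  \<open>E\<close>.\<close>

lemma half_sphere_pullback:
  assumes z: "z \<in> Z" and w: "w \<in> Z" and r7: "remote7 Z K" and odd: "(norm w)\<^sup>2 = 2 * real n + 1"
  shows "\<exists>g'\<in>signed_walls. \<forall>x\<in>E. x + z \<noteq> 0 \<longrightarrow> \<iota> (x + z) \<in> E \<longrightarrow>
           sgn ((norm (\<iota> (x + z) - w /\<^sub>R 2))\<^sup>2 - 1/4) = sgn (g' x)"
proof -
  have nw: "(norm (w /\<^sub>R 2))\<^sup>2 = (2 * real n + 1) / 4"
    using odd by (simp add: power_mult_distrib power_divide)
  have Qw2: "Q (w /\<^sub>R 2) = Q w /\<^sub>R 2" by (simp add: linear_cmul[OF linear_Q])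
  have key: "((norm (\<iota> (x + z) - w /\<^sub>R 2))\<^sup>2 - 1/4) * (norm (x + z))\<^sup>2
      = 1 - (x + z) \<bullet> Q w + real n / 2 * (norm (x + z))\<^sup>2" if "x + z \<noteq> 0" for x
    using norm_iota_diff_sq[OF that, of "w /\<^sub>R 2"] unfolding nw Qw2 by (simp add: field_simps)
  have pos: "0 < (norm (x + z))\<^sup>2" if "x + z \<noteq> 0" for x using that by simp
  have one: "(\<lambda>x. 1) \<in> signed_walls" by (auto simp: signed_walls_def walls_def)
  have shift: "(norm (x - (v - z)))\<^sup>2 = (norm (x + z))\<^sup>2 - 2 * ((x + z) \<bullet> v) + (norm v)\<^sup>2" for x v
    using norm_diff_sq[of "x + z" v] by (simp add: algebra_simps)
  consider "n = 0" | "n = 1" | "n = 2" | "n = 3" | "n \<ge> 4" by linarith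
  then show ?thesis
  proof cases
    case 1
    then have wU: "- Q w \<in> U" using U_minus U_Q w odd power2_eq_imp_eq[of "norm w" 1] by (simp add: U_def)
    then have "- Q w \<in> Z" by (simp add: U_def)
    then obtain k where k: "2 * (z \<bullet> (- Q w)) = of_int k" using Z_inner_half_int[OF z] by blast
    obtain g' where g': "g' \<in> signed_walls"
      "\<And>x. x \<in> E \<Longrightarrow> sgn (x \<bullet> (- Q w) + (z \<bullet> (- Q w) + 1)) = sgn (g' x)"
      using halfspace_sign[OF wU, of "z \<bullet> (- Q w) + 1" "k + 2"] k by auto
    moreover have eq: "sgn ((norm (\<iota> (x + z) - w /\<^sub>R 2))\<^sup>2 - 1/4) = sgn (x \<bullet> (- Q w) + (z \<bullet> (- Q w) + 1))"
      if "x + z \<noteq> 0" for x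
      by (rule sgn_eq_of_mult[OF pos[OF that], of _ 1])
         (use key[OF that] 1 in \<open>auto simp: inner_add_left\<close>)
    ultimately show ?thesis by metis
  next
    case 2
    have mem: "(\<lambda>x. (norm (x - (Q w - z)))\<^sup>2 - 1) \<in> signed_walls"
      by (rule wall_sphere[OF Z_diff[OF QZ[OF w] z]])
    moreover have eq: "sgn ((norm (\<iota> (x + z) - w /\<^sub>R 2))\<^sup>2 - 1/4) = sgn ((norm (x - (Q w - z)))\<^sup>2 - 1)"
      if "x + z \<noteq> 0" for x
      by (rule sgn_eq_of_mult[OF pos[OF that], of _ "1/2"])
         (use key[OF that] 2 odd shift[of x "Q w"] in auto)
    ultimately show ?thesis by (intro bexI[OF _ mem] ballI impI) (rule eq)
  next
    case 3
    let ?v = "Q w - 2 *\<^sub>R z"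
    have vZ: "?v \<in> Z" using Z_diff[OF Z_diff[OF QZ[OF w] z] z] by (simp add: scaleR_2 algebra_simps)
    obtain k where k: "2 * (Q w \<bullet> z) = of_int k" using Z_inner_half_int[OF QZ[OF w] z] .
    obtain l :: nat where l: "(norm z)\<^sup>2 = real l" using Z_norm_sq_nat[OF z] .
    have nv: "(norm ?v)\<^sup>2 = 5 - 2 * of_int k + 4 * real l"
      using norm_diff_sq[of "Q w" "2 *\<^sub>R z"] odd 3 k l by (simp add: power_mult_distrib)
    obtain n where n: "(norm ?v)\<^sup>2 = real n" using Z_norm_sq_nat[OF vZ] .
    have "real_of_int (int n) = of_int (5 - 2 * k + 4 * int l)" using nv n by simp
    then have "int n = 5 - 2 * k + 4 * int l" by (simp only: of_int_eq_iff)
    then have "Parity.odd n" by presburger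
    then obtain n' where "n = 2 * n' + 1" by (rule oddE)
    then have mem: "(\<lambda>x. (norm (x - ?v /\<^sub>R 2))\<^sup>2 - 1/4) \<in> signed_walls"
      using r7 vZ n by (intro wall_half_sphere[of _ n']) auto
    moreover have eq: "sgn ((norm (\<iota> (x + z) - w /\<^sub>R 2))\<^sup>2 - 1/4) = sgn ((norm (x - ?v /\<^sub>R 2))\<^sup>2 - 1/4)"
      if "x + z \<noteq> 0" for x
    proof (rule sgn_eq_of_mult[OF pos[OF that], of _ 1])
      have "?v /\<^sub>R 2 = Q w /\<^sub>R 2 - z" by (simp add: scaleR_diff_right)
      then have "(norm (x - ?v /\<^sub>R 2))\<^sup>2 = (norm (x + z))\<^sup>2 - (x + z) \<bullet> Q w + 5/4"
        using shift[of x "Q w /\<^sub>R 2"] odd 3 by (simp add: power_mult_distrib power_divide)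
      then show "((norm (\<iota> (x + z) - w /\<^sub>R 2))\<^sup>2 - 1/4) * (norm (x + z))\<^sup>2 = 1 * ((norm (x - ?v /\<^sub>R 2))\<^sup>2 - 1/4)"
        using key[OF that] 3 by simp
    qed auto
    ultimately show ?thesis by (intro bexI[OF _ mem] ballI impI) (rule eq)
  next
    case 4
    have "0 < (norm (y - w /\<^sub>R 2))\<^sup>2 - 1/4" if "y \<in> E" for y
    proof -
      have "1/2 < norm (y - w /\<^sub>R 2)" using remote7_E[OF r7 w _ that] odd 4 by simp
      then have "(1/2)\<^sup>2 < (norm (y - w /\<^sub>R 2))\<^sup>2" by (intro power_strict_mono) auto
      then show ?thesis by (simp add: power_divide)
    qed
    then show ?thesis using one by (intro bexI[of _ "\<lambda>x. 1"]) auto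
  next
    case 5
    have "(3::real)\<^sup>2 \<le> (norm w)\<^sup>2" using odd 5 by simp
    then have "3 \<le> norm w" by (rule power2_le_imp_le) simp
    then have "0 < (norm (y - w /\<^sub>R 2))\<^sup>2 - 1/4" if "y \<in> E" for y
      using sphere_positive[OF that, of "1/2" "w /\<^sub>R 2"] by (simp add: power_divide)
    then show ?thesis using one by (intro bexI[of _ "\<lambda>x. 1"]) auto
  qed
qed

lemma signed_walls_pullback:
  assumes g: "g \<in> signed_walls" and z: "z \<in> Z"
  shows "\<exists>g'\<in>signed_walls. \<forall>x\<in>E. x + z \<noteq> 0 \<longrightarrow> \<iota> (x + z) \<in> E \<longrightarrow> sgn (g (\<iota> (x + z))) = sgn (g' x)"
proof -
  have walls: "\<exists>g'\<in>signed_walls. \<forall>x\<in>E. x + z \<noteq> 0 \<longrightarrow> \<iota> (x + z) \<in> E \<longrightarrow> sgn (g (\<iota> (x + z))) = sgn (g' x)"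
    if "g \<in> walls" for g
    using that unfolding walls_def
  proof (elim UnE)
    assume "g \<in> {\<lambda>x. 1}"
    then show ?thesis by (intro bexI[of _ "\<lambda>x. 1"]) (auto simp: signed_walls_def walls_def)
  next
    assume "g \<in> (\<lambda>u x. x \<bullet> u) ` U"
    then obtain u where u: "u \<in> U" and g: "g = (\<lambda>x. x \<bullet> u)" by auto
    have Qu: "Q u \<in> U" using U_Q[OF u] .
    then have "Q u \<in> Z" by (simp add: U_def)
    then obtain k where k: "2 * (z \<bullet> Q u) = of_int k" using Z_inner_half_int[OF z] by blast
    obtain g' where g': "g' \<in> signed_walls" "\<And>x. x \<in> E \<Longrightarrow> sgn (x \<bullet> Q u + z \<bullet> Q u) = sgn (g' x)"
      using halfspace_sign[OF Qu k] by auto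
    moreover have "sgn (g (\<iota> (x + z))) = sgn (x \<bullet> Q u + z \<bullet> Q u)" if "x + z \<noteq> 0" for x
      by (rule sgn_eq_of_mult[of "(norm (x + z))\<^sup>2" _ 1])
         (use that in \<open>auto simp: g iota_def[of "x + z"] Q_inner inner_add_left\<close>)
    ultimately show ?thesis by metis
  next
    assume "g \<in> (\<lambda>w x. (norm (x - w))\<^sup>2 - 1) ` Z"
    then show ?thesis using sphere_pullback[OF z] by auto
  next
    assume "g \<in> (\<lambda>w x. (norm (x - w /\<^sub>R 2))\<^sup>2 - 1/4) ` {w \<in> Z. remote7 Z K \<and> (\<exists>n::nat. (norm w)\<^sup>2 = 2 * real n + 1)}"
    then show ?thesis using half_sphere_pullback[OF z] by auto
  qed
  show ?thesis
  proof (cases "g \<in> walls")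
    case True then show ?thesis by (rule walls)
  next
    case False
    then obtain h where h: "h \<in> walls" "g = (\<lambda>x. - h x)" using g by (auto simp: signed_walls_def)
    from walls[OF h(1)] obtain h' where h': "h' \<in> signed_walls"
      "\<forall>x\<in>E. x + z \<noteq> 0 \<longrightarrow> \<iota> (x + z) \<in> E \<longrightarrow> sgn (h (\<iota> (x + z))) = sgn (h' x)" by blast
    then show ?thesis
      using signed_walls_uminus[OF h'(1)] by (intro bexI[of _ "\<lambda>x. - h' x"]) (auto simp: h sgn_minus)
  qed
qed

section \<open>Composed branches and their domains\<close>

primrec br :: "'a list \<Rightarrow> 'a \<Rightarrow> 'a" where
  "br [] x = x"
| "br (z # zs) x = \<iota> (br zs x + z)"

text \<open>All intermediate points must lie in the open set \<open>E\<close>, so that the sign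
  statements about walls apply to them. The condition of being nonzero is genuine: \<iota> 0 = 0
  lies in \<open>E\<close> without coming from a branch.\<close>

primrec valid :: "'a list \<Rightarrow> 'a \<Rightarrow> bool" where
  "valid [] x \<longleftrightarrow> x \<in> E"
| "valid (z # zs) x \<longleftrightarrow> valid zs x \<and> z \<in> Z \<and> br zs x + z \<noteq> 0 \<and> \<iota> (br zs x + z) \<in> E"

lemma valid_br_in_E: "valid zs x \<Longrightarrow> br zs x \<in> E"
  by (cases zs) auto

text \<open>However long the branch is, a wall pulls back to a single signed wall. This is why one
  ball about \<open>x0\<close> can serve for branches of every length.\<close>

lemma signed_walls_pullback_br:
  assumes "g \<in> signed_walls" "set zs \<subseteq> Z"
  shows "\<exists>g'\<in>signed_walls. \<forall>x. valid zs x \<longrightarrow> sgn (g (br zs x)) = sgn (g' x)"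
  using assms
proof (induction zs arbitrary: g)
  case Nil
  then show ?case by auto
next
  case (Cons z zs)
  then obtain g1 where g1: "g1 \<in> signed_walls"
    "\<And>x. x \<in> E \<Longrightarrow> x + z \<noteq> 0 \<Longrightarrow> \<iota> (x + z) \<in> E \<Longrightarrow> sgn (g (\<iota> (x + z))) = sgn (g1 x)"
    using signed_walls_pullback[of g z] by auto
  obtain g2 where g2: "g2 \<in> signed_walls" "\<And>x. valid zs x \<Longrightarrow> sgn (g1 (br zs x)) = sgn (g2 x)"
    using Cons.IH[OF g1(1)] Cons.prems by auto
  show ?case
  proof (intro bexI[OF _ g2(1)] allI impI)
    fix x assume "valid (z # zs) x"
    then show "sgn (g (br (z # zs) x)) = sgn (g2 x)"
      using g1(2)[of "br zs x"] g2(2)[of x] valid_br_in_E[of zs x] by simp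
  qed
qed

text \<open>All but finitely many walls are positive throughout \<open>E\<close>: as
  \<open>E\<close> lies in the unit ball, |w| > 3 makes |w| exceed 1 + 1 and |w| / 2 exceed 1 + 1/2.
  Walls through \<open>x0\<close> are exempt, since they may change sign on every ball about
  it.\<close>

lemma sign_stable_ball:
  assumes x0: "x0 \<in> E"
  obtains \<epsilon> where "\<epsilon> > 0" "ball x0 \<epsilon> \<subseteq> E"
    "\<And>g x. g \<in> signed_walls \<Longrightarrow> x \<in> ball x0 \<epsilon> \<Longrightarrow> g x0 \<noteq> 0 \<Longrightarrow> sgn (g x) = sgn (g x0)"
proof -
  let ?S = "\<lambda>w x. (norm (x - w))\<^sup>2 - 1 :: real"
  let ?H = "\<lambda>w x. (norm (x - w /\<^sub>R 2))\<^sup>2 - 1/4 :: real"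
  define F where "F = {\<lambda>x. 1} \<union> (\<lambda>u x. x \<bullet> u) ` U \<union> ?S ` {w \<in> Z. norm w \<le> 3} \<union> ?H ` {w \<in> Z. norm w \<le> 3}"
  have "finite F" unfolding F_def using finite_U finite_Z_bounded[of 3] by auto
  have F: "g \<in> F \<or> (\<forall>x\<in>E. 0 < g x)" if g: "g \<in> walls" for g
    using g unfolding walls_def
  proof (elim UnE)
    assume "g \<in> ?S ` Z"
    then obtain w where w: "w \<in> Z" "g = ?S w" by auto
    show ?thesis
    proof (cases "norm w \<le> 3")
      case False
      then show ?thesis using sphere_positive[of _ 1 w] by (auto simp: w)
    qed (use w in \<open>auto simp: F_def\<close>)
  next
    assume "g \<in> ?H ` {w \<in> Z. remote7 Z K \<and> (\<exists>n::nat. (norm w)\<^sup>2 = 2 * real n + 1)}"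
    then obtain w where w: "w \<in> Z" "g = ?H w" by auto
    show ?thesis
    proof (cases "norm w \<le> 3")
      case False
      then show ?thesis using sphere_positive[of _ "1/2" "w /\<^sub>R 2"] by (auto simp: w power_divide)
    qed (use w in \<open>auto simp: F_def\<close>)
  qed (auto simp: F_def)
  have ev: "\<forall>\<^sub>F x in nhds x0. g x0 \<noteq> 0 \<longrightarrow> sgn (g x) = sgn (g x0)" if "g \<in> F" for g
  proof (cases "g x0 = 0")
    case False
    have "continuous_on UNIV g" using that unfolding F_def by (auto intro!: continuous_intros)
    then have "(g \<longlongrightarrow> g x0) (nhds x0)"
      by (simp add: continuous_on_eq_continuous_at isCont_def tendsto_nhds_iff)
    show ?thesis
    proof (cases "g x0 > 0")
      case True
      from order_tendstoD(1)[OF \<open>(g \<longlongrightarrow> g x0) (nhds x0)\<close> True] show ?thesis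
        by eventually_elim (use True in auto)
    next
      case neg: False
      then have "g x0 < 0" using False by linarith
      from order_tendstoD(2)[OF \<open>(g \<longlongrightarrow> g x0) (nhds x0)\<close> this] show ?thesis
        by eventually_elim (use \<open>g x0 < 0\<close> in auto)
    qed
  qed simp
  have "\<forall>\<^sub>F x in nhds x0. x \<in> E \<and> (\<forall>g\<in>F. g x0 \<noteq> 0 \<longrightarrow> sgn (g x) = sgn (g x0))"
    using ev \<open>finite F\<close> open_E x0 by (intro eventually_conj eventually_ball_finite ballI) (auto intro: eventually_nhds_in_open)
  then obtain \<epsilon> where \<epsilon>: "\<epsilon> > 0"
    and ball: "\<And>x. dist x x0 < \<epsilon> \<Longrightarrow> x \<in> E \<and> (\<forall>g\<in>F. g x0 \<noteq> 0 \<longrightarrow> sgn (g x) = sgn (g x0))"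
    unfolding eventually_nhds_metric by blast
  have walls: "sgn (g x) = sgn (g x0)" if "g \<in> walls" "x \<in> ball x0 \<epsilon>" "g x0 \<noteq> 0" for g x
    using F[OF that(1)] ball[of x] that x0 by (auto simp: dist_commute)
  show ?thesis
  proof (rule that[OF \<epsilon>])
    show "ball x0 \<epsilon> \<subseteq> E" using ball by (auto simp: dist_commute)
    fix g x assume g: "g \<in> signed_walls" and x: "x \<in> ball x0 \<epsilon>" "g x0 \<noteq> 0"
    show "sgn (g x) = sgn (g x0)"
    proof (cases "g \<in> walls")
      case False
      then obtain h where "h \<in> walls" "g = (\<lambda>x. - h x)" using g by (auto simp: signed_walls_def)
      then show ?thesis using walls[of h x] x by (simp add: sgn_minus)
    qed (use walls x in auto)
  qed
qed

lemma T_funpow_br: "valid zs x \<Longrightarrow> (T ^^ length zs) (br zs x) = x"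
proof (induction zs)
  case (Cons z zs)
  have "T (br (z # zs) x) = br zs x"
    using Cons.prems valid_br_in_E[of zs x] E_subset_K by (auto intro!: T_branch)
  then show ?case using Cons by (simp add: funpow_swap1)
qed simp

text \<open>Under \<iota> the plane \<open>u \<bullet> y = 1/2\<close> pulls back to the sphere
  about \<open>Q u\<close> through 0, a unit sphere if |u| = 1. In this way the faces of
  \<open>D\<close> enter the family of walls.\<close>

lemma sgn_half_minus_inner_iota:
  assumes "p \<noteq> 0"
  shows "sgn (1/2 - u \<bullet> \<iota> p) = sgn ((norm (p - Q u))\<^sup>2 - (norm u)\<^sup>2)"
proof (rule sgn_eq_of_mult[of "(norm p)\<^sup>2" _ "1/2"])
  have "u \<bullet> \<iota> p * (norm p)\<^sup>2 = p \<bullet> Q u"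
    using assms Q_inner[of u p] inner_commute[of p "Q u"] by (simp add: iota_def)
  then show "(1/2 - u \<bullet> \<iota> p) * (norm p)\<^sup>2 = 1/2 * ((norm (p - Q u))\<^sup>2 - (norm u)\<^sup>2)"
    using norm_diff_sq[of p "Q u"] by (simp add: algebra_simps)
qed (use assms in auto)

lemma Z_inter_D: "z \<in> Z \<Longrightarrow> z \<in> D \<Longrightarrow> z = 0"
proof -
  assume z: "z \<in> Z" "z \<in> D"
  obtain m :: nat where m: "(norm z)\<^sup>2 = real m" using Z_norm_sq_nat[OF z(1)] .
  have "(norm z)\<^sup>2 < 1" using norm_D_less_1[OF z(2)] by (simp add: abs_square_less_1)
  then show "z = 0" using m by simp
qed

text \<open>A branch that took \<open>x0\<close> into \<open>D - E\<close> would make \<open>x0\<close> a forward image of the boundary.\<close>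

lemma branch_dichotomy:
  assumes stable: "\<And>g x. g \<in> signed_walls \<Longrightarrow> x \<in> ball x0 \<epsilon> \<Longrightarrow> g x0 \<noteq> 0 \<Longrightarrow> sgn (g x) = sgn (g x0)"
    and \<epsilon>: "\<epsilon> > 0" and P: "x0 \<notin> (\<Union>n. (T ^^ n) ` frontier K)"
    and zs: "set zs \<subseteq> Z" "\<And>x. x \<in> ball x0 \<epsilon> \<Longrightarrow> valid zs x" and z: "z \<in> Z"
  shows "(\<forall>x\<in>ball x0 \<epsilon>. valid (z # zs) x) \<or>
         (\<forall>x\<in>ball x0 \<epsilon>. br zs x + z \<noteq> 0 \<longrightarrow> \<iota> (br zs x + z) \<notin> D)"
proof (cases "z = 0")
  case True
  have "\<iota> (br zs x + z) \<notin> D" if "x \<in> ball x0 \<epsilon>" "br zs x + z \<noteq> 0" for x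
  proof -
    have "norm (br zs x + z) < 1" using norm_E_less_1[OF valid_br_in_E[OF zs(2)[OF that(1)]]] True by simp
    then have "1 < norm (\<iota> (br zs x + z))" using that(2) by (simp add: norm_iota)
    then show ?thesis using norm_D_less_1 by force
  qed
  then show ?thesis by blast
next
  case False
  have nz: "br zs x + z \<noteq> 0" if "x \<in> ball x0 \<epsilon>" for x
  proof
    assume "br zs x + z = 0"
    then have "br zs x = - z" by (simp add: eq_neg_iff_add_eq_0)
    then have "- z \<in> D" using valid_br_in_E[OF zs(2)[OF that]] E_subset_D by auto
    then show False using Z_inter_D[of "- z"] Z_minus[OF z] False by simp
  qed
  have "\<exists>g\<in>signed_walls. \<forall>x\<in>ball x0 \<epsilon>. sgn (1/2 - u \<bullet> \<iota> (br zs x + z)) = sgn (g x)" if u: "u \<in> U" for u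
  proof -
    have Qu: "Q u - z \<in> Z" "norm u = 1" using U_Q[OF u] u Z_diff z by (auto simp: U_def)
    obtain g where g: "g \<in> signed_walls"
      "\<And>x. valid zs x \<Longrightarrow> sgn ((norm (br zs x - (Q u - z)))\<^sup>2 - 1) = sgn (g x)"
      using signed_walls_pullback_br[OF wall_sphere[OF Qu(1)] zs(1)] by blast
    show ?thesis
    proof (intro bexI[OF _ g(1)] ballI)
      fix x assume x: "x \<in> ball x0 \<epsilon>"
      show "sgn (1/2 - u \<bullet> \<iota> (br zs x + z)) = sgn (g x)"
        using sgn_half_minus_inner_iota[OF nz[OF x], of u] g(2)[OF zs(2)[OF x]] Qu(2) by (simp add: algebra_simps)
    qed
  qed
  then obtain G where G: "\<And>u. u \<in> U \<Longrightarrow> G u \<in> signed_walls"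
    "\<And>u x. u \<in> U \<Longrightarrow> x \<in> ball x0 \<epsilon> \<Longrightarrow> sgn (1/2 - u \<bullet> \<iota> (br zs x + z)) = sgn (G u x)" by metis
  have x0: "x0 \<in> ball x0 \<epsilon>" using \<epsilon> by simp
  let ?y = "\<lambda>x. \<iota> (br zs x + z)"
  \<comment> \<open>A sign can change on the ball only if \<open>?y x0\<close> lies on the plane of
    that face. The two cases below avoid this: in the first the boundary hypothesis puts
    \<open>?y x0\<close> into \<open>E\<close>, in the second a strictly violated face is
    chosen.\<close>
  have same: "sgn (1/2 - u \<bullet> ?y x) = sgn (1/2 - u \<bullet> ?y x0)"
    if "u \<in> U" "x \<in> ball x0 \<epsilon>" "u \<bullet> ?y x0 \<noteq> 1/2" for u x
  proof -
    have "G u x0 \<noteq> 0" using G(2)[OF that(1) x0] that(3) by (auto simp: sgn_if split: if_splits)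
    then show ?thesis using stable[OF G(1)[OF that(1)] that(2)] G(2)[OF that(1)] that(2) x0 by metis
  qed
  show ?thesis
  proof (cases "?y x0 \<in> D")
    case True
    have "?y x0 \<in> E"
    proof (rule ccontr)
      assume "?y x0 \<notin> E"
      then have fr: "?y x0 \<in> frontier K" using D_diff_E_frontier True by blast
      have "T (?y x0) = br zs x0"
        using T_branch[OF _ z nz[OF x0]] valid_br_in_E[OF zs(2)[OF x0]] E_subset_K by blast
      then have "(T ^^ Suc (length zs)) (?y x0) = x0"
        using T_funpow_br[OF zs(2)[OF x0]] by (simp add: funpow_swap1)
      then have "x0 \<in> (T ^^ Suc (length zs)) ` frontier K" using fr by (metis image_eqI)
      then show False using P by blast
    qed
    then have lt: "u \<bullet> ?y x0 < 1/2" if "u \<in> U" for u using that unfolding E_def by blast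
    have "?y x \<in> E" if x: "x \<in> ball x0 \<epsilon>" for x
      unfolding E_def
    proof (intro CollectI ballI)
      fix u assume u: "u \<in> U"
      show "u \<bullet> ?y x < 1/2" using same[OF u x] lt[OF u] by (auto simp: sgn_if split: if_splits)
    qed
    then show ?thesis using zs(2) z nz by simp
  next
    case notD: False
    then obtain u where u: "u \<in> U" "u \<bullet> ?y x0 > 1/2" unfolding D_eq by force
    have "?y x \<notin> D" if x: "x \<in> ball x0 \<epsilon>" for x
    proof
      assume "?y x \<in> D"
      then have "u \<bullet> ?y x \<le> 1/2" using D_unit u by blast
      then show False using same[OF u(1) x] u(2) by (auto simp: sgn_if split: if_splits)
    qed
    then show ?thesis by blast
  qed
qed

lemma valid_on_ball:
  assumes stable: "\<And>g x. g \<in> signed_walls \<Longrightarrow> x \<in> ball x0 \<epsilon> \<Longrightarrow> g x0 \<noteq> 0 \<Longrightarrow> sgn (g x) = sgn (g x0)"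
    and \<epsilon>: "\<epsilon> > 0" "ball x0 \<epsilon> \<subseteq> E" and P: "x0 \<notin> (\<Union>n. (T ^^ n) ` frontier K)"
    and zs: "valid zs x0" and x: "x \<in> ball x0 \<epsilon>"
  shows "valid zs x"
  using zs x
proof (induction zs arbitrary: x)
  case Nil
  then show ?case using \<epsilon> by auto
next
  case (Cons z zs)
  have set: "valid ws x0 \<Longrightarrow> set ws \<subseteq> Z" for ws by (induction ws) auto
  have v: "valid zs x0" "z \<in> Z" "br zs x0 + z \<noteq> 0" "\<iota> (br zs x0 + z) \<in> D"
    using Cons.prems E_subset_D by auto
  have "x0 \<in> ball x0 \<epsilon>" using \<epsilon> by simp
  with branch_dichotomy[OF stable \<epsilon>(1) P set[OF v(1)] Cons.IH[OF v(1)] v(2)] v(3,4) Cons.prems(2)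
  show ?case by blast
qed

lemma valid_set: "valid zs x \<Longrightarrow> set zs \<subseteq> Z"
  by (induction zs) auto

section \<open>Contraction and conformal factors of branches\<close>

lemma br_contraction:
  assumes r: "\<And>x. x \<in> D \<Longrightarrow> norm x \<le> r" and v: "valid zs x" "valid zs y" and r0: "0 < r"
  shows "norm (br zs x - br zs y) \<le> (r\<^sup>2) ^ length zs * norm (x - y)"
  using v
proof (induction zs)
  case (Cons z zs)
  let ?a = "br zs x + z" and ?b = "br zs y + z"
  \<comment> \<open>Valid branches land in \<open>D\<close>, so 1 / |a| = |\<iota> a| \<le> r; by
    the distance formula each inversion contributes a factor r^2.\<close>
  have ab: "?a \<noteq> 0" "?b \<noteq> 0" "1 / norm ?a \<le> r" "1 / norm ?b \<le> r"
    using Cons.prems r E_subset_D by (auto simp flip: norm_iota)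
  have "norm (br (z # zs) x - br (z # zs) y) = norm (br zs x - br zs y) * ((1 / norm ?a) * (1 / norm ?b))"
    using norm_iota_diff[OF ab(1,2)] by simp
  also have "\<dots> \<le> ((r\<^sup>2) ^ length zs * norm (x - y)) * (r * r)"
    using Cons ab r0 by (intro mult_mono) auto
  finally show ?case by (simp add: power2_eq_square mult_ac)
qed simp

text \<open>An inversion scales lengths at y by 1 / |y|^2, so by the chain rule \<open>den\<close>
  is the reciprocal of the conformal factor of the branch.\<close>

primrec den :: "'a list \<Rightarrow> 'a \<Rightarrow> real" where
  "den [] x = 1"
| "den (z # zs) x = (norm (br zs x + z))\<^sup>2 * den zs x"

lemma den_pos: "valid zs x \<Longrightarrow> 0 < den zs x"
  by (induction zs) auto

lemma den_nonneg: "0 \<le> den zs x"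
  by (induction zs) auto

text \<open>The claims need each other: \<open>den (z # zs)\<close> is the second expression for
  \<open>zs\<close> at q = - z, and the second expression for \<open>z # zs\<close> leads back to
  \<open>den zs\<close> if q = 0 and to the point \<iota> q - z otherwise. The alternative
  \<open>\<alpha> = 0 \<or> \<beta> = 0\<close> separates a pole at infinity from a pole at
  \<open>p\<close>.\<close>

lemma den_form:
  shows "\<exists>\<alpha> \<beta> p. \<alpha> \<ge> 0 \<and> \<beta> \<ge> 0 \<and> (\<alpha> = 0 \<or> \<beta> = 0) \<and> (\<forall>x. valid zs x \<longrightarrow> den zs x = \<alpha> * (norm (x - p))\<^sup>2 + \<beta>)"
    and "\<exists>\<alpha> \<beta> p. \<alpha> \<ge> 0 \<and> \<beta> \<ge> 0 \<and> (\<alpha> = 0 \<or> \<beta> = 0) \<and>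
       (\<forall>x. valid zs x \<longrightarrow> (norm (br zs x - q))\<^sup>2 * den zs x = \<alpha> * (norm (x - p))\<^sup>2 + \<beta>)"
proof (induction zs arbitrary: q)
  case Nil
  { case 1 show ?case by (intro exI[of _ 0] exI[of _ 1]) auto }
  { case 2 show ?case by (intro exI[of _ 1] exI[of _ 0] exI[of _ q]) auto }
next
  case (Cons z zs)
  { case 1
    show ?case using Cons(2)[of "- z"] by simp blast }
  { case 2
    show ?case
    proof (cases "q = 0")
      case True
      from Cons(1) obtain \<alpha> \<beta> p where h: "\<alpha> \<ge> 0" "\<beta> \<ge> 0" "\<alpha> = 0 \<or> \<beta> = 0"
        "\<And>x. valid zs x \<Longrightarrow> den zs x = \<alpha> * (norm (x - p))\<^sup>2 + \<beta>" by blast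
      show ?thesis
        by (intro exI[of _ \<alpha>] exI[of _ \<beta>] exI[of _ p]) (use h in \<open>auto simp: True norm_iota power_divide\<close>)
    next
      case False
      from Cons(2)[of "\<iota> q - z"] obtain \<alpha> \<beta> p where h: "\<alpha> \<ge> 0" "\<beta> \<ge> 0" "\<alpha> = 0 \<or> \<beta> = 0"
        "\<And>x. valid zs x \<Longrightarrow> (norm (br zs x - (\<iota> q - z)))\<^sup>2 * den zs x = \<alpha> * (norm (x - p))\<^sup>2 + \<beta>" by blast
      have eq: "(norm (br (z # zs) x - q))\<^sup>2 * den (z # zs) x = (norm q)\<^sup>2 * ((norm (br zs x - (\<iota> q - z)))\<^sup>2 * den zs x)"
        if "valid (z # zs) x" for x
      proof -
        have nz: "br zs x + z \<noteq> 0" "\<iota> q \<noteq> 0" using that False by auto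
        have "norm (\<iota> (br zs x + z) - \<iota> (\<iota> q)) * norm (br zs x + z) = norm q * norm (br zs x + z - \<iota> q)"
          using nz False by (subst norm_iota_diff) (auto simp: norm_iota)
        then have "(norm (\<iota> (br zs x + z) - q))\<^sup>2 * (norm (br zs x + z))\<^sup>2 = (norm q)\<^sup>2 * (norm (br zs x + z - \<iota> q))\<^sup>2"
          by (metis iota_iota power_mult_distrib)
        then show ?thesis by (simp add: algebra_simps)
      qed
      show ?thesis
      proof (rule exI[of _ "(norm q)\<^sup>2 * \<alpha>"], rule exI[of _ "(norm q)\<^sup>2 * \<beta>"], rule exI[of _ p],
          intro conjI allI impI)
        fix x assume v: "valid (z # zs) x"
        then have "valid zs x" by simp
        then show "(norm (br (z # zs) x - q))\<^sup>2 * den (z # zs) x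
            = (norm q)\<^sup>2 * \<alpha> * (norm (x - p))\<^sup>2 + (norm q)\<^sup>2 * \<beta>"
          unfolding eq[OF v] using h(4) by (simp add: distrib_left mult.assoc)
      qed (use h in auto)
    qed }
qed

text \<open>\<open>den\<close> is positive wherever the branch is valid, so a finite pole
  \<open>p\<close> is not in the ball: v = p - x0 has norm at least \<epsilon>, and q = v / |v|^2
  has norm 1 / |v|.\<close>

lemma den_kernel:
  assumes \<epsilon>: "\<epsilon> > 0" and v: "\<And>x. x \<in> ball x0 \<epsilon> \<Longrightarrow> valid zs x"
  obtains c q where "c > 0" "norm q \<le> 1 / \<epsilon>"
    "\<And>h. norm h < \<epsilon> \<Longrightarrow> 1 / den zs (x0 + h) ^ DIM('a) = c * mobius_kernel q h"
proof -
  have vh: "valid zs (x0 + h)" if "norm h < \<epsilon>" for h using v[of "x0 + h"] that by (simp add: dist_norm)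
  obtain \<alpha> \<beta> p where f: "\<alpha> \<ge> 0" "\<beta> \<ge> 0" "\<alpha> = 0 \<or> \<beta> = 0"
      "\<And>x. valid zs x \<Longrightarrow> den zs x = \<alpha> * (norm (x - p))\<^sup>2 + \<beta>"
    using den_form(1)[of zs] by blast
  have d0: "0 < den zs (x0 + h)" if "norm h < \<epsilon>" for h using den_pos[OF vh[OF that]] .
  show ?thesis
  proof (cases "\<alpha> = 0")
    case True
    then have "\<beta> > 0" using d0[of 0] f(4)[OF vh[of 0]] \<epsilon> f(2) by simp
    then show ?thesis
      by (intro that[of "1 / \<beta> ^ DIM('a)" 0]) (use \<epsilon> True f(4)[OF vh] in \<open>auto simp: mobius_kernel_def\<close>)
  next
    case False
    then have \<alpha>: "\<alpha> > 0" and \<beta>: "\<beta> = 0" using f by auto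
    define v where "v = p - x0"
    have v: "\<epsilon> \<le> norm v"
    proof (rule ccontr)
      assume "\<not> \<epsilon> \<le> norm v"
      then show False using d0[of v] f(4)[OF vh[of v]] \<beta> by (simp add: v_def)
    qed
    define q where "q = v /\<^sub>R (norm v)\<^sup>2"
    have v0: "norm v > 0" using v \<epsilon> by linarith
    have nq: "norm q = 1 / norm v" using v0 by (simp add: q_def power2_eq_square divide_inverse)
    show ?thesis
    proof (rule that[of "1 / (\<alpha> * (norm v)\<^sup>2) ^ DIM('a)" q])
      show "1 / (\<alpha> * (norm v)\<^sup>2) ^ DIM('a) > 0" using \<alpha> v0 by simp
      show "norm q \<le> 1 / \<epsilon>" using nq v \<epsilon> by (simp add: frac_le)
      fix h :: 'a assume h: "norm h < \<epsilon>"
      have e: "x0 + h - p = h - v" by (simp add: v_def)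
      have "den zs (x0 + h) = \<alpha> * (norm (x0 + h - p))\<^sup>2" using f(4)[OF vh[OF h]] \<beta> by simp
      also have "\<dots> = \<alpha> * (norm (h - v))\<^sup>2" by (simp only: e)
      also have "\<dots> = (\<alpha> * (norm v)\<^sup>2) * (1 - 2 * (h \<bullet> q) + (norm h)\<^sup>2 * (norm q)\<^sup>2)"
        unfolding norm_diff_sq nq using v0 by (simp add: q_def field_simps power2_eq_square)
      finally show "1 / den zs (x0 + h) ^ DIM('a) = 1 / (\<alpha> * (norm v)\<^sup>2) ^ DIM('a) * mobius_kernel q h"
        by (simp add: mobius_kernel_def power_mult_distrib)
    qed
  qed
qed

end

section \<open>Measure theory\<close>

lemma borel_measurable_nn_integral_count_space:
  fixes f :: "'i \<Rightarrow> 'b \<Rightarrow> ennreal"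
  assumes I: "countable I" and f: "\<And>i. i \<in> I \<Longrightarrow> f i \<in> borel_measurable N"
  shows "(\<lambda>x. \<integral>\<^sup>+i. f i x \<partial>count_space I) \<in> borel_measurable N"
proof (cases "finite I")
  case True
  then show ?thesis using f by (simp add: nn_integral_count_space_finite)
next
  case False
  have bij: "bij_betw (from_nat_into I) UNIV I" using I False by (rule bij_betw_from_nat_into)
  have "(\<integral>\<^sup>+i. f i x \<partial>count_space I) = (\<Sum>n. f (from_nat_into I n) x)" for x
    by (simp add: nn_integral_bij_count_space[symmetric, OF bij] nn_integral_count_space_nat)
  moreover have "from_nat_into I n \<in> I" for n using False by (intro from_nat_into) auto
  ultimately show ?thesis using f by simp
qed

lemma nn_integral_count_space_infsum:
  fixes a :: "'i \<Rightarrow> real"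
  assumes a: "a summable_on V" and pos: "\<And>s. s \<in> V \<Longrightarrow> 0 \<le> a s"
  shows "(\<integral>\<^sup>+s. ennreal (a s) \<partial>count_space V) = ennreal (infsum a V)"
proof -
  have "(\<lambda>s. norm (a s)) summable_on V"
    using a by (rule summable_on_cong[THEN iffD1, rotated]) (use pos in auto)
  then have ab: "Infinite_Set_Sum.abs_summable_on a V" by (simp only: abs_summable_equivalent)
  show ?thesis using nn_integral_conv_infsetsum[OF ab pos] by (simp add: infsetsum_infsum[OF ab])
qed

lemma sigma_finite_lebesgue: "sigma_finite_measure (lebesgue :: 'a::euclidean_space measure)"
proof
  let ?A = "range (\<lambda>n. ball (0::'a) (real n))"
  have "\<exists>n. norm x < real n" for x :: 'a by (rule reals_Archimedean2)
  then have "\<Union>?A = space lebesgue" by auto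
  moreover have "emeasure lebesgue a \<noteq> \<infinity>" if "a \<in> ?A" for a
    using that by (auto simp: emeasure_ball)
  ultimately show "\<exists>A. countable A \<and> A \<subseteq> sets (lebesgue :: 'a measure) \<and> \<Union>A = space lebesgue \<and>
      (\<forall>a\<in>A. emeasure lebesgue a \<noteq> \<infinity>)"
    by (intro exI[of _ ?A]) auto
qed

text \<open>A measurable function is an almost everywhere limit of continuous ones, but these need
  not be dominated. Truncating \<open>f\<close> at \<open>M\<close> and clipping the approximants to
  [0, M] supplies a majorant that is integrable over the compact set.\<close>

lemma L1_approx_continuous:
  fixes f :: "'a::euclidean_space \<Rightarrow> real"
  assumes f: "f \<in> borel_measurable lebesgue" "\<And>x. 0 \<le> f x" "(\<integral>\<^sup>+x. f x \<partial>lebesgue) < \<infinity>"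
    and C: "compact C" and e: "0 < e"
  obtains g where "continuous_on UNIV g" "\<And>x. 0 \<le> g x"
    "(\<integral>\<^sup>+x. ennreal \<bar>f x - g x\<bar> * indicator C x \<partial>lebesgue) < ennreal e"
proof -
  note [measurable] = f(1)
  have Cm [measurable]: "C \<in> sets lebesgue" using C by (simp add: compact_imp_closed)
  have Cfin: "emeasure lebesgue C < \<infinity>" using emeasure_compact_finite[OF C] Cm C by (simp add: compact_imp_closed)
  obtain N and G :: "nat \<Rightarrow> 'a \<Rightarrow> real" where N: "negligible N" and G: "\<And>n. continuous_on UNIV (G n)"
    and lim: "\<And>x. x \<notin> N \<Longrightarrow> (\<lambda>n. G n x) \<longlonglongrightarrow> f x"
    using lebesgue_measurable_imp_measurable_on[OF f(1), of UNIV] unfolding measurable_on_def by auto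
  have Gm [measurable]: "G n \<in> borel_measurable lebesgue" for n
    using G[of n] by (intro measurable_completion) (auto intro: borel_measurable_continuous_onI)
  have "(\<lambda>M. \<integral>\<^sup>+x. ennreal (f x - min (f x) (real M)) * indicator C x \<partial>lebesgue) \<longlonglongrightarrow> (\<integral>\<^sup>+x. 0 \<partial>(lebesgue :: 'a measure))"
  proof (rule nn_integral_dominated_convergence[where u' = "\<lambda>x. 0" and w = "\<lambda>x. ennreal (f x)"])
    show "AE x in lebesgue. ennreal (f x - min (f x) (real M)) * indicator C x \<le> ennreal (f x)" for M
      using f(2) by (auto intro!: AE_I2 ennreal_leI split: split_indicator simp: min_def)
    show "AE x in lebesgue. (\<lambda>M. ennreal (f x - min (f x) (real M)) * indicator C x) \<longlonglongrightarrow> 0"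
    proof (intro AE_I2 tendsto_eventually)
      fix x
      obtain m :: nat where "f x \<le> real m" using real_arch_simple by blast
      then have "min (f x) (real n) = f x" if "n \<ge> m" for n using that by (simp add: min_def)
      then show "\<forall>\<^sub>F n in sequentially. ennreal (f x - min (f x) (real n)) * indicator C x = 0"
        unfolding eventually_sequentially by (intro exI[of _ m]) auto
    qed
  qed (use f(3) in auto)
  then have "\<forall>\<^sub>F M in sequentially. (\<integral>\<^sup>+x. ennreal (f x - min (f x) (real M)) * indicator C x \<partial>lebesgue) < ennreal (e / 2)"
    using e by (intro order_tendstoD(2)) auto
  then obtain M :: nat where M: "(\<integral>\<^sup>+x. ennreal (f x - min (f x) (real M)) * indicator C x \<partial>lebesgue) < ennreal (e / 2)"
    using eventually_happens by fastforce
  define g where "g = (\<lambda>n x. max 0 (min (G n x) (real M)))"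
  have [measurable]: "g n \<in> borel_measurable lebesgue" for n unfolding g_def by measurable
  have "(\<lambda>n. \<integral>\<^sup>+x. ennreal \<bar>min (f x) (real M) - g n x\<bar> * indicator C x \<partial>lebesgue) \<longlonglongrightarrow> (\<integral>\<^sup>+x. 0 \<partial>(lebesgue :: 'a measure))"
  proof (rule nn_integral_dominated_convergence[where u' = "\<lambda>x. 0" and w = "\<lambda>x. ennreal (real M) * indicator C x"])
    show "AE x in lebesgue. ennreal \<bar>min (f x) (real M) - g n x\<bar> * indicator C x \<le> ennreal (real M) * indicator C x" for n
    proof -
      have "\<bar>min (f x) (real M) - g n x\<bar> \<le> real M" for x
        using f(2)[of x] by (auto simp: g_def min_def max_def abs_le_iff)
      then show ?thesis by (auto intro!: AE_I2 ennreal_leI split: split_indicator)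
    qed
    show "AE x in lebesgue. (\<lambda>n. ennreal \<bar>min (f x) (real M) - g n x\<bar> * indicator C x) \<longlonglongrightarrow> 0"
    proof (rule AE_I'[of N])
      show "N \<in> null_sets lebesgue" using N by (simp add: negligible_iff_null_sets)
      have "(\<lambda>n. ennreal \<bar>min (f x) (real M) - g n x\<bar> * indicator C x) \<longlonglongrightarrow> 0" if x: "x \<notin> N" for x
      proof -
        have "(\<lambda>n. \<bar>min (f x) (real M) - g n x\<bar>) \<longlonglongrightarrow> \<bar>min (f x) (real M) - max 0 (min (f x) (real M))\<bar>"
          unfolding g_def by (intro tendsto_intros lim x)
        also have "\<bar>min (f x) (real M) - max 0 (min (f x) (real M))\<bar> = 0" using f(2)[of x] by simp
        finally have "(\<lambda>n. ennreal \<bar>min (f x) (real M) - g n x\<bar>) \<longlonglongrightarrow> ennreal 0" by (rule tendsto_ennrealI)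
        then show ?thesis by (cases "x \<in> C") auto
      qed
      then show "{x \<in> space lebesgue. \<not> (\<lambda>n. ennreal \<bar>min (f x) (real M) - g n x\<bar> * indicator C x) \<longlonglongrightarrow> 0} \<subseteq> N"
        by blast
    qed
  qed (use Cfin in \<open>auto simp: nn_integral_cmult_indicator ennreal_mult_less_top\<close>)
  then have "\<forall>\<^sub>F n in sequentially. (\<integral>\<^sup>+x. ennreal \<bar>min (f x) (real M) - g n x\<bar> * indicator C x \<partial>lebesgue) < ennreal (e / 2)"
    using e by (intro order_tendstoD(2)) auto
  then obtain n where n: "(\<integral>\<^sup>+x. ennreal \<bar>min (f x) (real M) - g n x\<bar> * indicator C x \<partial>lebesgue) < ennreal (e / 2)"
    using eventually_happens by fastforce
  show ?thesis
  proof (rule that[of "g n"])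
    show "continuous_on UNIV (g n)" unfolding g_def by (intro continuous_intros G)
    show "0 \<le> g n x" for x by (simp add: g_def)
    have "(\<integral>\<^sup>+x. ennreal \<bar>f x - g n x\<bar> * indicator C x \<partial>lebesgue)
        \<le> (\<integral>\<^sup>+x. ennreal (f x - min (f x) (real M)) * indicator C x
               + ennreal \<bar>min (f x) (real M) - g n x\<bar> * indicator C x \<partial>lebesgue)"
      by (intro nn_integral_mono) (auto split: split_indicator simp flip: ennreal_plus intro!: ennreal_leI)
    also have "\<dots> < ennreal (e / 2) + ennreal (e / 2)"
      using M n by (subst nn_integral_add) (auto intro: add_strict_mono)
    also have "\<dots> = ennreal e" using e by (simp flip: ennreal_plus)
    finally show "(\<integral>\<^sup>+x. ennreal \<bar>f x - g n x\<bar> * indicator C x \<partial>lebesgue) < ennreal e" .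
  qed
qed

context cf_system
begin

lemma br_measurable [measurable]: "br zs \<in> borel_measurable borel"
  by (induction zs) auto

lemma den_measurable [measurable]: "den zs \<in> borel_measurable borel"
  by (induction zs) auto

lemma iota_image: "\<iota> ` S = \<iota> -` S"
  by (auto intro: image_eqI[of _ \<iota> "\<iota> _"])

text \<open>Since \<iota> is its own inverse, images under branches are preimages under measurable
  maps; this makes images of Borel sets Borel.\<close>

lemma br_Cons_image: "br (z # zs) ` A = (\<lambda>y. \<iota> y - z) -` (br zs ` A)"
proof -
  have "br (z # zs) ` A = \<iota> ` ((\<lambda>y. y + z) ` br zs ` A)" by (simp add: image_image)
  also have "\<dots> = \<iota> -` ((\<lambda>y. y + z) ` br zs ` A)" by (rule iota_image)
  also have "\<dots> = (\<lambda>y. \<iota> y - z) -` (br zs ` A)" by (auto simp: image_iff algebra_simps)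
  finally show ?thesis .
qed

lemma br_image_borel: "A \<in> sets borel \<Longrightarrow> br zs ` A \<in> sets borel"
proof (induction zs)
  case (Cons z zs)
  have "(\<lambda>y. \<iota> y - z) \<in> borel_measurable borel" by measurable
  from measurable_sets[OF this Cons.IH[OF Cons.prems]] show ?case
    by (simp only: br_Cons_image space_borel Int_UNIV_right)
qed simp

text \<open>Change of variables for a branch: the outermost inversion is removed by
  \<open>distr_iota\<close>, its translation by invariance of Lebesgue measure. \<open>A\<close> may
  be any Borel set, because branches are bijections of the whole space.\<close>

lemma nn_integral_br:
  assumes A [measurable]: "A \<in> sets borel" and F: "F \<in> borel_measurable borel"
  shows "(\<integral>\<^sup>+y. F y * indicator (br zs ` A) y \<partial>lborel)
       = (\<integral>\<^sup>+x. F (br zs x) * ennreal (1 / den zs x ^ DIM('a)) * indicator A x \<partial>lborel)"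
  using F
proof (induction zs arbitrary: F)
  case (Cons z zs F)
  note [measurable] = Cons.prems
  have m [measurable]: "br (z # zs) ` A \<in> sets borel" "br zs ` A \<in> sets borel" using br_image_borel A by blast+
  define G where "G = (\<lambda>y. F (\<iota> y) * indicator (br (z # zs) ` A) (\<iota> y))"
  have [measurable]: "G \<in> borel_measurable borel" unfolding G_def by measurable
  have ind: "indicator (br (z # zs) ` A) (\<iota> y) = (indicator (br zs ` A) (y - z) :: ennreal)" for y
    unfolding br_Cons_image by (simp split: split_indicator)
  have "(\<integral>\<^sup>+y. F y * indicator (br (z # zs) ` A) y \<partial>lborel) = (\<integral>\<^sup>+x. G (\<iota> x) \<partial>lborel)"
    by (simp add: G_def)
  also have "\<dots> = (\<integral>\<^sup>+y. G y \<partial>distr lborel borel \<iota>)" by (simp add: nn_integral_distr)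
  also have "\<dots> = (\<integral>\<^sup>+y. ennreal (1 / norm y ^ (2 * DIM('a))) * G y \<partial>lborel)"
    unfolding distr_iota by (subst nn_integral_density) auto
  also have "\<dots> = (\<integral>\<^sup>+y. ennreal (1 / norm y ^ (2 * DIM('a))) * G y \<partial>distr lborel borel ((+) z))"
    by (simp add: lborel_distr_plus)
  also have "\<dots> = (\<integral>\<^sup>+y. ennreal (1 / norm (z + y) ^ (2 * DIM('a))) * G (z + y) \<partial>lborel)"
    by (subst nn_integral_distr) auto
  also have "\<dots> = (\<integral>\<^sup>+y. (F (\<iota> (y + z)) * ennreal (1 / norm (y + z) ^ (2 * DIM('a)))) * indicator (br zs ` A) y \<partial>lborel)"
    by (intro nn_integral_cong) (simp only: G_def ind, simp add: add.commute mult_ac)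
  also have "\<dots> = (\<integral>\<^sup>+x. F (\<iota> (br zs x + z)) * ennreal (1 / norm (br zs x + z) ^ (2 * DIM('a)))
        * ennreal (1 / den zs x ^ DIM('a)) * indicator A x \<partial>lborel)"
    by (rule Cons.IH) measurable
  also have "\<dots> = (\<integral>\<^sup>+x. F (br (z # zs) x) * ennreal (1 / den (z # zs) x ^ DIM('a)) * indicator A x \<partial>lborel)"
  proof (intro nn_integral_cong)
    fix x
    have "ennreal (1 / norm (br zs x + z) ^ (2 * DIM('a))) * ennreal (1 / den zs x ^ DIM('a))
        = ennreal (1 / norm (br zs x + z) ^ (2 * DIM('a)) * (1 / den zs x ^ DIM('a)))"
      using den_nonneg by (intro ennreal_mult[symmetric]) auto
    also have "\<dots> = ennreal (1 / den (z # zs) x ^ DIM('a))"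
      by (simp add: power_mult power_mult_distrib)
    finally show "F (\<iota> (br zs x + z)) * ennreal (1 / norm (br zs x + z) ^ (2 * DIM('a)))
        * ennreal (1 / den zs x ^ DIM('a)) * indicator A x
        = F (br (z # zs) x) * ennreal (1 / den (z # zs) x ^ DIM('a)) * indicator A x"
      by (simp only: mult.assoc br.simps)
  qed
  finally show ?case .
qed simp

end

text \<open>Intended reading: a, b are the masses and s, s' the volumes of nested sets on which the
  density is c up to a total error \<eta>. Eliminating c costs \<eta> only once more because s / s'
  \<le> 1, and no subtraction in \<open>ennreal\<close> is involved.\<close>

lemma ennreal_ratio_bound:
  fixes a b c s s' \<eta> :: ennreal
  assumes a: "a \<le> c * s + \<eta>" and b: "c * s' \<le> b + \<eta>" and s: "s \<le> s'" and s': "s' \<noteq> 0" "s' \<noteq> \<infinity>"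
  shows "a \<le> b / s' * s + 2 * \<eta>"
proof -
  define \<rho> where "\<rho> = s / s'"
  have \<rho>s: "s' * \<rho> = s" using s' by (simp add: \<rho>_def ennreal_times_divide ennreal_mult_divide_eq mult.commute)
  have \<rho>1: "\<rho> \<le> 1" unfolding \<rho>_def using s s' by (simp add: divide_le_posI_ennreal zero_less_iff_neq_zero)
  have "c * s = c * s' * \<rho>" by (simp only: \<rho>s[symmetric] mult.assoc)
  also have "\<dots> \<le> (b + \<eta>) * \<rho>" using b by (rule mult_right_mono) simp
  also have "\<dots> = b * \<rho> + \<eta> * \<rho>" by (simp add: distrib_right)
  also have "\<dots> \<le> b * \<rho> + \<eta> * 1" using \<rho>1 by (intro add_left_mono mult_left_mono) auto
  also have "b * \<rho> = b / s' * s" by (simp add: \<rho>_def ennreal_times_divide ennreal_divide_times mult.commute)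
  finally have "a \<le> b / s' * s + \<eta> + \<eta>" using a by (simp add: add_right_mono order_trans)
  then show ?thesis by (simp add: mult_2 add.assoc)
qed

section \<open>Invariant measures\<close>

locale cf_measure = cf_system \<iota> Q Z K for \<iota> Q :: "'a::euclidean_space \<Rightarrow> 'a" and Z K +
  fixes \<mu> :: "'a measure"
  assumes sets_mu: "sets \<mu> = sets lebesgue"
    and prob: "prob_space \<mu>"
    and T_meas: "cf_map \<iota> Z K \<in> measurable \<mu> \<mu>"
    and T_inv: "\<forall>A\<in>sets \<mu>. emeasure \<mu> (cf_map \<iota> Z K -` A \<inter> space \<mu>) = emeasure \<mu> A"
    and equiv: "\<forall>A\<in>sets lebesgue. (emeasure \<mu> A = 0 \<longleftrightarrow> emeasure lebesgue (A \<inter> dirichlet Z) = 0)"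
begin

sublocale prob_space \<mu> by (rule prob)

lemma space_mu: "space \<mu> = UNIV" using sets_eq_imp_space_eq[OF sets_mu] by simp

text \<open>The point 0 joins the exceptional set because T 0 = 0 is a convention and not the
  inverse of a branch.\<close>

lemma mu_compl_E: "emeasure \<mu> (- E \<union> {0}) = 0"
proof -
  have E: "E \<in> sets lebesgue" using open_E by (simp add: borel_open)
  then have m: "- E \<union> {0} \<in> sets lebesgue" unfolding Compl_eq_Diff_UNIV by (intro sets.Un sets.Diff) auto
  have "negligible ((D - E) \<union> {0})" using negligible_D_diff_E by simp
  then have "negligible ((- E \<union> {0}) \<inter> D)" by (rule negligible_subset) auto
  then have "emeasure lebesgue ((- E \<union> {0}) \<inter> D) = 0" by (simp add: negligible_iff_null_sets null_sets_def)
  then show ?thesis using equiv m by blast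
qed

lemma br_inj:
  assumes "valid zs x" "valid ws y" "length zs = length ws" "br zs x = br ws y"
  shows "zs = ws"
  using assms
proof (induction zs arbitrary: ws)
  case (Cons z zs)
  then obtain w ws' where ws: "ws = w # ws'" by (cases ws) auto
  have eq: "br zs x + z = br ws' y + w" using Cons.prems(4) ws by simp (metis iota_iota)
  have K: "br zs x \<in> K" "br ws' y \<in> K" "z \<in> Z" "w \<in> Z"
    using Cons.prems ws valid_br_in_E[of zs x] valid_br_in_E[of ws' y] E_subset_K by auto
  have "br zs x + z - z \<in> K" using K by simp
  moreover have "br zs x + z - w \<in> K" unfolding eq using K by simp
  ultimately have "z = w" using ex1_rep[of "br zs x + z"] K by blast
  then show ?case using Cons.IH[of ws'] Cons.prems ws eq by simp
qed simp

end

section \<open>Images of a stable ball under the branches of one length\<close>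

locale cf_point = cf_measure \<iota> Q Z K \<mu> for \<iota> Q :: "'a::euclidean_space \<Rightarrow> 'a" and Z K \<mu> +
  fixes x0 :: 'a and \<epsilon> :: real
  assumes \<epsilon>: "\<epsilon> > 0" and ball_E: "ball x0 \<epsilon> \<subseteq> E"
    and stable: "\<And>g x. g \<in> signed_walls \<Longrightarrow> x \<in> ball x0 \<epsilon> \<Longrightarrow> g x0 \<noteq> 0 \<Longrightarrow> sgn (g x) = sgn (g x0)"
    and not_boundary: "x0 \<notin> (\<Union>n. (T ^^ n) ` frontier K)"
begin

definition V where "V n = {zs. length zs = n \<and> valid zs x0}"

lemma V_valid: "zs \<in> V n \<Longrightarrow> x \<in> ball x0 \<epsilon> \<Longrightarrow> valid zs x"
  using valid_on_ball[OF stable \<epsilon> ball_E not_boundary] by (simp add: V_def)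

lemma countable_V: "countable (V n)"
  by (rule countable_subset[OF _ countable_lists[OF countable_Z]]) (auto simp: V_def dest: valid_set)

lemma V_0: "V 0 = {[]}"
proof -
  have "x0 \<in> E" using ball_E \<epsilon> by (meson centre_in_ball subsetD)
  then show ?thesis by (auto simp: V_def)
qed

lemma br_image_E: "zs \<in> V n \<Longrightarrow> A \<subseteq> ball x0 \<epsilon> \<Longrightarrow> br zs ` A \<subseteq> E"
  using V_valid valid_br_in_E by blast

lemma disjoint_br: "A \<subseteq> ball x0 \<epsilon> \<Longrightarrow> disjoint_family_on (\<lambda>zs. br zs ` A) (V n)"
  unfolding disjoint_family_on_def
proof (intro ballI impI)
  fix zs ws assume A: "A \<subseteq> ball x0 \<epsilon>" and v: "zs \<in> V n" "ws \<in> V n" "zs \<noteq> ws"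
  show "br zs ` A \<inter> br ws ` A = {}"
  proof (rule ccontr)
    assume "br zs ` A \<inter> br ws ` A \<noteq> {}"
    then obtain x y where xy: "x \<in> A" "y \<in> A" "br zs x = br ws y" by blast
    then have "valid zs x" "valid ws y" using V_valid v A by blast+
    moreover have "length zs = length ws" using v by (simp add: V_def)
    ultimately show False using br_inj xy(3) v(3) by blast
  qed
qed

lemma UN_br_borel: "A \<in> sets borel \<Longrightarrow> (\<Union>zs\<in>V n. br zs ` A) \<in> sets borel"
  using countable_V br_image_borel by (intro sets.countable_UN') auto

text \<open>Up to a null set, the preimage under \<open>T\<close> of the images at level n is the
  union of the images at level n + 1, so invariance carries the equation from one level to the
  next.\<close>

lemma mu_UN_br:
  assumes A: "A \<in> sets borel" "A \<subseteq> ball x0 \<epsilon>"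
  shows "emeasure \<mu> (\<Union>zs\<in>V n. br zs ` A) = emeasure \<mu> A"
proof (induction n)
  case 0
  show ?case by (simp add: V_0)
next
  case (Suc n)
  let ?S = "\<lambda>n. \<Union>zs\<in>V n. br zs ` A"
  have S: "?S n \<in> sets \<mu>" for n using UN_br_borel[OF A(1)] by (simp add: sets_mu)
  have TS: "T -` ?S n \<in> sets \<mu>" using measurable_sets[OF T_meas S, of n] by (simp add: space_mu)
  have N: "- E \<union> {0} \<in> null_sets \<mu>"
  proof -
    have "- E \<union> {0} \<in> sets lebesgue"
      unfolding Compl_eq_Diff_UNIV using open_E by (intro sets.Un sets.Diff) (auto simp: borel_open)
    then show ?thesis using mu_compl_E by (simp add: null_sets_def sets_mu)
  qed
  have sub: "?S (Suc n) \<subseteq> T -` ?S n"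
  proof
    fix y assume "y \<in> ?S (Suc n)"
    then obtain ws x where ws: "ws \<in> V (Suc n)" "x \<in> A" "y = br ws x" by auto
    then obtain z zs where zs: "ws = z # zs" by (auto simp: V_def length_Suc_conv)
    have "valid (z # zs) x" using V_valid[OF ws(1)] ws A zs by auto
    then have "T y = br zs x"
      using valid_br_in_E[of zs x] E_subset_K T_branch[of "br zs x" z] by (auto simp: ws zs)
    moreover have "zs \<in> V n" using ws zs by (simp add: V_def)
    ultimately show "y \<in> T -` ?S n" using ws by auto
  qed
  have sup: "T -` ?S n \<subseteq> ?S (Suc n) \<union> (- E \<union> {0})"
  proof
    fix y assume y: "y \<in> T -` ?S n"
    show "y \<in> ?S (Suc n) \<union> (- E \<union> {0})"
    proof (cases "y \<in> E \<and> y \<noteq> 0")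
      case True
      obtain zs x where zs: "zs \<in> V n" "x \<in> A" "T y = br zs x" using y by auto
      obtain z where z: "z \<in> Z" "\<iota> y = T y + z" using T_eq[of y] True by metis
      have yb: "y = \<iota> (br zs x + z)" using z zs by (metis iota_iota)
      have nz: "br zs x + z \<noteq> 0" using True yb by auto
      have x: "x \<in> ball x0 \<epsilon>" using zs A by auto
      have x0: "x0 \<in> ball x0 \<epsilon>" using \<epsilon> by simp
      have "set zs \<subseteq> Z" using zs valid_set by (auto simp: V_def)
      \<comment> \<open>The point \<open>x\<close> of the ball is sent to y in \<open>E\<close>,
        which excludes the second alternative; hence the digit \<open>z\<close> extends the branch
        on the whole ball and not only at \<open>x\<close>.\<close>
      from branch_dichotomy[OF stable \<epsilon> not_boundary this V_valid[OF zs(1)] z(1)]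
      have "\<forall>x\<in>ball x0 \<epsilon>. valid (z # zs) x"
        using x nz yb True E_subset_D by blast
      then have "valid (z # zs) x0" using x0 by blast
      then have "z # zs \<in> V (Suc n)" using zs(1) unfolding V_def by simp
      then show ?thesis using zs(2) yb by (intro UnI1 UN_I[of "z # zs"]) auto
    qed auto
  qed
  have "emeasure \<mu> (?S (Suc n)) = emeasure \<mu> (T -` ?S n)"
  proof (rule antisym)
    show "emeasure \<mu> (?S (Suc n)) \<le> emeasure \<mu> (T -` ?S n)" using sub TS by (rule emeasure_mono)
    have "emeasure \<mu> (T -` ?S n) \<le> emeasure \<mu> (?S (Suc n) \<union> (- E \<union> {0}))"
      by (rule emeasure_mono[OF sup sets.Un[OF S null_setsD2[OF N]]])
    also have "\<dots> = emeasure \<mu> (?S (Suc n))" using S[of "Suc n"] N by (rule emeasure_Un_null_set)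
    finally show "emeasure \<mu> (T -` ?S n) \<le> emeasure \<mu> (?S (Suc n))" .
  qed
  also have "\<dots> = emeasure \<mu> (?S n)" using T_inv S[of n] by (simp add: space_mu)
  finally show ?case using Suc by simp
qed

lemma mu_eq_sum:
  assumes A: "A \<in> sets borel" "A \<subseteq> ball x0 \<epsilon>"
  shows "emeasure \<mu> A = (\<integral>\<^sup>+zs. emeasure \<mu> (br zs ` A) \<partial>count_space (V n))"
  unfolding mu_UN_br[OF A, of n, symmetric]
  using br_image_borel[OF A(1)] countable_V disjoint_br[OF A(2)]
  by (intro emeasure_UN_countable) (auto simp: sets_mu)

lemma leb_br:
  assumes A: "A \<in> sets borel"
  shows "emeasure lborel (br zs ` A) = (\<integral>\<^sup>+x. ennreal (1 / den zs x ^ DIM('a)) * indicator A x \<partial>lborel)"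
  using nn_integral_br[OF A, of "\<lambda>_. 1" zs] br_image_borel[OF A, of zs] by simp

text \<open>The base in the denominator is at most (1 + |h| |q|)^2 \<le> 4: moving from 0 to
  \<open>h\<close> at most doubles the distance to the pole.\<close>

lemma mobius_kernel_lower:
  fixes q h :: 'a
  assumes "norm q \<le> 1 / \<epsilon>" "norm h < \<epsilon>"
  shows "1 / 4 ^ DIM('a) \<le> mobius_kernel q h"
proof -
  have t: "norm h * norm q < 1"
  proof -
    have "norm h * norm q \<le> norm h * (1 / \<epsilon>)" using assms by (intro mult_left_mono) auto
    also have "\<dots> < 1" using assms \<epsilon> by simp
    finally show ?thesis .
  qed
  define t where "t = norm h * norm q"
  have t0: "0 \<le> t" "t < 1" using t by (auto simp: t_def)
  have cs: "\<bar>h \<bullet> q\<bar> \<le> t" unfolding t_def by (rule Cauchy_Schwarz_ineq2)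
  have eq: "(norm h)\<^sup>2 * (norm q)\<^sup>2 = t\<^sup>2" by (simp add: t_def power_mult_distrib)
  have t2: "t\<^sup>2 \<le> 1" using t0 by (simp add: abs_square_le_1)
  have "0 < (1 - t)\<^sup>2" using t0 by simp
  also have "(1 - t)\<^sup>2 = 1 - 2 * t + t\<^sup>2" by (simp add: power2_eq_square algebra_simps)
  finally have "0 < 1 - 2 * (h \<bullet> q) + t\<^sup>2" using cs by linarith
  moreover have "1 - 2 * (h \<bullet> q) + t\<^sup>2 \<le> 4" using cs t0 t2 by linarith
  ultimately show ?thesis unfolding mobius_kernel_def eq
    by (intro divide_left_mono power_mono) auto
qed

lemma kernel_data:
  obtains c q where
    "\<And>zs n. zs \<in> V n \<Longrightarrow> 0 < c zs" "\<And>zs n. zs \<in> V n \<Longrightarrow> norm (q zs) \<le> 1 / \<epsilon>"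
    "\<And>zs n h. zs \<in> V n \<Longrightarrow> norm h < \<epsilon> \<Longrightarrow> 1 / den zs (x0 + h) ^ DIM('a) = c zs * mobius_kernel (q zs) h"
proof -
  have "\<exists>c q. 0 < c \<and> norm q \<le> 1 / \<epsilon> \<and>
      (\<forall>h. norm h < \<epsilon> \<longrightarrow> 1 / den zs (x0 + h) ^ DIM('a) = c * mobius_kernel q h)" if "zs \<in> (\<Union>n. V n)" for zs
  proof -
    have "\<And>x. x \<in> ball x0 \<epsilon> \<Longrightarrow> valid zs x" using that V_valid by auto
    from den_kernel[OF \<epsilon> this] show ?thesis by metis
  qed
  then obtain c q where *: "\<And>zs. zs \<in> (\<Union>n. V n) \<Longrightarrow> 0 < c zs \<and> norm (q zs) \<le> 1 / \<epsilon> \<and>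
      (\<forall>h. norm h < \<epsilon> \<longrightarrow> 1 / den zs (x0 + h) ^ DIM('a) = c zs * mobius_kernel (q zs) h)" by metis
  show ?thesis by (rule that[of c q]) (use * in blast)+
qed

text \<open>This controls the factor \<open>c\<close> of the Jacobian by the volume of the image,
  which keeps the total weight of the averages bounded.\<close>

lemma leb_br_lower:
  assumes zs: "zs \<in> V n" and \<delta>: "\<delta> \<le> \<epsilon>"
    and c: "0 < c" and q: "norm q \<le> 1 / \<epsilon>"
    and cq: "\<And>h. norm h < \<epsilon> \<Longrightarrow> 1 / den zs (x0 + h) ^ DIM('a) = c * mobius_kernel q h"
  shows "ennreal (c / 4 ^ DIM('a)) * emeasure lborel (ball x0 \<delta>) \<le> emeasure lborel (br zs ` ball x0 \<delta>)"
proof -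
  have "ennreal (c / 4 ^ DIM('a)) * emeasure lborel (ball x0 \<delta>)
      = (\<integral>\<^sup>+x. ennreal (c / 4 ^ DIM('a)) * indicator (ball x0 \<delta>) x \<partial>lborel)"
    by (simp add: nn_integral_cmult_indicator)
  also have "\<dots> \<le> (\<integral>\<^sup>+x. ennreal (1 / den zs x ^ DIM('a)) * indicator (ball x0 \<delta>) x \<partial>lborel)"
  proof (rule nn_integral_mono)
    fix x
    have "c / 4 ^ DIM('a) \<le> 1 / den zs x ^ DIM('a)" if "x \<in> ball x0 \<delta>"
    proof -
      have h: "norm (x - x0) < \<epsilon>" using that \<delta> by (simp add: dist_norm norm_minus_commute)
      have "c * (1 / 4 ^ DIM('a)) \<le> c * mobius_kernel q (x - x0)"
        using mobius_kernel_lower[OF q h] c by (intro mult_left_mono) auto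
      then show ?thesis using cq[OF h] by simp
    qed
    then show "ennreal (c / 4 ^ DIM('a)) * indicator (ball x0 \<delta>) x
        \<le> ennreal (1 / den zs x ^ DIM('a)) * indicator (ball x0 \<delta>) x"
      by (auto split: split_indicator intro!: ennreal_leI)
  qed
  also have "\<dots> = emeasure lborel (br zs ` ball x0 \<delta>)" by (rule leb_br[symmetric]) simp
  finally show ?thesis .
qed

lemma leb_br_finite:
  assumes zs: "zs \<in> V n" and A: "A \<in> sets borel" "A \<subseteq> ball x0 \<epsilon>"
  shows "emeasure lborel (br zs ` A) < \<infinity>"
proof -
  have "emeasure lborel (br zs ` A) \<le> emeasure lborel D"
    using br_image_E[OF zs A(2)] E_subset_D closed_D by (intro emeasure_mono) auto
  also have "\<dots> < \<infinity>" using emeasure_compact_finite[OF compact_D] .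
  finally show ?thesis .
qed

lemma leb_br_pos:
  assumes zs: "zs \<in> V n" and \<delta>: "0 < \<delta>" "\<delta> \<le> \<epsilon>"
  shows "emeasure lborel (br zs ` ball x0 \<delta>) \<noteq> 0"
proof -
  obtain c q where cq: "0 < c" "norm q \<le> 1 / \<epsilon>"
    "\<And>h. norm h < \<epsilon> \<Longrightarrow> 1 / den zs (x0 + h) ^ DIM('a) = c * mobius_kernel q h"
    using kernel_data zs by metis
  have "0 < ennreal (c / 4 ^ DIM('a)) * emeasure lborel (ball x0 \<delta>)"
    using cq \<delta> by (simp add: emeasure_ball ennreal_zero_less_mult_iff)
  also have "\<dots> \<le> emeasure lborel (br zs ` ball x0 \<delta>)" by (rule leb_br_lower[OF zs \<delta>(2) cq])
  finally show ?thesis by simp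
qed

end

section \<open>Comparison of the measure with averaged Jacobians\<close>

context cf_measure
begin

lemma mu_has_density:
  obtains f :: "'a \<Rightarrow> real" where "f \<in> borel_measurable lebesgue" "\<And>x. 0 \<le> f x"
    "\<mu> = density lebesgue (\<lambda>x. ennreal (f x))" "(\<integral>\<^sup>+x. f x \<partial>lebesgue) < \<infinity>"
proof -
  interpret leb: sigma_finite_measure "lebesgue :: 'a measure" by (rule sigma_finite_lebesgue)
  have "absolutely_continuous lebesgue \<mu>"
    unfolding absolutely_continuous_def
  proof
    fix A :: "'a set" assume A: "A \<in> null_sets lebesgue"
    have "negligible (A \<inter> D)" using A by (intro negligible_Int) (simp add: negligible_iff_null_sets)
    then have "emeasure lebesgue (A \<inter> D) = 0" by (simp add: negligible_iff_null_sets null_sets_def)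
    then show "A \<in> null_sets \<mu>" using A equiv by (auto simp: null_sets_def sets_mu)
  qed
  then obtain F where F: "F \<in> borel_measurable lebesgue" "density lebesgue F = \<mu>"
    using leb.Radon_Nikodym sets_mu by blast
  have "(\<integral>\<^sup>+x. F x \<partial>lebesgue) = emeasure \<mu> (space \<mu>)"
    using F by (simp add: F(2)[symmetric] emeasure_density space_mu cong: nn_integral_cong)
  then have int: "(\<integral>\<^sup>+x. F x \<partial>lebesgue) = 1" by (simp add: emeasure_space_1)
  then have fin: "AE x in lebesgue. F x \<noteq> \<infinity>" using F by (intro nn_integral_PInf_AE) auto
  define f where "f = (\<lambda>x. enn2real (F x))"
  have ae: "AE x in lebesgue. F x = ennreal (f x)"
    using fin by eventually_elim (simp add: f_def less_top)
  show ?thesis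
  proof (rule that[of f])
    show fm: "f \<in> borel_measurable lebesgue" using F unfolding f_def by measurable
    show "0 \<le> f x" for x by (simp add: f_def)
    show "\<mu> = density lebesgue (\<lambda>x. ennreal (f x))"
      unfolding F(2)[symmetric] using F fm ae by (intro density_cong) auto
    have "(\<integral>\<^sup>+x. f x \<partial>lebesgue) = (\<integral>\<^sup>+x. F x \<partial>lebesgue)" using ae by (intro nn_integral_cong_AE) auto
    then show "(\<integral>\<^sup>+x. f x \<partial>lebesgue) < \<infinity>" using int by simp
  qed
qed

end

context cf_point
begin

text \<open>At depth n the images of the ball have size of order r^(2 n), so a continuous
  approximation of the density is nearly constant on each. The L1 error need not be small relative
  to each image, but its sum is small since the images are disjoint subsets of \<open>D\<close>.
  Charging errors to the images of the whole ball makes the threshold for n independent of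
  \<open>A\<close>.\<close>

lemma mu_estimate:
  assumes \<delta>: "0 < \<delta>" "\<delta> \<le> \<epsilon>" and e: "0 < e"
  shows "\<forall>\<^sub>F n in sequentially. \<forall>A\<in>sets borel. A \<subseteq> ball x0 \<delta> \<longrightarrow>
    emeasure \<mu> A \<le> (\<integral>\<^sup>+zs. emeasure \<mu> (br zs ` ball x0 \<delta>) / emeasure lborel (br zs ` ball x0 \<delta>)
                       * emeasure lborel (br zs ` A) \<partial>count_space (V n)) + ennreal e"
proof -
  obtain f where f [measurable]: "f \<in> borel_measurable lebesgue" and f0: "\<And>x. 0 \<le> f x"
    and \<mu>: "\<mu> = density lebesgue (\<lambda>x. ennreal (f x))" and fi: "(\<integral>\<^sup>+x. f x \<partial>lebesgue) < \<infinity>"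
    using mu_has_density by blast
  obtain r where r: "0 < r" "r < 1" "\<And>x. x \<in> D \<Longrightarrow> norm x \<le> r" using D_radius by blast
  let ?B = "ball x0 \<delta>"
  have B: "?B \<subseteq> ball x0 \<epsilon>" using \<delta> by auto
  have Dm: "D \<in> sets borel" using closed_D by auto
  define m where "m = measure lborel D"
  have m: "emeasure lborel D = ennreal m" "0 \<le> m"
    using emeasure_compact_finite[OF compact_D] by (auto simp: m_def emeasure_eq_ennreal_measure)
  \<comment> \<open>The summed error is at most e' from the L1 distance plus e' m from the
    oscillation over a set of volume at most m; \<open>ennreal_ratio_bound\<close> doubles it, which
    gives \<open>e\<close>.\<close>
  define e' where "e' = e / (2 * (1 + m))"
  have "e' * (2 * (1 + m)) = e" using m by (simp add: e'_def)
  then have e'2: "2 * (e' + e' * m) = e" by (simp add: algebra_simps)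
  have "0 < e'" using e m by (simp add: e'_def)
  note e' = this e'2
  obtain g where g: "continuous_on UNIV g" "\<And>x. 0 \<le> g x"
    and fg: "(\<integral>\<^sup>+x. ennreal \<bar>f x - g x\<bar> * indicator D x \<partial>lebesgue) < ennreal e'"
    using L1_approx_continuous[OF f f0 fi compact_D e'(1)] by blast
  have gm [measurable]: "g \<in> borel_measurable lebesgue"
    using g(1) by (intro measurable_completion) (auto intro: borel_measurable_continuous_onI)
  define \<nu> where "\<nu> = density lebesgue (\<lambda>x. ennreal \<bar>f x - g x\<bar>)"
  have \<nu>: "emeasure \<nu> S = (\<integral>\<^sup>+x. ennreal \<bar>f x - g x\<bar> * indicator S x \<partial>lebesgue)" if "S \<in> sets borel" for S
    unfolding \<nu>_def using that by (subst emeasure_density) auto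
  have \<mu>S: "emeasure \<mu> S = (\<integral>\<^sup>+x. ennreal (f x) * indicator S x \<partial>lebesgue)" if "S \<in> sets borel" for S
    unfolding \<mu> using that by (subst emeasure_density) auto
  have leb: "(\<integral>\<^sup>+x. ennreal c * indicator S x \<partial>lebesgue) = ennreal c * emeasure lborel S"
    if "S \<in> sets borel" for c S using that by (subst nn_integral_cmult_indicator) auto
  have "uniformly_continuous_on D g"
    using continuous_on_subset[OF g(1)] compact_D by (intro compact_uniformly_continuous) auto
  then obtain d where d: "0 < d" "\<And>x y. x \<in> D \<Longrightarrow> y \<in> D \<Longrightarrow> dist y x < d \<Longrightarrow> dist (g y) (g x) < e'"
    unfolding uniformly_continuous_on_def using e'(1) by metis
  have "(\<lambda>n. (r\<^sup>2) ^ n * \<delta>) \<longlonglongrightarrow> 0 * \<delta>"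
    using r by (intro tendsto_intros LIMSEQ_power_zero) (simp add: abs_square_less_1)
  then have "\<forall>\<^sub>F n in sequentially. (r\<^sup>2) ^ n * \<delta> < d" using d by (intro order_tendstoD(2)) auto
  then show ?thesis
  proof eventually_elim
    case (elim n)
    show ?case
    proof (intro ballI impI)
      fix A :: "'a set" assume A: "A \<in> sets borel" "A \<subseteq> ?B"
      define \<eta> where "\<eta> = (\<lambda>zs. emeasure \<nu> (br zs ` ?B) + ennreal e' * emeasure lborel (br zs ` ?B))"
      have step: "emeasure \<mu> (br zs ` A) \<le> emeasure \<mu> (br zs ` ?B) / emeasure lborel (br zs ` ?B)
                       * emeasure lborel (br zs ` A) + 2 * \<eta> zs" if zs: "zs \<in> V n" for zs
      proof (rule ennreal_ratio_bound[where c = "ennreal (g (br zs x0))"])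
        let ?S = "br zs ` A" and ?S' = "br zs ` ?B" and ?c = "g (br zs x0)"
        have S: "?S \<in> sets borel" "?S' \<in> sets borel" using br_image_borel A by auto
        have SS: "?S \<subseteq> ?S'" using A by auto
        have SD: "?S' \<subseteq> D" using br_image_E[OF zs B] E_subset_D by blast
        have osc: "\<bar>g y - ?c\<bar> \<le> e'" if y: "y \<in> ?S'" for y
        proof -
          obtain x where x: "x \<in> ?B" "y = br zs x" using y by blast
          have x0: "x0 \<in> ball x0 \<epsilon>" "x0 \<in> ?B" using \<epsilon> \<delta> by auto
          have "norm (br zs x - br zs x0) \<le> (r\<^sup>2) ^ length zs * norm (x - x0)"
            using V_valid[OF zs] x(1) x0 B r by (intro br_contraction) auto
          also have "\<dots> \<le> (r\<^sup>2) ^ n * \<delta>"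
            using x(1) zs by (intro mult_mono) (auto simp: dist_norm norm_minus_commute V_def)
          finally have "dist y (br zs x0) < d" using elim x(2) by (simp add: dist_norm)
          moreover have "br zs x0 \<in> D" "y \<in> D" using SD y x0 by blast+
          ultimately have "dist (g y) ?c < e'" by (intro d(2))
          then show ?thesis by (simp add: dist_real_def)
        qed
        have sum3: "(\<integral>\<^sup>+x. ennreal (u x) * indicator S x + (ennreal \<bar>f x - g x\<bar> * indicator ?S' x + ennreal e' * indicator ?S' x) \<partial>lebesgue)
            = (\<integral>\<^sup>+x. ennreal (u x) * indicator S x \<partial>lebesgue) + \<eta> zs"
          if "S \<in> sets borel" "u \<in> borel_measurable lebesgue" for S u
        proof -
          have [measurable]: "S \<in> sets lebesgue" "?S' \<in> sets lebesgue" "u \<in> borel_measurable lebesgue"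
            using that S(2) by auto
          show ?thesis
            unfolding \<eta>_def \<nu>[OF S(2)] leb[OF S(2), symmetric] by (subst nn_integral_add; simp add: nn_integral_add)
        qed
        have "emeasure \<mu> ?S \<le> (\<integral>\<^sup>+x. ennreal ?c * indicator ?S x + (ennreal \<bar>f x - g x\<bar> * indicator ?S' x + ennreal e' * indicator ?S' x) \<partial>lebesgue)"
          unfolding \<mu>S[OF S(1)]
        proof (rule nn_integral_mono)
          fix y
          show "ennreal (f y) * indicator ?S y \<le> ennreal ?c * indicator ?S y + (ennreal \<bar>f y - g y\<bar> * indicator ?S' y + ennreal e' * indicator ?S' y)"
          proof (cases "y \<in> ?S")
            case True
            then have "y \<in> ?S'" using SS by blast
            have "f y \<le> ?c + (\<bar>f y - g y\<bar> + e')" using osc[OF \<open>y \<in> ?S'\<close>] by linarith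
            then have "ennreal (f y) \<le> ennreal ?c + (ennreal \<bar>f y - g y\<bar> + ennreal e')"
              using g(2) e'(1) by (simp flip: ennreal_plus add: ennreal_leI)
            then show ?thesis using True \<open>y \<in> ?S'\<close> by simp
          qed simp
        qed
        also have "\<dots> = ennreal ?c * emeasure lborel ?S + \<eta> zs"
          using sum3[OF S(1), of "\<lambda>_. ?c"] leb[OF S(1)] by simp
        finally show "emeasure \<mu> ?S \<le> ennreal ?c * emeasure lborel ?S + \<eta> zs" .
        have "ennreal ?c * emeasure lborel ?S' = (\<integral>\<^sup>+x. ennreal ?c * indicator ?S' x \<partial>lebesgue)"
          using leb[OF S(2)] by simp
        also have "\<dots> \<le> (\<integral>\<^sup>+x. ennreal (f x) * indicator ?S' x + (ennreal \<bar>f x - g x\<bar> * indicator ?S' x + ennreal e' * indicator ?S' x) \<partial>lebesgue)"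
        proof (rule nn_integral_mono)
          fix y
          show "ennreal ?c * indicator ?S' y \<le> ennreal (f y) * indicator ?S' y + (ennreal \<bar>f y - g y\<bar> * indicator ?S' y + ennreal e' * indicator ?S' y)"
          proof (cases "y \<in> ?S'")
            case True
            have "?c \<le> f y + (\<bar>f y - g y\<bar> + e')" using osc[OF True] by linarith
            then have "ennreal ?c \<le> ennreal (f y) + (ennreal \<bar>f y - g y\<bar> + ennreal e')"
              using f0 e'(1) by (simp flip: ennreal_plus add: ennreal_leI)
            then show ?thesis using True by simp
          qed simp
        qed
        also have "\<dots> = emeasure \<mu> ?S' + \<eta> zs" using sum3[OF S(2) f] \<mu>S[OF S(2)] by simp
        finally show "ennreal ?c * emeasure lborel ?S' \<le> emeasure \<mu> ?S' + \<eta> zs" .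
        show "emeasure lborel ?S \<le> emeasure lborel ?S'" using SS S by (intro emeasure_mono) auto
        show "emeasure lborel ?S' \<noteq> 0" by (rule leb_br_pos[OF zs \<delta>])
        show "emeasure lborel ?S' \<noteq> \<infinity>" using leb_br_finite[OF zs _ B] by simp
      qed
      let ?U = "\<Union>zs\<in>V n. br zs ` ?B"
      have U: "?U \<in> sets borel" by (rule UN_br_borel) simp
      have UD: "?U \<subseteq> D" using br_image_E[OF _ B] E_subset_D by blast
      have "(\<integral>\<^sup>+zs. \<eta> zs \<partial>count_space (V n)) = (\<integral>\<^sup>+zs. emeasure \<nu> (br zs ` ?B) \<partial>count_space (V n))
          + ennreal e' * (\<integral>\<^sup>+zs. emeasure lborel (br zs ` ?B) \<partial>count_space (V n))"
        unfolding \<eta>_def by (simp add: nn_integral_add nn_integral_cmult)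
      also have "(\<integral>\<^sup>+zs. emeasure \<nu> (br zs ` ?B) \<partial>count_space (V n)) = emeasure \<nu> ?U"
        using br_image_borel[of ?B] countable_V disjoint_br[OF B]
        by (intro emeasure_UN_countable[symmetric]) (auto simp: \<nu>_def)
      also have "(\<integral>\<^sup>+zs. emeasure lborel (br zs ` ?B) \<partial>count_space (V n)) = emeasure lborel ?U"
        using br_image_borel[of ?B] countable_V disjoint_br[OF B]
        by (intro emeasure_UN_countable[symmetric]) auto
      also have "emeasure \<nu> ?U + ennreal e' * emeasure lborel ?U \<le> emeasure \<nu> D + ennreal e' * emeasure lborel D"
        using UD Dm by (intro add_mono mult_left_mono emeasure_mono) (auto simp: \<nu>_def)
      also have "\<dots> \<le> ennreal e' + ennreal e' * ennreal m"
        using fg \<nu>[OF Dm] m by (intro add_mono) auto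
      also have "\<dots> = ennreal (e' + e' * m)" using e' m by (simp add: ennreal_mult)
      finally have \<eta>: "(\<integral>\<^sup>+zs. \<eta> zs \<partial>count_space (V n)) \<le> ennreal (e' + e' * m)" .
      have "emeasure \<mu> A = (\<integral>\<^sup>+zs. emeasure \<mu> (br zs ` A) \<partial>count_space (V n))"
        using A B by (intro mu_eq_sum) auto
      also have "\<dots> \<le> (\<integral>\<^sup>+zs. emeasure \<mu> (br zs ` ?B) / emeasure lborel (br zs ` ?B)
                       * emeasure lborel (br zs ` A) + 2 * \<eta> zs \<partial>count_space (V n))"
        using step by (intro nn_integral_mono) auto
      also have "\<dots> = (\<integral>\<^sup>+zs. emeasure \<mu> (br zs ` ?B) / emeasure lborel (br zs ` ?B)
                       * emeasure lborel (br zs ` A) \<partial>count_space (V n)) + 2 * (\<integral>\<^sup>+zs. \<eta> zs \<partial>count_space (V n))"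
        by (simp add: nn_integral_add nn_integral_cmult)
      also have "2 * (\<integral>\<^sup>+zs. \<eta> zs \<partial>count_space (V n)) \<le> 2 * ennreal (e' + e' * m)"
        by (intro mult_left_mono \<eta>) auto
      also have "2 * ennreal (e' + e' * m) = ennreal e"
        using e' m by (simp flip: e'(2) add: ennreal_mult)
      finally show "emeasure \<mu> A \<le> (\<integral>\<^sup>+zs. emeasure \<mu> (br zs ` ?B) / emeasure lborel (br zs ` ?B)
                       * emeasure lborel (br zs ` A) \<partial>count_space (V n)) + ennreal e"
        by (simp add: add_left_mono)
    qed
  qed
qed

text \<open>The weight \<omega> is the mass of the image of the ball divided by its volume. With
  these weights every averaged density has exactly the mass of \<open>\<mu>\<close> on the ball, and
  the bounded limit along the subsequence inherits this.\<close>

lemma local_density: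
  obtains \<delta> H c where "0 < \<delta>" "continuous_on (ball 0 \<delta>) H" "\<And>h. norm h < \<delta> \<Longrightarrow> 0 \<le> H h"
    "\<And>h. norm h < \<delta> \<Longrightarrow> ((\<lambda>\<alpha>. c \<alpha> * (\<Prod>i\<in>Basis. (h \<bullet> i) ^ \<alpha> i)) has_sum H h) multi_indices"
    "\<And>A. A \<in> sets borel \<Longrightarrow> A \<subseteq> ball x0 \<delta> \<Longrightarrow>
       emeasure \<mu> A = (\<integral>\<^sup>+x. ennreal (H (x - x0)) * indicator A x \<partial>lborel)"
proof (rule mobius_kernel_averages_compact[where 's = "'a list" and 'a = 'a, of "1 / \<epsilon>"])
  show "1 / \<epsilon> > 0" using \<epsilon> by simp
next
  fix \<rho> Bd :: real
  assume \<rho>: "\<rho> > 0" and Bd: "Bd \<ge> 0"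
    and compactness: "\<And>(V :: nat \<Rightarrow> 'a list set) w (q :: nat \<Rightarrow> 'a list \<Rightarrow> 'a) W.
       (\<And>n s. s \<in> V n \<Longrightarrow> 0 \<le> w n s \<and> norm (q n s) \<le> 1 / \<epsilon>) \<Longrightarrow>
       (\<And>n. w n summable_on V n) \<Longrightarrow> (\<And>n. infsum (w n) (V n) \<le> W) \<Longrightarrow>
       (\<forall>n h. norm h \<le> \<rho> \<longrightarrow> (\<lambda>s. w n s * mobius_kernel (q n s) h) summable_on V n \<and>
          \<bar>\<Sum>\<^sub>\<infinity>s\<in>V n. w n s * mobius_kernel (q n s) h\<bar> \<le> W * Bd) \<and>
       (\<exists>k H c. strict_mono k \<and> continuous_on (cball 0 \<rho>) H \<and>
         (\<forall>h. norm h \<le> \<rho> \<longrightarrow>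
            (\<lambda>n. \<Sum>\<^sub>\<infinity>s\<in>V (k n). w (k n) s * mobius_kernel (q (k n) s) h) \<longlonglongrightarrow> H h \<and>
            ((\<lambda>\<alpha>. c \<alpha> * (\<Prod>i\<in>Basis. (h \<bullet> i) ^ \<alpha> i)) has_sum H h) multi_indices))"
  let ?d = "DIM('a)"
  define \<delta> where "\<delta> = min \<rho> \<epsilon>"
  have \<delta>: "0 < \<delta>" "\<delta> \<le> \<rho>" "\<delta> \<le> \<epsilon>" using \<rho> \<epsilon> by (auto simp: \<delta>_def)
  let ?B = "ball x0 \<delta>"
  have B: "?B \<subseteq> ball x0 \<epsilon>" using \<delta> by auto
  have Bm [measurable]: "?B \<in> sets borel" by simp
  obtain c q where c: "\<And>zs n. zs \<in> V n \<Longrightarrow> 0 < c zs" and q: "\<And>zs n. zs \<in> V n \<Longrightarrow> norm (q zs) \<le> 1 / \<epsilon>"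
    and cq: "\<And>zs n h. zs \<in> V n \<Longrightarrow> norm h < \<epsilon> \<Longrightarrow> 1 / den zs (x0 + h) ^ ?d = c zs * mobius_kernel (q zs) h"
    using kernel_data by metis
  define b where "b = measure lborel ?B"
  have eb: "emeasure lborel ?B = ennreal b" and b: "0 < b"
    using \<delta> content_ball_pos[of \<delta> x0] by (auto simp: b_def emeasure_eq_ennreal_measure emeasure_ball)
  define \<beta> where "\<beta> = (\<lambda>zs. measure \<mu> (br zs ` ?B))"
  define \<sigma> where "\<sigma> = (\<lambda>zs. measure lborel (br zs ` ?B))"
  define \<omega> where "\<omega> = (\<lambda>zs. \<beta> zs / \<sigma> zs)"
  have \<sigma>e: "emeasure lborel (br zs ` ?B) = ennreal (\<sigma> zs)" if "zs \<in> V n" for zs n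
    unfolding \<sigma>_def using leb_br_finite[OF that _ B] by (intro emeasure_eq_ennreal_measure) auto
  have \<beta>e: "emeasure \<mu> (br zs ` ?B) = ennreal (\<beta> zs)" for zs
    unfolding \<beta>_def by (rule emeasure_eq_measure)
  have \<sigma>b: "c zs / 4 ^ ?d * b \<le> \<sigma> zs" if "zs \<in> V n" for zs n
  proof -
    have "ennreal (c zs / 4 ^ ?d) * emeasure lborel ?B \<le> ennreal (\<sigma> zs)"
      using leb_br_lower[OF that \<delta>(3) c[OF that] q[OF that] cq[OF that]] \<sigma>e[OF that] by simp
    then have "ennreal (c zs / 4 ^ ?d * b) \<le> ennreal (\<sigma> zs)"
      using c[OF that] b unfolding eb by (subst ennreal_mult) auto
    then show ?thesis by (simp add: \<sigma>_def)
  qed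
  have \<sigma>0: "0 < \<sigma> zs" if "zs \<in> V n" for zs n
    using \<sigma>b[OF that] c[OF that] b by (smt (verit) divide_pos_pos mult_pos_pos zero_less_power)
  have \<omega>0: "0 \<le> \<omega> zs" for zs by (simp add: \<omega>_def \<beta>_def \<sigma>_def)
  have \<omega>e: "emeasure \<mu> (br zs ` ?B) / emeasure lborel (br zs ` ?B) = ennreal (\<omega> zs)" if "zs \<in> V n" for zs n
    unfolding \<sigma>e[OF that] \<beta>e \<omega>_def using \<sigma>0[OF that] by (intro divide_ennreal) (auto simp: \<beta>_def)
  have finsum: "sum \<beta> F \<le> 1" if "finite F" "F \<subseteq> V n" for F n
  proof -
    have "disjoint_family_on (\<lambda>zs. br zs ` ?B) F"
      using disjoint_family_on_mono[OF that(2) disjoint_br[OF B]] .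
    then have "sum \<beta> F = measure \<mu> (\<Union>zs\<in>F. br zs ` ?B)"
      unfolding \<beta>_def using that br_image_borel[of ?B]
      by (intro finite_measure_finite_Union[symmetric]) (auto simp: sets_mu)
    then show ?thesis by (simp add: prob_le_1)
  qed
  have \<beta>0: "0 \<le> \<beta> zs" for zs by (simp add: \<beta>_def)
  have \<beta>s: "\<beta> summable_on V n" for n
    using finsum[of _ n] \<beta>0 by (intro nonneg_bdd_above_summable_on) (auto simp: bdd_above_def)
  have \<beta>1: "infsum \<beta> (V n) \<le> 1" for n
    using finsum[of _ n] \<beta>s by (intro infsum_le_finite_sums) auto
  \<comment> \<open>By \<open>\<sigma>b\<close> the factor c is at most \<open>\<kappa>\<close>
    times the volume \<sigma>, so w = (\<beta> / \<sigma>) c is at most \<kappa> \<beta>. The images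
    are disjoint, so their masses \<beta> add up to at most 1 and the total weight is at most
    \<kappa>.\<close>
  define \<kappa> where "\<kappa> = 4 ^ ?d / b"
  have \<kappa>: "\<kappa> > 0" using b by (simp add: \<kappa>_def)
  define w where "w = (\<lambda>zs. \<omega> zs * c zs)"
  have w\<beta>: "w zs \<le> \<kappa> * \<beta> zs" if "zs \<in> V n" for zs n
  proof -
    have "c zs * b \<le> \<sigma> zs * 4 ^ ?d" using \<sigma>b[OF that] by (simp add: field_simps)
    then have "c zs / \<sigma> zs \<le> \<kappa>" using \<sigma>0[OF that] b by (simp add: \<kappa>_def field_simps)
    then have "\<beta> zs * (c zs / \<sigma> zs) \<le> \<beta> zs * \<kappa>" using \<beta>0 by (rule mult_left_mono)
    then show ?thesis by (simp add: w_def \<omega>_def mult.commute)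
  qed
  have w0: "0 \<le> w zs" if "zs \<in> V n" for zs n using \<omega>0 c[OF that] by (simp add: w_def)
  have ws: "w summable_on V n" for n
    using w\<beta> w0 by (rule summable_on_comparison_test[OF summable_on_cmult_right[OF \<beta>s, of \<kappa>]])
  have w1: "infsum w (V n) \<le> \<kappa>" for n
  proof -
    have "infsum w (V n) \<le> infsum (\<lambda>zs. \<kappa> * \<beta> zs) (V n)"
      using w\<beta> by (intro infsum_mono ws summable_on_cmult_right \<beta>s)
    also have "\<dots> = \<kappa> * infsum \<beta> (V n)" by (simp add: infsum_cmult_right')
    also have "\<dots> \<le> \<kappa> * 1" using \<kappa> \<beta>1 by (intro mult_left_mono) auto
    finally show ?thesis by simp
  qed
  define Hn where "Hn = (\<lambda>n h. \<Sum>\<^sub>\<infinity>zs\<in>V n. w zs * mobius_kernel (q zs) h)"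
  from compactness[of V "\<lambda>_. w" "\<lambda>_. q" \<kappa>] w0 q ws w1
  have "(\<forall>n h. norm h \<le> \<rho> \<longrightarrow> (\<lambda>zs. w zs * mobius_kernel (q zs) h) summable_on V n \<and> \<bar>Hn n h\<bar> \<le> \<kappa> * Bd) \<and>
       (\<exists>k H c. strict_mono k \<and> continuous_on (cball 0 \<rho>) H \<and>
         (\<forall>h. norm h \<le> \<rho> \<longrightarrow> (\<lambda>n. Hn (k n) h) \<longlonglongrightarrow> H h \<and>
            ((\<lambda>\<alpha>. c \<alpha> * (\<Prod>i\<in>Basis. (h \<bullet> i) ^ \<alpha> i)) has_sum H h) multi_indices))"
    unfolding Hn_def by blast
  then obtain k H cc where ks: "\<And>n h. norm h \<le> \<rho> \<Longrightarrow> (\<lambda>zs. w zs * mobius_kernel (q zs) h) summable_on V n"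
    and Hbd: "\<And>n h. norm h \<le> \<rho> \<Longrightarrow> \<bar>Hn n h\<bar> \<le> \<kappa> * Bd"
    and k: "strict_mono (k :: nat \<Rightarrow> nat)" and Hc: "continuous_on (cball 0 \<rho>) H"
    and lim: "\<And>h. norm h \<le> \<rho> \<Longrightarrow> (\<lambda>n. Hn (k n) h) \<longlonglongrightarrow> H h"
    and ser: "\<And>h. norm h \<le> \<rho> \<Longrightarrow> ((\<lambda>\<alpha>. cc \<alpha> * (\<Prod>i\<in>Basis. (h \<bullet> i) ^ \<alpha> i)) has_sum H h) multi_indices"
    by blast
  have in_B: "norm (x - x0) < \<delta>" if "x \<in> ?B" for x using that by (simp add: dist_norm norm_minus_commute)
  have wk: "w zs * mobius_kernel (q zs) (x - x0) = \<omega> zs * (1 / den zs x ^ ?d)" if "zs \<in> V n" "x \<in> ?B" for zs n x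
    using cq[OF that(1), of "x - x0"] in_B[OF that(2)] \<delta> by (simp add: w_def)
  have Hn_eq: "(\<integral>\<^sup>+zs. ennreal (\<omega> zs) * ennreal (1 / den zs x ^ ?d) \<partial>count_space (V n)) = ennreal (Hn n (x - x0))"
    if x: "x \<in> ?B" for x n
  proof -
    have "(\<integral>\<^sup>+zs. ennreal (\<omega> zs) * ennreal (1 / den zs x ^ ?d) \<partial>count_space (V n))
        = (\<integral>\<^sup>+zs. ennreal (w zs * mobius_kernel (q zs) (x - x0)) \<partial>count_space (V n))"
      using wk[OF _ x] \<omega>0 den_nonneg by (intro nn_integral_cong) (simp add: ennreal_mult[symmetric])
    also have "\<dots> = ennreal (Hn n (x - x0))"
      unfolding Hn_def
    proof (rule nn_integral_count_space_infsum)
      show "(\<lambda>zs. w zs * mobius_kernel (q zs) (x - x0)) summable_on V n"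
        using in_B[OF x] \<delta> by (intro ks) auto
      show "0 \<le> w zs * mobius_kernel (q zs) (x - x0)" if "zs \<in> V n" for zs
        using wk[OF that x] \<omega>0[of zs] den_nonneg[of zs x] by simp
    qed
    finally show ?thesis .
  qed
  have Hn0: "0 \<le> Hn n h" if "norm h < \<delta>" for n h
    unfolding Hn_def
  proof (rule infsum_nonneg)
    fix zs assume "zs \<in> V n"
    then show "0 \<le> w zs * mobius_kernel (q zs) h"
      using wk[of zs n "x0 + h"] that \<omega>0[of zs] den_nonneg[of zs "x0 + h"] by (simp add: dist_norm)
  qed
  have H0: "0 \<le> H h" if "norm h < \<delta>" for h
    using that \<delta> Hn0 by (intro LIMSEQ_le_const[OF lim]) auto
  \<comment> \<open>The average kept as an \<open>ennreal\<close> integral over branches, so that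
    Tonelli applies directly; \<open>u_eq\<close> links it to the real series
    \<open>Hn\<close>.\<close>
  define u where "u = (\<lambda>A n x. \<integral>\<^sup>+zs. ennreal (\<omega> zs) * (ennreal (1 / den zs x ^ ?d) * indicator A x) \<partial>count_space (V n))"
  have um: "u A n \<in> borel_measurable lborel" if [measurable]: "A \<in> sets borel" for A n
    unfolding u_def using countable_V by (intro borel_measurable_nn_integral_count_space) measurable
  have u_eq: "u A n x = ennreal (Hn n (x - x0)) * indicator A x" if "A \<subseteq> ?B" for A n x
    using Hn_eq[of x n] that by (cases "x \<in> A") (auto simp: u_def)
  have int_u: "(\<integral>\<^sup>+x. u A n x \<partial>lborel)
      = (\<integral>\<^sup>+zs. emeasure \<mu> (br zs ` ?B) / emeasure lborel (br zs ` ?B) * emeasure lborel (br zs ` A) \<partial>count_space (V n))"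
    if A [measurable]: "A \<in> sets borel" for A n
  proof -
    have "(\<integral>\<^sup>+x. u A n x \<partial>lborel) = (\<integral>\<^sup>+zs. \<integral>\<^sup>+x. ennreal (\<omega> zs) * (ennreal (1 / den zs x ^ ?d) * indicator A x) \<partial>lborel \<partial>count_space (V n))"
      unfolding u_def using countable_V by (intro nn_integral_count_space_nn_integral) measurable
    also have "\<dots> = (\<integral>\<^sup>+zs. ennreal (\<omega> zs) * emeasure lborel (br zs ` A) \<partial>count_space (V n))"
      by (intro nn_integral_cong) (simp add: nn_integral_cmult leb_br[OF A])
    also have "\<dots> = (\<integral>\<^sup>+zs. emeasure \<mu> (br zs ` ?B) / emeasure lborel (br zs ` ?B) * emeasure lborel (br zs ` A) \<partial>count_space (V n))"
      by (intro nn_integral_cong) (simp add: \<omega>e)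
    finally show ?thesis .
  qed
  have int_uB: "(\<integral>\<^sup>+x. u ?B n x \<partial>lborel) = emeasure \<mu> ?B" for n
  proof -
    have "(\<integral>\<^sup>+x. u ?B n x \<partial>lborel) = (\<integral>\<^sup>+zs. emeasure \<mu> (br zs ` ?B) \<partial>count_space (V n))"
      unfolding int_u[of ?B n, simplified]
    proof (intro nn_integral_cong)
      fix zs assume "zs \<in> space (count_space (V n))"
      then have zs: "zs \<in> V n" by simp
      have "ennreal (\<omega> zs) * ennreal (\<sigma> zs) = ennreal (\<beta> zs)"
        using \<sigma>0[OF zs] \<beta>0[of zs] \<omega>0[of zs] by (simp add: \<omega>_def ennreal_mult[symmetric])
      then show "emeasure \<mu> (br zs ` ?B) / emeasure lborel (br zs ` ?B) * emeasure lborel (br zs ` ?B) = emeasure \<mu> (br zs ` ?B)"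
        unfolding \<omega>e[OF zs] by (simp add: \<sigma>e[OF zs] \<beta>e)
    qed
    also have "\<dots> = emeasure \<mu> ?B" using B by (intro mu_eq_sum[symmetric]) auto
    finally show ?thesis .
  qed
  define J where "J = (\<lambda>A. \<integral>\<^sup>+x. ennreal (H (x - x0)) * indicator A x \<partial>lborel)"
  have Hm: "(\<lambda>x. ennreal (H (x - x0)) * indicator A x) \<in> borel_measurable borel"
    if A: "A \<in> sets borel" "A \<subseteq> ?B" for A
  proof -
    have "continuous_on ?B (\<lambda>x. H (x - x0))"
      using in_B \<delta> by (intro continuous_on_compose2[OF Hc] continuous_intros) (force simp: dist_norm)+
    then have "(\<lambda>x. indicator ?B x *\<^sub>R H (x - x0)) \<in> borel_measurable borel"
      by (intro borel_measurable_continuous_on_indicator) auto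
    then have "(\<lambda>x. ennreal (indicator ?B x *\<^sub>R H (x - x0)) * indicator A x) \<in> borel_measurable borel"
      using A(1) by measurable
    moreover have "ennreal (indicator ?B x *\<^sub>R H (x - x0)) * indicator A x = ennreal (H (x - x0)) * indicator A x" for x
      using A(2) by (auto split: split_indicator)
    ultimately show ?thesis by simp
  qed
  have limJ: "(\<lambda>n. \<integral>\<^sup>+x. u A (k n) x \<partial>lborel) \<longlonglongrightarrow> J A" if A: "A \<in> sets borel" "A \<subseteq> ?B" for A
    unfolding J_def
  proof (rule nn_integral_dominated_convergence[where w = "\<lambda>x. ennreal (\<kappa> * Bd) * indicator ?B x"])
    show "u A (k n) \<in> borel_measurable lborel" for n by (rule um[OF A(1)])
    show "(\<lambda>x. ennreal (H (x - x0)) * indicator A x) \<in> borel_measurable lborel" using Hm[OF A] by simp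
    show "(\<integral>\<^sup>+x. ennreal (\<kappa> * Bd) * indicator ?B x \<partial>lborel) < \<infinity>"
      by (simp add: nn_integral_cmult_indicator eb ennreal_mult_less_top)
    show "AE x in lborel. u A (k n) x \<le> ennreal (\<kappa> * Bd) * indicator ?B x" for n
    proof (rule AE_I2)
      fix x
      show "u A (k n) x \<le> ennreal (\<kappa> * Bd) * indicator ?B x"
      proof (cases "x \<in> A")
        case True
        then have x: "x \<in> ?B" using A by blast
        have "Hn (k n) (x - x0) \<le> \<kappa> * Bd" using Hbd[of "x - x0" "k n"] in_B[OF x] \<delta> by simp
        then show ?thesis using True x by (simp add: u_eq[OF A(2)] ennreal_leI del: mem_ball)
      qed (simp add: u_eq[OF A(2)])
    qed
    show "AE x in lborel. (\<lambda>n. u A (k n) x) \<longlonglongrightarrow> ennreal (H (x - x0)) * indicator A x"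
    proof (rule AE_I2)
      fix x
      show "(\<lambda>n. u A (k n) x) \<longlonglongrightarrow> ennreal (H (x - x0)) * indicator A x"
      proof (cases "x \<in> A")
        case True
        then have x: "x \<in> ?B" using A by blast
        have "(\<lambda>n. Hn (k n) (x - x0)) \<longlonglongrightarrow> H (x - x0)" using in_B[OF x] \<delta> by (intro lim) simp
        then show ?thesis using True by (simp add: u_eq[OF A(2)] tendsto_ennrealI)
      qed (simp add: u_eq[OF A(2)])
    qed
    show "(\<lambda>x. ennreal (\<kappa> * Bd) * indicator ?B x) \<in> borel_measurable lborel" by measurable
  qed
  have JB: "J ?B = emeasure \<mu> ?B"
    using limJ[of ?B] by (simp add: int_uB LIMSEQ_const_iff)
  have le: "emeasure \<mu> A \<le> J A" if A: "A \<in> sets borel" "A \<subseteq> ?B" for A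
  proof (rule ennreal_le_epsilon)
    fix e :: real assume e: "0 < e"
    have "\<forall>\<^sub>F n in sequentially. emeasure \<mu> A \<le> (\<integral>\<^sup>+x. u A n x \<partial>lborel) + ennreal e"
      using mu_estimate[OF \<delta>(1) \<delta>(3) e] unfolding int_u[OF A(1)] by eventually_elim (use A in blast)
    then have ev: "\<forall>\<^sub>F n in sequentially. emeasure \<mu> A \<le> (\<integral>\<^sup>+x. u A (k n) x \<partial>lborel) + ennreal e"
      using filterlim_subseq[OF k] by (rule eventually_compose_filterlim)
    have "(\<lambda>n. (\<integral>\<^sup>+x. u A (k n) x \<partial>lborel) + ennreal e) \<longlonglongrightarrow> J A + ennreal e"
      by (intro tendsto_intros limJ A)
    then show "emeasure \<mu> A \<le> J A + ennreal e" using ev by (intro tendsto_lowerbound) auto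
  qed
  \<comment> \<open>The upper bounds for \<open>A\<close> and for its complement in the ball add up
    to an equality by \<open>JB\<close>, so each of them is an equality. Cancelling is legitimate
    because \<open>J (?B - A)\<close> is finite.\<close>
  have eq: "emeasure \<mu> A = J A" if A: "A \<in> sets borel" "A \<subseteq> ?B" for A
  proof (rule antisym[OF le[OF A]])
    have A': "?B - A \<in> sets borel" "?B - A \<subseteq> ?B" using A by auto
    have "J A + J (?B - A) = J ?B"
      unfolding J_def using Hm[OF A] Hm[OF A'] A(2)
      by (subst nn_integral_add[symmetric]) (auto intro!: nn_integral_cong split: split_indicator)
    also have "\<dots> = emeasure \<mu> A + emeasure \<mu> (?B - A)"
      unfolding JB using A A' by (subst plus_emeasure) (auto simp: sets_mu Un_absorb1)
    also have "\<dots> \<le> emeasure \<mu> A + J (?B - A)" by (intro add_left_mono le A')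
    finally have "J (?B - A) + J A \<le> J (?B - A) + emeasure \<mu> A" by (simp add: add.commute)
    moreover have "J (?B - A) \<noteq> \<infinity>"
    proof -
      have "J (?B - A) \<le> J ?B" unfolding J_def by (intro nn_integral_mono) (auto split: split_indicator)
      then show ?thesis unfolding JB using emeasure_finite[of ?B] by (metis infinity_ennreal_def top.extremum_unique)
    qed
    ultimately show "J A \<le> emeasure \<mu> A" by (simp add: ennreal_add_left_cancel_le)
  qed
  show ?thesis
  proof (rule that[of \<delta> H cc])
    show "continuous_on (ball 0 \<delta>) H" using \<delta> by (intro continuous_on_subset[OF Hc]) auto
  qed (use \<delta> H0 ser eq in \<open>auto simp: J_def\<close>)
qed

end

section \<open>Gluing the local densities\<close>

lemma continuous_representatives_agree:
  fixes g g' :: "'a::euclidean_space \<Rightarrow> real"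
  assumes "0 < d" "continuous_on (ball y d) g" "continuous_on (ball y d) g'"
    and "negligible {z \<in> ball y d. g z \<noteq> f z}" "negligible {z \<in> ball y d. g' z \<noteq> f z}"
  shows "g y = g' y"
proof (rule ccontr)
  assume "g y \<noteq> g' y"
  let ?W = "ball y d \<inter> (\<lambda>z. g z - g' z) -` (- {0})"
  have "open ?W" using assms by (intro continuous_open_preimage continuous_intros) auto
  moreover have "y \<in> ?W" using assms \<open>g y \<noteq> g' y\<close> by simp
  moreover have "negligible ?W"
    by (rule negligible_subset[OF negligible_Un[OF assms(4,5)]]) auto
  ultimately show False using open_not_negligible by blast
qed

text \<open>Two continuous local representatives of \<open>f\<close> agree wherever both are defined
  on a ball, so values can be chosen pointwise without fixing a cover. Where there is no
  representative, \<open>F\<close> keeps the value of \<open>f\<close>; hence every point of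
  disagreement has a ball on which the disagreement is negligible, and this local statement gives
  the global one.\<close>

lemma continuous_version:
  fixes f :: "'a::euclidean_space \<Rightarrow> real"
  assumes f0: "\<And>x. 0 \<le> f x"
  obtains F where "negligible {x. F x \<noteq> f x}" "\<And>x. 0 \<le> F x"
    "\<And>x g d. 0 < d \<and> continuous_on (ball x d) g \<and> (\<forall>y\<in>ball x d. 0 \<le> g y) \<and>
       negligible {y \<in> ball x d. g y \<noteq> f y} \<Longrightarrow> \<forall>y\<in>ball x d. F y = g y"
proof -
  define good where "good = (\<lambda>x g d. 0 < d \<and> continuous_on (ball x d) g \<and> (\<forall>y\<in>ball x d. 0 \<le> g y)
    \<and> negligible {y \<in> ball x d. g y \<noteq> f y})"
  have sub: "good y g e" if "good x g d" "ball y e \<subseteq> ball x d" "0 < e" for x y d e g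
    using that unfolding good_def
    by (auto intro: continuous_on_subset elim!: negligible_subset)
  have uniq: "g y = g' y" if g: "good y g d" and g': "good y g' d'" for y g g' d d'
  proof -
    let ?e = "min d d'"
    have "good y g ?e" by (rule sub[OF g]) (use g g' in \<open>auto simp: good_def\<close>)
    moreover have "good y g' ?e" by (rule sub[OF g']) (use g g' in \<open>auto simp: good_def\<close>)
    ultimately show ?thesis unfolding good_def by (intro continuous_representatives_agree[of ?e y g g' f]) auto
  qed
  define F where "F = (\<lambda>x. if \<exists>g d. good x g d then (SOME v. \<exists>g d. good x g d \<and> v = g x) else f x)"
  have Fg: "F x = g x" if g: "good x g d" for x g d
  proof -
    have "\<exists>g d. good x g d \<and> (SOME v. \<exists>g d. good x g d \<and> v = g x) = g x"
      using g by (intro someI_ex[of "\<lambda>v. \<exists>g d. good x g d \<and> v = g x"]) blast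
    then show ?thesis using g uniq unfolding F_def by auto
  qed
  have Fgood: "F y = g y" if g: "good x g d" and y: "y \<in> ball x d" for x g d y
  proof (rule Fg, rule sub[OF g])
    show "ball y (d - dist x y) \<subseteq> ball x d"
    proof
      fix z assume "z \<in> ball y (d - dist x y)"
      then show "z \<in> ball x d" using dist_triangle[of x z y] by simp
    qed
    show "0 < d - dist x y" using y by simp
  qed
  show ?thesis
  proof (rule that[of F])
    show "negligible {x. F x \<noteq> f x}"
      unfolding locally_negligible_alt[of "{x. F x \<noteq> f x}"]
    proof
      fix x assume x: "x \<in> {x. F x \<noteq> f x}"
      then obtain g d where g: "good x g d" unfolding F_def by (auto split: if_splits)
      have "{x. F x \<noteq> f x} \<inter> ball x d \<subseteq> {y \<in> ball x d. g y \<noteq> f y}" using Fgood[OF g] by auto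
      then have "negligible ({x. F x \<noteq> f x} \<inter> ball x d)"
        using g negligible_subset unfolding good_def by blast
      then show "\<exists>U. openin (top_of_set {x. F x \<noteq> f x}) U \<and> x \<in> U \<and> negligible U"
        using x g by (intro exI[of _ "{x. F x \<noteq> f x} \<inter> ball x d"]) (auto simp: good_def openin_open_Int)
    qed
    show "0 \<le> F x" for x
    proof (cases "\<exists>g d. good x g d")
      case True
      then obtain g d where g: "good x g d" by blast
      then show ?thesis using Fg[OF g] by (simp add: good_def)
    next
      case False
      then have "F x = f x" unfolding F_def by (rule if_not_P)
      then show ?thesis by (simp add: f0)
    qed
    show "\<forall>y\<in>ball x d. F y = g y" if "0 < d \<and> continuous_on (ball x d) g \<and> (\<forall>y\<in>ball x d. 0 \<le> g y) \<and>
       negligible {y \<in> ball x d. g y \<noteq> f y}" for x g d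
      using that Fgood[of x g d] unfolding good_def by blast
  qed
qed

context cf_measure
begin

lemma local_density_at:
  assumes x: "x \<in> K - (\<Union>n. (T ^^ n) ` frontier K)"
  obtains \<delta> H c where "0 < \<delta>" "continuous_on (ball 0 \<delta>) H" "\<And>h. norm h < \<delta> \<Longrightarrow> 0 \<le> H h"
    "\<And>h. norm h < \<delta> \<Longrightarrow> ((\<lambda>\<alpha>. c \<alpha> * (\<Prod>i\<in>Basis. (h \<bullet> i) ^ \<alpha> i)) has_sum H h) multi_indices"
    "\<And>A. A \<in> sets borel \<Longrightarrow> A \<subseteq> ball x \<delta> \<Longrightarrow>
       emeasure \<mu> A = (\<integral>\<^sup>+y. ennreal (H (y - x)) * indicator A y \<partial>lborel)"
proof -
  \<comment> \<open>The term n = 0 of the union removes the frontier of \<open>K\<close> itself, so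
    x lies in \<open>E\<close>.\<close>
  have "x \<notin> (T ^^ 0) ` frontier K" using x by blast
  then have "x \<in> E" using x K_subset_D D_diff_E_frontier by auto
  then obtain \<epsilon> where \<epsilon>: "\<epsilon> > 0" "ball x \<epsilon> \<subseteq> E"
    "\<And>g y. g \<in> signed_walls \<Longrightarrow> y \<in> ball x \<epsilon> \<Longrightarrow> g x \<noteq> 0 \<Longrightarrow> sgn (g y) = sgn (g x)"
    using sign_stable_ball by blast
  have "cf_point \<iota> Q Z K \<mu> x \<epsilon>"
    using x by (intro cf_point.intro cf_measure_axioms cf_point_axioms.intro \<epsilon>) auto
  then show ?thesis by (rule cf_point.local_density) (rule that)
qed

text \<open>Agreement is known on Borel subsets of the ball, whereas uniqueness of densities is
  applied to Lebesgue sets; each of these is a Borel set up to a null set. Finite mass makes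
  uniqueness available.\<close>

lemma density_eq_ae:
  fixes f :: "'a \<Rightarrow> real"
  assumes f: "f \<in> borel_measurable lebesgue" "\<And>x. 0 \<le> f x" "\<mu> = density lebesgue (\<lambda>x. ennreal (f x))"
    and \<delta>: "0 < \<delta>" and H: "continuous_on (ball x \<delta>) H" "\<And>y. y \<in> ball x \<delta> \<Longrightarrow> 0 \<le> H y"
    and eq: "\<And>A. A \<in> sets borel \<Longrightarrow> A \<subseteq> ball x \<delta> \<Longrightarrow>
       emeasure \<mu> A = (\<integral>\<^sup>+y. ennreal (H y) * indicator A y \<partial>lborel)"
  shows "negligible {y \<in> ball x \<delta>. H y \<noteq> f y}"
proof -
  let ?B = "ball x \<delta>"
  have Bm [measurable]: "?B \<in> sets lebesgue" "?B \<in> sets borel" by auto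
  note [measurable] = f(1)
  define f1 where "f1 = (\<lambda>y. ennreal (f y) * indicator ?B y)"
  define h1 where "h1 = (\<lambda>y. ennreal (indicator ?B y *\<^sub>R H y))"
  have h1_eq: "h1 y = ennreal (H y) * indicator ?B y" for y
    by (simp add: h1_def split: split_indicator)
  have "(\<lambda>y. indicator ?B y *\<^sub>R H y) \<in> borel_measurable borel"
    using H by (intro borel_measurable_continuous_on_indicator) auto
  then have h1b: "h1 \<in> borel_measurable borel" unfolding h1_def by measurable
  then have h1m [measurable]: "h1 \<in> borel_measurable lebesgue" by (intro measurable_completion) auto
  have f1m [measurable]: "f1 \<in> borel_measurable lebesgue" unfolding f1_def by measurable
  have dens: "density lebesgue f1 = density lebesgue h1"
  proof (rule measure_eqI)
    fix A assume "A \<in> sets (density lebesgue f1)"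
    then have A [measurable]: "A \<in> sets lebesgue" by simp
    then obtain S N N' where S: "A = S \<union> N" "N \<subseteq> N'" "N' \<in> null_sets lborel" "S \<in> sets lborel"
      by (rule sets_completionE)
    have SB: "S \<inter> ?B \<in> sets borel" "S \<inter> ?B \<subseteq> ?B" using S by auto
    have N': "N' \<in> null_sets lebesgue" using S(3) by (rule null_sets_completionI)
    have red: "(\<integral>\<^sup>+y. \<phi> y * indicator A y \<partial>lebesgue) = (\<integral>\<^sup>+y. \<phi> y * indicator S y \<partial>lebesgue)" for \<phi> :: "'a \<Rightarrow> ennreal"
    proof (rule nn_integral_cong_AE)
      from AE_not_in[OF N'] show "AE y in lebesgue. \<phi> y * indicator A y = \<phi> y * indicator S y"
      proof eventually_elim
        case (elim y)
        then have "y \<in> A \<longleftrightarrow> y \<in> S" using S(1,2) by blast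
        then show ?case by (simp split: split_indicator)
      qed
    qed
    have "emeasure (density lebesgue f1) A = (\<integral>\<^sup>+y. f1 y * indicator S y \<partial>lebesgue)"
      by (simp add: emeasure_density red)
    also have "\<dots> = (\<integral>\<^sup>+y. ennreal (f y) * indicator (S \<inter> ?B) y \<partial>lebesgue)"
      by (intro nn_integral_cong) (auto simp: f1_def split: split_indicator)
    also have "\<dots> = emeasure \<mu> (S \<inter> ?B)" using SB unfolding f(3) by (subst emeasure_density) auto
    also have "\<dots> = (\<integral>\<^sup>+y. ennreal (H y) * indicator (S \<inter> ?B) y \<partial>lborel)" by (rule eq[OF SB])
    also have "\<dots> = (\<integral>\<^sup>+y. h1 y * indicator S y \<partial>lborel)"
      by (intro nn_integral_cong) (auto simp: h1_eq split: split_indicator)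
    also have "\<dots> = (\<integral>\<^sup>+y. h1 y * indicator S y \<partial>lebesgue)" by (simp add: nn_integral_completion)
    also have "\<dots> = emeasure (density lebesgue h1) A" by (simp add: emeasure_density red)
    finally show "emeasure (density lebesgue f1) A = emeasure (density lebesgue h1) A" .
  qed simp
  have "(\<integral>\<^sup>+y. f1 y \<partial>lebesgue) = emeasure \<mu> ?B" unfolding f(3) f1_def by (subst emeasure_density) auto
  then have "(\<integral>\<^sup>+y. f1 y \<partial>lebesgue) \<noteq> \<infinity>" using emeasure_finite[of ?B] by simp
  then have "AE y in lebesgue. f1 y = h1 y"
    using finite_density_unique[OF f1m h1m] dens by simp
  then have "AE y in lebesgue. y \<notin> {y \<in> ?B. H y \<noteq> f y}"
  proof eventually_elim
    case (elim y)
    then show ?case using H(2)[of y] f(2)[of y] by (auto simp: f1_def h1_def)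
  qed
  then obtain N where N: "{y \<in> space lebesgue. \<not> y \<notin> {y \<in> ?B. H y \<noteq> f y}} \<subseteq> N"
    "emeasure lebesgue N = 0" "N \<in> sets lebesgue"
    by (rule AE_E)
  then have "negligible N" by (simp add: negligible_iff_null_sets null_sets_def)
  then show ?thesis by (rule negligible_subset) (use N(1) in auto)
qed

theorem analytic_density:
  "\<exists>f :: 'a \<Rightarrow> real. f \<in> borel_measurable lebesgue \<and> (\<forall>x. 0 \<le> f x)
     \<and> \<mu> = density lebesgue (\<lambda>x. ennreal (f x))
     \<and> (\<forall>C \<in> components (K - (\<Union>n. (T ^^ n) ` frontier K)). real_analytic_on f C)"
proof -
  obtain f :: "'a \<Rightarrow> real" where f: "f \<in> borel_measurable lebesgue" "\<And>x. 0 \<le> f x"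
    "\<mu> = density lebesgue (\<lambda>x. ennreal (f x))"
    using mu_has_density by blast
  obtain F where F: "negligible {x. F x \<noteq> f x}" "\<And>x. 0 \<le> F x"
    "\<And>x g d. 0 < d \<and> continuous_on (ball x d) g \<and> (\<forall>y\<in>ball x d. 0 \<le> g y) \<and>
       negligible {y \<in> ball x d. g y \<noteq> f y} \<Longrightarrow> \<forall>y\<in>ball x d. F y = g y"
    by (rule continuous_version[of f, OF f(2)]) (rule that)
  have "{x. F x \<noteq> f x} \<in> null_sets lebesgue" using F(1) by (simp add: negligible_iff_null_sets)
  then have ae: "AE x in lebesgue. f x = F x" by (rule AE_I') auto
  have Fm: "F \<in> borel_measurable lebesgue" using borel_measurable_AE[OF f(1) ae] .
  have dens: "\<mu> = density lebesgue (\<lambda>x. ennreal (F x))"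
    unfolding f(3) using f(1) Fm ae by (intro density_cong) auto
  have "real_analytic_on F C" if C: "C \<in> components (K - (\<Union>n. (T ^^ n) ` frontier K))" for C
    unfolding real_analytic_on_def
  proof
    fix x assume "x \<in> C"
    then have "x \<in> K - (\<Union>n. (T ^^ n) ` frontier K)" using in_components_subset[OF C] by blast
    then obtain \<delta> H c where \<delta>: "0 < \<delta>" and H: "continuous_on (ball 0 \<delta>) H" "\<And>h. norm h < \<delta> \<Longrightarrow> 0 \<le> H h"
      and ser: "\<And>h. norm h < \<delta> \<Longrightarrow> ((\<lambda>\<alpha>. c \<alpha> * (\<Prod>i\<in>Basis. (h \<bullet> i) ^ \<alpha> i)) has_sum H h) multi_indices"
      and eq: "\<And>A. A \<in> sets borel \<Longrightarrow> A \<subseteq> ball x \<delta> \<Longrightarrow>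
         emeasure \<mu> A = (\<integral>\<^sup>+y. ennreal (H (y - x)) * indicator A y \<partial>lborel)"
      by (rule local_density_at) (rule that)
    have Hx: "continuous_on (ball x \<delta>) (\<lambda>y. H (y - x))"
      by (intro continuous_on_compose2[OF H(1)] continuous_intros) (auto simp: dist_norm norm_minus_commute)
    have H0: "0 \<le> H (y - x)" if "y \<in> ball x \<delta>" for y
      using that by (intro H(2)) (simp add: dist_norm norm_minus_commute)
    have "\<forall>y\<in>ball x \<delta>. F y = H (y - x)"
      using \<delta> Hx H0 density_eq_ae[OF f \<delta> Hx H0 eq] by (intro F(3)) blast
    then have "F (x + h) = H h" if "norm h < \<delta>" for h
      using bspec[of "ball x \<delta>" _ "x + h"] that by (simp add: dist_norm)
    then show "\<exists>r>0. \<exists>c. \<forall>h. norm h < r \<longrightarrow>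
        ((\<lambda>\<alpha>. c \<alpha> * (\<Prod>i\<in>Basis. (h \<bullet> i) ^ \<alpha> i)) has_sum F (x + h)) multi_indices"
      using \<delta> ser by (intro exI[of _ \<delta>] conjI exI[of _ c]) auto
  qed
  then show ?thesis using Fm F(2) dens by blast
qed

end

theorem theorem5p1:
  fixes Z K :: "'a::euclidean_space set"
    and \<iota> :: "'a \<Rightarrow> 'a"
    and \<mu> :: "'a measure"
  assumes inv: "is_inversion \<iota>"
    and lat: "is_lattice Z"
    and K: "dirichlet_with_boundary_choice Z K"
    and integral: "integral_lattice Z"
    and unit: "unit_generated Z"
    and ne: "norm_euclidean K"
    and ni: "nicely_invertible Z \<iota>"
    and remote: "remote3 Z K \<or> remote7 Z K"
    and sets_mu: "sets \<mu> = sets lebesgue"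
    and prob: "prob_space \<mu>"
    and T_meas: "cf_map \<iota> Z K \<in> measurable \<mu> \<mu>"
    and T_inv: "\<forall>A\<in>sets \<mu>. emeasure \<mu> (cf_map \<iota> Z K -` A \<inter> space \<mu>) = emeasure \<mu> A"
    and equiv: "\<forall>A\<in>sets lebesgue.
                  (emeasure \<mu> A = 0 \<longleftrightarrow> emeasure lebesgue (A \<inter> dirichlet Z) = 0)"
  shows "\<exists>f :: 'a \<Rightarrow> real. f \<in> borel_measurable lebesgue \<and> (\<forall>x. 0 \<le> f x)
           \<and> \<mu> = density lebesgue (\<lambda>x. ennreal (f x))
           \<and> (\<forall>C \<in> components (K - (\<Union>n. (cf_map \<iota> Z K ^^ n) ` frontier K)).
                 real_analytic_on f C)"
proof -
  obtain Q where Q: "orthogonal_transformation Q"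
    and \<iota>: "\<And>x. x \<noteq> 0 \<Longrightarrow> \<iota> x = (1 / (norm x)\<^sup>2) *\<^sub>R Q x" and \<iota>0: "\<iota> 0 = 0" and \<iota>\<iota>: "\<And>x. \<iota> (\<iota> x) = x"
    using inv by (auto simp: is_inversion_def)
  have lin: "linear Q" and nQ: "\<And>x. norm (Q x) = norm x"
    using Q by (auto simp: orthogonal_transformation)
  have Q0: "Q 0 = 0" using linear_0[OF lin] .
  have QQ: "Q (Q x) = x" for x
  proof (cases "x = 0")
    case False
    have "\<iota> x \<noteq> 0" using False \<iota>0 \<iota>\<iota> by metis
    then have "x = (1 / (norm (\<iota> x))\<^sup>2) *\<^sub>R Q (\<iota> x)" using \<iota> \<iota>\<iota> by metis
    also have "norm (\<iota> x) = 1 / norm x" using False by (simp add: \<iota> nQ power2_eq_square)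
    also have "Q (\<iota> x) = (1 / (norm x)\<^sup>2) *\<^sub>R Q (Q x)" using False by (simp add: \<iota> linear_cmul[OF lin])
    finally show ?thesis using False by (simp add: power_divide)
  qed (simp add: Q0)
  have \<iota>': "\<iota> x = Q x /\<^sub>R (norm x)\<^sup>2" for x
    by (cases "x = 0") (simp_all add: \<iota> \<iota>0 Q0 inverse_eq_divide)
  have QZ: "Q z \<in> Z" if "z \<in> Z" for z
  proof (cases "z = 0")
    case True
    then show ?thesis using that Q0 by simp
  next
    case False
    then have "(norm z)\<^sup>2 *\<^sub>R \<iota> z \<in> Z" using ni that by (simp add: nicely_invertible_def)
    then show ?thesis using False by (simp add: \<iota>)
  qed
  interpret cf_measure \<iota> Q Z K \<mu>
    by (intro cf_measure.intro cf_system.intro inversion.intro cf_system_axioms.intro cf_measure_axioms.intro)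
      (fact Q QQ \<iota>' lat K integral unit ne QZ remote sets_mu prob T_meas T_inv equiv)+
  show ?thesis by (rule analytic_density)
qed

end
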